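(* Let $\tau(P,P',\beta,q)$ be the generating function of weighted numbers of (possibly disconnected) coverings of $\mathbb{P}^1$ with arbitrary ramification over $0,\infty$ and simple ramification elsewhere, as defined in the context. Then $$ \frac{\partial^2}{\partial p_1\,\partial p'_1}\,\log\tau(P,P',\beta,q)\;=\;q\,\frac{\tau(P,P',\beta,e^{\beta}q)\;\tau(P,P',\beta,e^{-\beta}q)}{\tau(P,P',\beta,q)^2}. $$
   Context: Let $S(d)$ denote the symmetric group, and for a partition $\mu$ of $d$ let $C_\mu\subset S(d)$ be the conjugacy class of permutations of cycle type $\mu$. Let $C_{(2)}\subset S(d)$ be the conjugacy class of transpositions (empty if $d<2$). For conjugacy classes $C_1,\dots,C_s\subset S(d)$, $\mathrm{Cov}_d(C_1,\dots,C_s)$ denotes the weighted number of $d$-fold coverings of $\mathbb{P}^1$, not necessarily connected, ramified over $s$ fixed points of $\mathbb{P}^1$ with monodromies in $C_1,\dots,C_s$ respectively. Each covering is weighted by the reciprocal of the order of its automorphism group. Equivalently, $\mathrm{Cov}_d(C_1,\dots,C_s)=\frac1{d!}\#\{(g_1,\dots,g_s): g_i\in C_i,\ g_1\cdots g_s=1\}$. For $d=0$ the empty covering contributes $1$ (to the term with $b=0$ below). Let $P=(p_1,p_2,\dots)$ and $P'=(p'_1,p'_2,\dots)$ be two sequences of independent variables, and let $\beta,q$ be further formal variables. For a partition $\mu$, put $p_\mu=\prod_i p_{\mu_i}$ and $p'_\mu=\prod_i p'_{\mu_i}$. Define the formal power series $$ \tau(P,P',\beta,q)=\sum_{d\ge0}\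 \sum_{b\ge 0}\ \sum_{|\mu|=|\nu|=d} q^d\,\frac{\beta^b}{b!}\,p_\mu\,p'_\nu\,\mathrm{Cov}_d\big(C_\mu,C_\nu,\underbrace{C_{(2)},\dots,C_{(2)}}_{b\text{ times}}\big). $$ The constant term of $\tau$ in $q$ is $1$, so $\log\tau$ and $1/\tau^2$ are well-defined formal power series; $e^{\pm\beta}$ is expanded as a power series in $\beta$. *)

theory Defs
  imports
    "HOL-Computational_Algebra.Formal_Power_Series"
    "HOL-Library.Poly_Mapping"
    "HOL-Library.Multiset"
    "HOL-Combinatorics.Permutations"
    "HOL-Combinatorics.Orbits"
begin

unbundle fps_syntax

section \<open>Weighted counts of branched coverings\<close>

definition partitions :: "nat \<Rightarrow> nat multiset set" where
  "partitions d = {\<mu>. 0 \<notin># \<mu> \<and> \<Sum>\<^sub># \<mu> = d}"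

text \<open>\<open>S(d)\<close> is the set of permutations of \<open>{..<d}\<close>.  Fixed points are orbits of size one,
  so the cycle type of an element of \<open>S(d)\<close> is a partition of \<open>d\<close>.\<close>

definition cycle_type :: "nat \<Rightarrow> (nat \<Rightarrow> nat) \<Rightarrow> nat multiset" where
  "cycle_type d g = image_mset card (mset_set (orbit g ` {..<d}))"

definition conj_class :: "nat \<Rightarrow> nat multiset \<Rightarrow> (nat \<Rightarrow> nat) set" where
  "conj_class d \<mu> = {g. g permutes {..<d} \<and> cycle_type d g = \<mu>}"

definition transpositions :: "nat \<Rightarrow> (nat \<Rightarrow> nat) set" where
  "transpositions d = {transpose i j | i j. i < d \<and> j < d \<and> i \<noteq> j}"

text \<open>The automorphism-weighted number of \<open>d\<close>-fold coverings of the projective line with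
  monodromies in the classes \<open>Cs\<close>, expressed through monodromy tuples.\<close>

definition Cov :: "nat \<Rightarrow> (nat \<Rightarrow> nat) set list \<Rightarrow> rat" where
  "Cov d Cs = of_nat (card {gs \<in> listset Cs. foldr (\<circ>) gs id = id}) / fact d"


section \<open>The power series ring\<close>

text \<open>Every coefficient of \<open>q^d \<beta>^b\<close> in the series considered here is a polynomial in the
  \<open>p\<^sub>i\<close> and \<open>p'\<^sub>i\<close>, so they all live in the subring \<open>\<rat>[P,P'][[\<beta>]][[q]]\<close> of
  \<open>\<rat>[[P,P',\<beta>,q]]\<close>.  The variables are \<open>P i\<close> and \<open>P' i\<close> for \<open>i \<ge> 1\<close>; index \<open>0\<close> never occurs.\<close>

datatype pvar = P nat | P' nat

type_synonym ppoly = "(pvar \<Rightarrow>\<^sub>0 nat) \<Rightarrow>\<^sub>0 rat"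
type_synonym bseries = "ppoly fps"
type_synonym qseries = "bseries fps"

definition pconst :: "rat \<Rightarrow> ppoly" where
  "pconst c = Poly_Mapping.single 0 c"

definition var_poly :: "pvar \<Rightarrow> ppoly" where
  "var_poly v = Poly_Mapping.single (Poly_Mapping.single v 1) 1"

definition ppoly_deriv :: "pvar \<Rightarrow> ppoly \<Rightarrow> ppoly" where
  "ppoly_deriv v f = (\<Sum>m\<in>Poly_Mapping.keys f.
     Poly_Mapping.single (m - Poly_Mapping.single v 1)
       (of_nat (Poly_Mapping.lookup m v) * Poly_Mapping.lookup f m))"

definition fps_map :: "('a \<Rightarrow> 'b) \<Rightarrow> 'a fps \<Rightarrow> 'b fps" where
  "fps_map h f = Abs_fps (\<lambda>n. h (f $ n))"

definition partial :: "pvar \<Rightarrow> qseries \<Rightarrow> qseries" where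
  "partial v = fps_map (fps_map (ppoly_deriv v))"

text \<open>\<open>exp_beta c\<close> is \<open>e\<^bsup>c\<beta>\<^esup>\<close>.\<close>

definition exp_beta :: "rat \<Rightarrow> bseries" where
  "exp_beta c = fps_map pconst (fps_exp c)"

text \<open>The library series \<open>fps_ln 1\<close> is \<open>log (1 + X)\<close>.  The argument of \<open>qlog\<close> is meant to have
  constant term \<open>1\<close> in \<open>q\<close>.\<close>

definition qlog :: "qseries \<Rightarrow> qseries" where
  "qlog f = fps_map (\<lambda>c. fps_const (pconst c)) (fps_ln 1) oo (f - 1)"

text \<open>The coefficient ring is not a field, so the reciprocal is the library's
  \<open>fps_right_inverse\<close>, with the inverse of the constant term supplied (here \<open>1\<close>).\<close>

definition qrecip :: "qseries \<Rightarrow> qseries" where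
  "qrecip f = fps_right_inverse f 1"

text \<open>\<open>subst_q c f\<close> is \<open>f\<close> with \<open>q\<close> replaced by \<open>c q\<close>.\<close>

definition subst_q :: "bseries \<Rightarrow> qseries \<Rightarrow> qseries" where
  "subst_q c f = f oo (fps_const c * fps_X)"


section \<open>The generating function\<close>

definition tau :: qseries where
  "tau = Abs_fps (\<lambda>d. Abs_fps (\<lambda>b.
     \<Sum>\<mu>\<in>partitions d. \<Sum>\<nu>\<in>partitions d.
       pconst (Cov d (conj_class d \<mu> # conj_class d \<nu> # replicate b (transpositions d)) / fact b)
         * (\<Prod>i\<in>#\<mu>. var_poly (P i)) * (\<Prod>i\<in>#\<nu>. var_poly (P' i))))"


section \<open>Well-definedness\<close>

text \<open>Infinite index sets would silently make \<open>sum\<close> and \<open>card\<close> zero.\<close>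

lemma finite_partitions: "finite (partitions d)"
proof -
  have "\<mu> \<in> mset ` {xs. set xs \<subseteq> {..d} \<and> length xs \<le> d}" if "\<mu> \<in> partitions d" for \<mu>
  proof -
    obtain xs where xs: "\<mu> = mset xs" using ex_mset by metis
    with that have z: "0 \<notin> set xs" and s: "sum_list xs = d"
      by (auto simp: partitions_def sum_mset_sum_list)
    have "length xs \<le> sum_list xs" using z
      by (induction xs) auto
    moreover have "set xs \<subseteq> {..d}" using s member_le_sum_list by fastforce
    ultimately show ?thesis using s xs by auto
  qed
  then have "partitions d \<subseteq> mset ` {xs. set xs \<subseteq> {..d} \<and> length xs \<le> d}" by blast
  then show ?thesis
    by (rule finite_subset) (intro finite_imageI finite_lists_length_le finite_atMost)
qed

lemma finite_listset: "(\<And>C. C \<in> set Cs \<Longrightarrow> finite C) \<Longrightarrow> finite (listset Cs)"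
proof (induction Cs)
  case (Cons A As)
  have "set_Cons A (listset As) = case_prod (#) ` (A \<times> listset As)"
    by (auto simp: set_Cons_def)
  with Cons show ?case by simp
qed simp

lemma finite_conj_class: "finite (conj_class d \<mu>)"
  by (rule finite_subset[OF _ finite_permutations[of "{..<d}"]]) (auto simp: conj_class_def)

lemma finite_transpositions: "finite (transpositions d)"
  by (rule finite_subset[of _ "case_prod transpose ` ({..<d} \<times> {..<d})"])
     (auto simp: transpositions_def)

lemma tau_nth_0: "tau $ 0 = 1"
proof (rule fps_ext)
  fix b
  have p: "partitions 0 = {{#}}"
    by (auto simp: partitions_def) (metis multiset_nonemptyE)
  have c: "conj_class 0 {#} = {id}"
    by (auto simp: conj_class_def cycle_type_def)
  have t: "transpositions 0 = {}" by (auto simp: transpositions_def)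
  have "{gs \<in> listset ({id} # {id} # replicate b (transpositions 0)). foldr (\<circ>) gs id = id}
        = (if b = 0 then {[id, id]} else {})"
    by (cases b) (auto simp: t set_Cons_def)
  then show "tau $ 0 $ b = 1 $ b"
    unfolding tau_def
    by (simp add: p c Cov_def pconst_def)
qed

lemma qrecip_tau_square: "tau\<^sup>2 * qrecip (tau\<^sup>2) = 1"
  unfolding qrecip_def
  by (rule fps_right_inverse) (simp add: tau_nth_0 power2_eq_square)

end

theory Submission
  imports Defs "Jordan_Normal_Form.Determinant" "HOL-Computational_Algebra.Polynomial_FPS"
begin

text \<open>Expanding in Schur functions, \<open>\<tau>\<close> is the sum over partitions \<open>\<lambda>\<close> of
  \<open>q^|\<lambda>| e^(\<beta> c(\<lambda>)) s\<^sub>\<lambda>(P) s\<^sub>\<lambda>(P')\<close>, where \<open>c(\<lambda>)\<close> is the sum of the contents. By Cauchy--Binet the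
  part with at most \<open>m\<close> rows is, up to elementary factors, the \<open>m \<times> m\<close> Wronskian determinant of the
  \<open>\<partial>\<^sub>1^j \<partial>'\<^sub>1^k f\<close> with \<open>f = \<Sum> q^l e^(\<beta>(l(l-1)/2 + s l)) h\<^sub>l(P) h\<^sub>l(P')\<close>, and the
  Desnanot--Jacobi identity relates the sizes \<open>m - 1\<close>, \<open>m\<close>, \<open>m + 1\<close> as in the Toda equation; the change
  of size becomes the rescaling of \<open>q\<close> by \<open>e^\<beta>\<close> and \<open>e^(-\<beta>)\<close>. The limit of large \<open>m\<close> is taken coefficientwise.

  Characters of \<open>S(d)\<close> are avoided. Substitute for \<open>p'\<^sub>k\<close> the power sums of \<open>m\<close> variables \<open>y\<^sub>i\<close>,
  which loses nothing in degree at most \<open>m\<close>. The monomial of a permutation becomes a sum over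
  invariant colourings; multiplication by transpositions becomes a differential operator in the \<open>y\<^sub>i\<close> that
  conjugation by the Vandermonde determinant makes diagonal on monomials. The determinant times the
  Vandermonde determinant obeys the same evolution in \<open>\<beta>\<close> with the same value at \<open>\<beta> = 0\<close>.\<close>

text \<open>The determinant of size m matches \<tau> only at its own parameter s = 1 - m: the
  content sum is made of l(l-1)/2 - (m-1)l over the shifted parts l, and m enters it linearly in l.
  Desnanot--Jacobi wants three sizes with one common s, so the two outer ones are evaluated one off
  their own value. That multiplies the coefficient of q^l in f by e^(\<beta>l) or e^(-\<beta>l),
  hence the two rescaled arguments. The factor q is the second difference of m(m-1)/2, the lowest
  q-degree of these determinants.

  The limit is attained: up to q^m the normalised determinant agrees with \<tau> exactly, so each
  coefficient of q^d needs only sizes beyond d. The delicate point is undoing the specialisation. It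
  rests on the algebraic independence of m power sums in m variables, so every coefficient compared
  must be shown to involve p'_1, ..., p'_m only. Division is avoided throughout: Vandermonde
  factors, powers of q and determinants are cancelled in integral domains.\<close>

no_notation vec_index (infixl "$" 100)

section \<open>Polynomials\<close>

text \<open>A linear order on the variables orders the exponent vectors lexicographically and
  compatibly with addition. This makes \<open>ppoly\<close>, and the series rings over it, integral
  domains, on which the later cancellations depend.\<close>

instantiation pvar :: linorder
begin

definition less_eq_pvar :: "pvar \<Rightarrow> pvar \<Rightarrow> bool" where
  "less_eq_pvar v w = (case v of
     P i \<Rightarrow> (case w of P j \<Rightarrow> i \<le> j | P' j \<Rightarrow> True)
   | P' i \<Rightarrow> (case w of P j \<Rightarrow> False | P' j \<Rightarrow> i \<le> j))"

definition less_pvar :: "pvar \<Rightarrow> pvar \<Rightarrow> bool" where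
  "less_pvar v w \<longleftrightarrow> v \<le> w \<and> \<not> w \<le> v"

instance
  by standard (auto simp: less_eq_pvar_def less_pvar_def split: pvar.splits)

end

section \<open>Derivations and partial derivatives\<close>

locale derivation =
  fixes d :: "'a::comm_ring_1 \<Rightarrow> 'a"
  assumes add: "d (x + y) = d x + d y"
    and mult: "d (x * y) = d x * y + x * d y"
begin

lemma zero [simp]: "d 0 = 0"
  using add[of 0 0] by simp

lemma one [simp]: "d 1 = 0"
  using mult[of 1 1] by simp

lemma uminus: "d (- x) = - d x"
  using add[of x "- x"] by (simp add: eq_neg_iff_add_eq_0 add.commute)

lemma diff: "d (x - y) = d x - d y"
  using add[of x "- y"] by (simp add: uminus)

lemma sum: "d (\<Sum>x\<in>A. f x) = (\<Sum>x\<in>A. d (f x))"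
  by (induction A rule: infinite_finite_induct) (auto simp: add)

lemma prod: "finite A \<Longrightarrow> d (\<Prod>x\<in>A. f x) = (\<Sum>x\<in>A. d (f x) * (\<Prod>y\<in>A - {x}. f y))"
proof (induction A rule: finite_induct)
  case (insert a A)
  have "(\<Prod>y\<in>insert a A - {x}. f y) = f a * (\<Prod>y\<in>A - {x}. f y)" if "x \<in> A" for x
  proof -
    have "insert a A - {x} = insert a (A - {x})" using insert that by auto
    then show ?thesis using insert by simp
  qed
  moreover have "insert a A - {a} = A" using insert by auto
  ultimately show ?case
    using insert by (simp add: mult sum_distrib_left algebra_simps cong: sum.cong)
qed simp

lemma of_nat: "d (of_nat n) = 0"
  by (induction n) (auto simp: add)

lemma power: "d (x ^ n) = of_nat n * x ^ (n - 1) * d x"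
proof (induction n)
  case (Suc n)
  then show ?case by (cases n) (auto simp: mult algebra_simps)
qed simp

lemma sign: "d (signof p) = 0"
  by (auto simp: sign_def uminus)

end

lemma derivation_scale: "derivation d \<Longrightarrow> derivation (\<lambda>f. a * d f)"
  by (auto simp: derivation_def algebra_simps)

lemma lookup_pderiv:
  "Poly_Mapping.lookup (ppoly_deriv v f) m =
     of_nat (Poly_Mapping.lookup m v + 1) * Poly_Mapping.lookup f (m + Poly_Mapping.single v 1)"
proof -
  \<comment> \<open>Subtraction of exponents truncates, so a monomial without \<open>v\<close> is
    sent to itself. Its coefficient is then 0, which the condition on \<open>lookup n v\<close>
    reflects.\<close>
  have *: "(n - Poly_Mapping.single v 1 = m \<and> Poly_Mapping.lookup n v \<noteq> 0)
      \<longleftrightarrow> n = m + Poly_Mapping.single v 1" for n :: "pvar \<Rightarrow>\<^sub>0 nat"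
    by (auto simp: poly_mapping_eq_iff fun_eq_iff lookup_add lookup_minus lookup_single when_def
        split: if_splits)
  have "Poly_Mapping.lookup (ppoly_deriv v f) m =
     (\<Sum>n\<in>Poly_Mapping.keys f. if n = m + Poly_Mapping.single v 1
        then of_nat (Poly_Mapping.lookup n v) * Poly_Mapping.lookup f n else 0)"
    unfolding ppoly_deriv_def lookup_sum
  proof (rule sum.cong[OF refl])
    fix n assume "n \<in> Poly_Mapping.keys f"
    show "Poly_Mapping.lookup (Poly_Mapping.single (n - Poly_Mapping.single v 1)
         (of_nat (Poly_Mapping.lookup n v) * Poly_Mapping.lookup f n)) m =
       (if n = m + Poly_Mapping.single v 1
        then of_nat (Poly_Mapping.lookup n v) * Poly_Mapping.lookup f n else 0)"
      unfolding lookup_single when_def using *[of n] by (metis mult_eq_0_iff of_nat_0)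
  qed
  also have "\<dots> = of_nat (Poly_Mapping.lookup m v + 1) * Poly_Mapping.lookup f (m + Poly_Mapping.single v 1)"
    by (auto simp: lookup_add in_keys_iff)
  finally show ?thesis .
qed

lemma pderiv_add: "ppoly_deriv v (f + g) = ppoly_deriv v f + ppoly_deriv v g"
  by (auto intro!: poly_mapping_eqI simp: lookup_pderiv lookup_add algebra_simps)

lemma pderiv_single: "ppoly_deriv v (Poly_Mapping.single m c) =
    Poly_Mapping.single (m - Poly_Mapping.single v 1) (of_nat (Poly_Mapping.lookup m v) * c)"
  by (simp add: ppoly_deriv_def)

lemma ppoly_sum_single:
  "(f :: ppoly) = (\<Sum>m\<in>Poly_Mapping.keys f. Poly_Mapping.single m (Poly_Mapping.lookup f m))"
  by (auto intro!: poly_mapping_eqI simp: lookup_sum lookup_single when_def in_keys_iff)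

lemma ppoly_induct_single [case_names single add]:
  assumes "\<And>m c. Q (Poly_Mapping.single m c)" and "\<And>f g. Q f \<Longrightarrow> Q g \<Longrightarrow> Q (f + g :: ppoly)"
  shows "Q f"
proof -
  have "Q 0" using assms(1)[of 0 0] by simp
  then have "Q (\<Sum>m\<in>A. Poly_Mapping.single m (Poly_Mapping.lookup f m))" for A
    by (induction A rule: infinite_finite_induct) (auto intro: assms)
  then show ?thesis by (subst ppoly_sum_single)
qed

lemma derivation_pderiv: "derivation (ppoly_deriv v)"
proof
  have *: "ppoly_deriv v (Poly_Mapping.single m c * Poly_Mapping.single n e) =
     ppoly_deriv v (Poly_Mapping.single m c) * Poly_Mapping.single n e +
     Poly_Mapping.single m c * ppoly_deriv v (Poly_Mapping.single n e)" for m n c e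
  proof -
    have "m - Poly_Mapping.single v 1 + n = m + n - Poly_Mapping.single v 1"
      if "Poly_Mapping.lookup m v > 0" for m n :: "pvar \<Rightarrow>\<^sub>0 nat"
    proof (rule poly_mapping_eqI)
      fix w show "Poly_Mapping.lookup (m - Poly_Mapping.single v 1 + n) w =
          Poly_Mapping.lookup (m + n - Poly_Mapping.single v 1) w"
        using that by (cases "w = v") (auto simp: lookup_add lookup_minus lookup_single when_def)
    qed
    from this[of m n] this[of n m] show ?thesis
      by (cases "Poly_Mapping.lookup m v > 0"; cases "Poly_Mapping.lookup n v > 0")
         (auto simp: pderiv_single mult_single lookup_add algebra_simps simp flip: single_add)
  qed
  have **: "ppoly_deriv v (f * Poly_Mapping.single n e) =
     ppoly_deriv v f * Poly_Mapping.single n e + f * ppoly_deriv v (Poly_Mapping.single n e)" for f n e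
    by (induction f rule: ppoly_induct_single) (auto simp: * pderiv_add algebra_simps)
  fix f g
  show "ppoly_deriv v (f * g) = ppoly_deriv v f * g + f * ppoly_deriv v g"
    by (induction g rule: ppoly_induct_single) (auto simp: ** pderiv_add algebra_simps)
qed (rule pderiv_add)

interpretation pderiv: derivation "ppoly_deriv v" for v
  by (rule derivation_pderiv)

lemma pderiv_pconst [simp]: "ppoly_deriv v (pconst c) = 0"
  by (simp add: pconst_def pderiv_single)

lemma pderiv_var [simp]: "ppoly_deriv v (var_poly w) = (if v = w then 1 else 0)"
  by (auto simp: var_poly_def pderiv_single lookup_single when_def)

lemma pconst_0 [simp]: "pconst 0 = 0"
  and pconst_1 [simp]: "pconst 1 = 1"
  and pconst_add: "pconst (a + b) = pconst a + pconst b"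
  and pconst_mult: "pconst (a * b) = pconst a * pconst b"
  and pconst_uminus: "pconst (- a) = - pconst a"
  and pconst_diff: "pconst (a - b) = pconst a - pconst b"
  by (auto simp: pconst_def single_add mult_single single_uminus single_diff)

interpretation pconst: comm_ring_hom pconst
  by standard (auto simp: pconst_add pconst_mult)

lemma pconst_of_nat [simp]: "pconst (of_nat n) = of_nat n"
  by (induction n) (auto simp: pconst_add)

lemma ppoly_pderiv_eq_0:
  assumes "ppoly_deriv v f = 0" "m \<in> Poly_Mapping.keys f"
  shows "Poly_Mapping.lookup m v = 0"
proof (rule ccontr)
  assume "Poly_Mapping.lookup m v \<noteq> 0"
  then have "m = (m - Poly_Mapping.single v 1) + Poly_Mapping.single v 1"
    by (auto intro!: poly_mapping_eqI simp: lookup_add lookup_minus lookup_single when_def)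
  then have "Poly_Mapping.lookup (ppoly_deriv v f) (m - Poly_Mapping.single v 1) =
      of_nat (Poly_Mapping.lookup (m - Poly_Mapping.single v 1) v + 1) * Poly_Mapping.lookup f m"
    by (subst lookup_pderiv) simp
  also have "\<dots> \<noteq> 0" using assms(2) by (auto simp: in_keys_iff simp del: of_nat_Suc of_nat_add)
  finally show False using assms(1) by simp
qed

subsection \<open>Substitution\<close>

definition psubst :: "(pvar \<Rightarrow> ppoly) \<Rightarrow> ppoly \<Rightarrow> ppoly" where
  "psubst \<phi> f = (\<Sum>m\<in>Poly_Mapping.keys f. pconst (Poly_Mapping.lookup f m) *
     (\<Prod>v\<in>Poly_Mapping.keys m. \<phi> v ^ Poly_Mapping.lookup m v))"

lemma psubst_add: "psubst \<phi> (f + g) = psubst \<phi> f + psubst \<phi> g"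
proof -
  have *: "psubst \<phi> f = (\<Sum>m\<in>A. pconst (Poly_Mapping.lookup f m) *
     (\<Prod>v\<in>Poly_Mapping.keys m. \<phi> v ^ Poly_Mapping.lookup m v))"
    if "finite A" "Poly_Mapping.keys f \<subseteq> A" for f A
    unfolding psubst_def by (rule sum.mono_neutral_left) (use that in \<open>auto simp: in_keys_iff\<close>)
  let ?A = "Poly_Mapping.keys f \<union> Poly_Mapping.keys g"
  show ?thesis
    by (subst (1 2 3) *[where A = ?A])
       (auto simp: keys_add lookup_add pconst_add algebra_simps sum.distrib dest: subsetD[OF keys_add])
qed

lemma psubst_single: "psubst \<phi> (Poly_Mapping.single m c) = pconst c *
     (\<Prod>v\<in>Poly_Mapping.keys m. \<phi> v ^ Poly_Mapping.lookup m v)"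
  by (simp add: psubst_def)

lemma psubst_mult: "psubst \<phi> (f * g) = psubst \<phi> f * psubst \<phi> g"
proof -
  have *: "psubst \<phi> (Poly_Mapping.single m c * Poly_Mapping.single n e) =
     psubst \<phi> (Poly_Mapping.single m c) * psubst \<phi> (Poly_Mapping.single n e)" for m n c e
  proof -
    let ?A = "Poly_Mapping.keys m \<union> Poly_Mapping.keys n"
    have "(\<Prod>v\<in>Poly_Mapping.keys k. \<phi> v ^ Poly_Mapping.lookup k v) = (\<Prod>v\<in>?A. \<phi> v ^ Poly_Mapping.lookup k v)"
      if "Poly_Mapping.keys k \<subseteq> ?A" for k
      by (rule prod.mono_neutral_left) (use that in \<open>auto simp: in_keys_iff\<close>)
    from this[of m] this[of n] this[of "m + n"] keys_add[of m n] show ?thesis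
      by (simp add: mult_single psubst_single lookup_add power_add prod.distrib pconst_mult algebra_simps)
  qed
  have **: "psubst \<phi> (f * Poly_Mapping.single n e) = psubst \<phi> f * psubst \<phi> (Poly_Mapping.single n e)" for f n e
    by (induction f rule: ppoly_induct_single) (auto simp: * psubst_add algebra_simps)
  show ?thesis
    by (induction g rule: ppoly_induct_single) (auto simp: ** psubst_add algebra_simps)
qed

lemma psubst_pconst [simp]: "psubst \<phi> (pconst c) = pconst c"
  by (simp add: pconst_def psubst_single mult_single flip: single_one)

lemma psubst_var [simp]: "psubst \<phi> (var_poly v) = \<phi> v"
  by (simp add: var_poly_def psubst_single)

interpretation psubst: comm_ring_hom "psubst \<phi>" for \<phi>
proof
  show "psubst \<phi> 0 = 0" using psubst_pconst[of \<phi> 0] by simp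
  show "psubst \<phi> 1 = 1" using psubst_pconst[of \<phi> 1] by simp
qed (auto simp: psubst_add psubst_mult)

lemma prod_var_poly: "finite A \<Longrightarrow> (\<Prod>v\<in>A. var_poly v ^ k v) = Poly_Mapping.single (\<Sum>v\<in>A. Poly_Mapping.single v (k v)) 1"
proof (induction A rule: finite_induct)
  case (insert a A)
  have "var_poly v ^ j = Poly_Mapping.single (Poly_Mapping.single v j) 1" for v j
    by (induction j) (auto simp: var_poly_def mult_single simp flip: single_add)
  with insert show ?case by (simp add: mult_single)
qed simp

lemma single_eq_prod: "Poly_Mapping.single m c = pconst c * (\<Prod>v\<in>Poly_Mapping.keys m. var_poly v ^ Poly_Mapping.lookup m v)"
proof -
  have "m = (\<Sum>v\<in>Poly_Mapping.keys m. Poly_Mapping.single v (Poly_Mapping.lookup m v))"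
    by (auto intro!: poly_mapping_eqI simp: lookup_sum lookup_single when_def in_keys_iff)
  then show ?thesis
    by (subst prod_var_poly) (auto simp: pconst_def mult_single)
qed

section \<open>Coefficientwise maps on power series\<close>

lemma fps_map_nth [simp]: "fps_map h f $ n = h (f $ n)"
  by (simp add: fps_map_def)

lemma derivation_fps_map: "derivation d \<Longrightarrow> derivation (fps_map d)"
proof -
  assume "derivation d"
  then interpret derivation d .
  show ?thesis
    by standard (auto intro!: fps_ext simp: add fps_mult_nth sum mult sum.distrib)
qed

lemma comm_ring_hom_fps_map: "comm_ring_hom h \<Longrightarrow> comm_ring_hom (fps_map h)"
proof -
  assume "comm_ring_hom h"
  then interpret comm_ring_hom h .
  show ?thesis
    by standard (auto intro!: fps_ext simp: hom_distribs fps_mult_nth)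
qed

interpretation partial: derivation "partial v" for v
  unfolding partial_def by (intro derivation_fps_map derivation_pderiv)

lemma partial_nth [simp]: "partial v f $ d $ b = ppoly_deriv v (f $ d $ b)"
  by (simp add: partial_def)

lemma exp_beta_nth [simp]: "exp_beta c $ n = pconst (c ^ n / fact n)"
  by (simp add: exp_beta_def)

lemma exp_beta_0 [simp]: "exp_beta 0 = 1"
  by (rule fps_ext) (simp add: power_0_left)

lemma exp_beta_add: "exp_beta (a + b) = exp_beta a * exp_beta b"
proof -
  interpret comm_ring_hom "fps_map pconst" by (rule comm_ring_hom_fps_map) (rule pconst.comm_ring_hom_axioms)
  show ?thesis by (simp add: exp_beta_def fps_exp_add_mult hom_mult)
qed

lemma exp_beta_power: "exp_beta c ^ n = exp_beta (of_nat n * c)"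
  by (induction n) (auto simp: exp_beta_add algebra_simps)

lemma exp_beta_inverse: "exp_beta c * exp_beta (- c) = 1"
  by (simp flip: exp_beta_add)

lemma subst_q_nth [simp]: "subst_q c f $ d = c ^ d * f $ d"
  by (simp add: subst_q_def fps_compose_linear)

lemma subst_q_mult: "subst_q c (f * g) = subst_q c f * subst_q c g"
proof (rule fps_ext)
  fix n
  have "c ^ n * (f $ i * g $ (n - i)) = (c ^ i * f $ i) * (c ^ (n - i) * g $ (n - i))" if "i \<in> {0..n}" for i
  proof -
    have "c ^ n = c ^ i * c ^ (n - i)" using that by (simp flip: power_add)
    then show ?thesis by simp
  qed
  then show "subst_q c (f * g) $ n = (subst_q c f * subst_q c g) $ n"
    unfolding fps_mult_nth subst_q_nth sum_distrib_left by (intro sum.cong) auto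
qed

interpretation subst_q: comm_ring_hom "subst_q c" for c
proof
  show "subst_q c 1 = 1" by (rule fps_ext) simp
qed (auto intro!: fps_ext simp: subst_q_mult algebra_simps)

section \<open>Cycle-weighted sums over permutations\<close>

definition cycle_weight :: "(nat \<Rightarrow> ppoly) \<Rightarrow> nat set \<Rightarrow> (nat \<Rightarrow> nat) \<Rightarrow> ppoly" where
  "cycle_weight b A g = (\<Prod>C\<in>orbit g ` A. b (card C))"

text \<open>When \<open>b k\<close> is the k-th power sum, this is the complete homogeneous
  symmetric function of degree n, written as the cycle index of the symmetric group.\<close>

definition complete_sum :: "(nat \<Rightarrow> ppoly) \<Rightarrow> nat \<Rightarrow> ppoly" where
  "complete_sum b n = pconst (1 / fact n) * (\<Sum>g | g permutes {..<n}. cycle_weight b {..<n} g)"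

lemma prod_cycle_type: "(\<Prod>i\<in>#cycle_type d g. b i) = cycle_weight b {..<d} g"
  by (simp add: cycle_type_def cycle_weight_def prod_unfold_prod_mset multiset.map_comp comp_def)

lemma orbit_eq_iff:
  assumes "p permutes F" "finite F"
  shows "orbit p y = orbit p z \<longleftrightarrow> z \<in> orbit p y"
  using assms by (metis cyclic_on_orbit orbit_cyclic_eq3 permutation_permutes permutation_self_in_orbit)

text \<open>Here \<open>g\<close> sends \<open>x\<close> to \<open>z\<close> and the
  \<open>p\<close>-preimage of \<open>z\<close> to \<open>x\<close>: the new point is spliced into
  the cycle of \<open>z\<close> just before \<open>z\<close>, and all other cycles stay as they
  were.\<close>

lemma orbits_insert:
  assumes p: "p permutes F" and F: "finite F" "x \<notin> F" "z \<in> F"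
  defines "g \<equiv> transpose x z \<circ> p"
  shows "orbit g x = insert x (orbit p z)"
    and "orbit g ` insert x F - {orbit g x} = orbit p ` F - {orbit p z}"
proof -
  have pF: "p y \<in> F" if "y \<in> F" for y using p that by (simp add: permutes_in_image)
  have px: "p x = x" using p F by (simp add: permutes_def)
  have gx: "g x = z" using px by (simp add: g_def)
  have gy: "g y = (if p y = z then x else p y)" if "y \<in> F" for y
    using pF[OF that] F by (auto simp: g_def transpose_def)
  have g: "g permutes insert x F"
    unfolding g_def using p F by (intro permutes_compose permutes_swap_id) (auto intro: permutes_subset)
  have perm: "permutation p" "permutation g"
    using p g F by (auto simp: permutation_permutes)
  have sub: "orbit p z \<subseteq> F" by (rule permutes_orbit_subset[OF p \<open>z \<in> F\<close>])
  show 1: "orbit g x = insert x (orbit p z)"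
  proof (intro Set.set_eqI iffI)
    fix y assume "y \<in> orbit g x"
    then show "y \<in> insert x (orbit p z)"
    proof induction
      case base
      show ?case using gx perm(1) by (simp add: permutation_self_in_orbit)
    next
      case (step y)
      show ?case
      proof (cases "y = x")
        case True
        then show ?thesis using gx perm(1) by (simp add: permutation_self_in_orbit)
      next
        case False
        then have y: "y \<in> orbit p z" using step by simp
        then have "g y = (if p y = z then x else p y)" using gy sub by blast
        then show ?thesis using orbit.step[OF y] by simp
      qed
    qed
  next
    have z: "z \<in> orbit g x" using orbit.base[of g x] gx by simp
    have s: "p y \<in> orbit g x" if "y \<in> orbit g x" "y \<in> F" for y
      using orbit.step[OF that(1)] gy[OF that(2)] z by (auto split: if_splits)
    fix y assume "y \<in> insert x (orbit p z)"
    moreover have "y \<in> orbit g x" if "y \<in> orbit p z" for y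
      using that by induction (use s z \<open>z \<in> F\<close> sub in auto)
    ultimately show "y \<in> orbit g x"
      using perm(2) by (auto simp: permutation_self_in_orbit)
  qed
  have 2: "orbit g y = orbit p y" if "y \<in> F" "z \<notin> orbit p y" for y
  proof (rule orbit_cong)
    show "y \<in> orbit p y" using perm(1) by (simp add: permutation_self_in_orbit)
    fix s assume s: "s \<in> orbit p y"
    then have "s \<in> F" using permutes_orbit_subset[OF p \<open>y \<in> F\<close>] by auto
    moreover have "p s \<noteq> z" using orbit.step[OF s] that by auto
    ultimately show "g s = p s" using gy by simp
  qed
  have 3: "orbit g y = orbit g x" if "y \<in> F" "z \<in> orbit p y" for y
  proof -
    have "orbit p y = orbit p z" using orbit_eq_iff[OF p F(1)] that by simp
    then have "y \<in> orbit p z" using perm(1) by (metis permutation_self_in_orbit)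
    then show ?thesis using 1 orbit_eq_iff[OF g] F by (metis finite_insert insertI2)
  qed
  have zz: "z \<in> orbit p z" using perm(1) by (simp add: permutation_self_in_orbit)
  show "orbit g ` insert x F - {orbit g x} = orbit p ` F - {orbit p z}"
  proof (intro Set.set_eqI iffI)
    fix C assume "C \<in> orbit g ` insert x F - {orbit g x}"
    then obtain y where y: "y \<in> F" "C = orbit g y" "C \<noteq> orbit g x" by auto
    then have "z \<notin> orbit p y" using 3 by auto
    then show "C \<in> orbit p ` F - {orbit p z}" using 2 y zz by auto
  next
    fix C assume "C \<in> orbit p ` F - {orbit p z}"
    then obtain y where y: "y \<in> F" "C = orbit p y" "orbit p y \<noteq> orbit p z" by auto
    then have z: "z \<notin> orbit p y" using orbit_eq_iff[OF p F(1)] by simp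
    moreover have "orbit p y \<noteq> orbit g x" using 1 z zz by auto
    ultimately show "C \<in> orbit g ` insert x F - {orbit g x}" using 2[OF y(1)] y by auto
  qed
qed

text \<open>The cycle through the marked point \<open>a\<close> carries its own weight \<open>f\<close>, so that inserting a point
  into that cycle only replaces \<open>f\<close> by \<open>f \<circ> Suc\<close>.\<close>

definition marked_sum :: "(nat \<Rightarrow> ppoly) \<Rightarrow> (nat \<Rightarrow> ppoly) \<Rightarrow> nat set \<Rightarrow> nat \<Rightarrow> ppoly" where
  "marked_sum b f A a = (\<Sum>g | g permutes A. f (card (orbit g a)) * (\<Prod>C\<in>orbit g ` A - {orbit g a}. b (card C)))"

lemma marked_sum_self:
  assumes "finite A" "a \<in> A"
  shows "marked_sum b b A a = (\<Sum>g | g permutes A. cycle_weight b A g)"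
  unfolding marked_sum_def cycle_weight_def
  by (intro sum.cong refl prod.remove[symmetric]) (use assms in auto)

text \<open>Every permutation of \<open>insert x F\<close> is uniquely
  \<open>transpose x z \<circ> p\<close> with \<open>p\<close> permuting \<open>F\<close>. For z = x
  the point is fixed and contributes \<open>f 1\<close>; otherwise it joins the cycle of
  \<open>z\<close>, which becomes the marked one and grows by 1.\<close>

lemma marked_sum_insert:
  assumes "finite F" "x \<notin> F"
  shows "marked_sum b f (insert x F) x =
    f 1 * (\<Sum>g | g permutes F. cycle_weight b F g) + (\<Sum>z\<in>F. marked_sum b (\<lambda>k. f (Suc k)) F z)"
proof -
  let ?w = "\<lambda>g. f (card (orbit g x)) * (\<Prod>C\<in>orbit g ` insert x F - {orbit g x}. b (card C))"
  have x: "?w p = f 1 * cycle_weight b F p" if p: "p permutes F" for p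
  proof -
    have o: "orbit p x = {x}" using p assms by (simp add: orbit_eq_singleton_iff permutes_def)
    have "{x} \<notin> orbit p ` F"
      using permutes_orbit_subset[OF p] orbit_nonempty[of p] assms by blast
    then have "orbit p ` insert x F - {orbit p x} = orbit p ` F" using o by auto
    then show ?thesis by (simp add: o cycle_weight_def)
  qed
  have z: "?w (transpose x z \<circ> p) =
      f (Suc (card (orbit p z))) * (\<Prod>C\<in>orbit p ` F - {orbit p z}. b (card C))"
    if "p permutes F" "z \<in> F" for p z
  proof -
    have "x \<notin> orbit p z" "finite (orbit p z)"
      using permutes_orbit_subset[OF that] assms finite_subset by auto
    then show ?thesis using orbits_insert[OF that(1) assms that(2)] by simp
  qed
  have "marked_sum b f (insert x F) x = (\<Sum>z\<in>insert x F. \<Sum>p | p permutes F. ?w (transpose x z \<circ> p))"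
    unfolding marked_sum_def by (rule sum_over_permutations_insert[OF assms])
  also have "\<dots> = (\<Sum>p | p permutes F. ?w p) + (\<Sum>z\<in>F. \<Sum>p | p permutes F. ?w (transpose x z \<circ> p))"
    using assms by simp
  also have "\<dots> = f 1 * (\<Sum>g | g permutes F. cycle_weight b F g) + (\<Sum>z\<in>F. marked_sum b (\<lambda>k. f (Suc k)) F z)"
    unfolding marked_sum_def sum_distrib_left
    by (intro arg_cong2[of _ _ _ _ "(+)"] sum.cong refl) (use x z in auto)
  finally show ?thesis .
qed

lemma sum_shift: "(\<Sum>k=1..Suc n. F k) = F 1 + (\<Sum>k=1..n. F (Suc k) :: 'a::comm_monoid_add)"
  using sum.atLeast_Suc_atMost[of 1 "Suc n" F] sum.shift_bounds_cl_Suc_ivl[of F 1 n] by simp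

text \<open>With n = \<open>card A\<close>, there are (n-1)!/(n-k)! cycles of length k through
  \<open>a\<close>, and the other points contribute (n-k)! times
  \<open>complete_sum b (n - k)\<close>. The product is the summand for k.\<close>

lemma marked_sum_eq:
  assumes "finite A" "a \<in> A"
  shows "marked_sum b f A a = (\<Sum>k=1..card A. fact (card A - 1) * f k * complete_sum b (card A - k))"
  using assms
proof (induction "card A" arbitrary: A a f rule: less_induct)
  case less
  define F where "F = A - {a}"
  have F: "finite F" "a \<notin> F" "A = insert a F" using less.prems by (auto simp: F_def)
  define n where "n = card F"
  have n: "card A = Suc n" using F by (simp add: n_def)
  \<comment> \<open>The sum depends on \<open>B\<close> only through its size: the induction
    hypothesis with the weight \<open>b\<close> itself on the marked cycle gives the same value for
    \<open>B\<close> and for \<open>{..<n}\<close>.\<close>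
  have "(\<Sum>g | g permutes B. cycle_weight b B g) = fact n * complete_sum b n"
    if B: "finite B" "card B = n" for B
  proof (cases n)
    case 0
    then show ?thesis using B by (simp add: complete_sum_def)
  next
    case (Suc k)
    have *: "(\<Sum>g | g permutes B. cycle_weight b B g) =
       (\<Sum>k=1..n. fact (n - 1) * b k * complete_sum b (n - k))" if "finite B" "card B = n" for B
    proof -
      from that Suc obtain z where "z \<in> B" by fastforce
      with less.hyps[of B z b] that n show ?thesis by (simp add: marked_sum_self)
    qed
    have "fact n = pconst (fact n)"
      using pconst_of_nat[of "fact n"] by (simp add: of_nat_fact)
    then have "fact n * complete_sum b n =
        pconst (fact n * (1 / fact n)) * (\<Sum>g | g permutes {..<n}. cycle_weight b {..<n} g)"
      by (simp only: complete_sum_def pconst_mult mult.assoc)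
    then show ?thesis using *[OF B] *[of "{..<n}"] by simp
  qed
  then have "marked_sum b f A a = f 1 * (fact n * complete_sum b n) +
      (\<Sum>z\<in>F. \<Sum>k=1..n. fact (n - 1) * f (Suc k) * complete_sum b (n - k))"
    using F marked_sum_insert[OF F(1,2), of b f] less.hyps[of F] n by (simp add: n_def)
  also have "(\<Sum>z\<in>F. \<Sum>k=1..n. fact (n - 1) * f (Suc k) * complete_sum b (n - k))
      = (\<Sum>k=1..n. fact n * f (Suc k) * complete_sum b (n - k))"
    by (cases n) (auto simp: n_def[symmetric] sum_distrib_left algebra_simps)
  finally show ?case unfolding n sum_shift by (simp add: algebra_simps)
qed

section \<open>Newton's identity and generating series\<close>

lemma of_nat_cancel: "n > 0 \<Longrightarrow> of_nat n * (f :: ppoly) = of_nat n * g \<longleftrightarrow> f = g"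
  by simp

lemma complete_sum_0 [simp]: "complete_sum b 0 = 1"
  by (simp add: complete_sum_def cycle_weight_def)

text \<open>Newton's identity, obtained by summing over the length k of the cycle through the point
  0.\<close>

lemma complete_sum_rec: "of_nat n * complete_sum b n = (\<Sum>k=1..n. b k * complete_sum b (n - k))"
proof (cases n)
  case (Suc m)
  have "(\<Sum>g | g permutes {..<n}. cycle_weight b {..<n} g) =
      (\<Sum>k=1..n. fact m * b k * complete_sum b (n - k))"
    using marked_sum_eq[of "{..<n}" 0 b b] Suc by (simp add: marked_sum_self)
  also have "\<dots> = pconst (fact m) * (\<Sum>k=1..n. b k * complete_sum b (n - k))"
    using pconst_of_nat[of "fact m"] by (simp add: sum_distrib_left of_nat_fact mult.assoc)
  finally have "complete_sum b n = pconst (fact m / fact n) * (\<Sum>k=1..n. b k * complete_sum b (n - k))"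
    by (simp add: complete_sum_def mult.assoc[symmetric] pconst_mult[symmetric])
  moreover have "of_nat n * pconst (fact m / fact n) = 1"
    unfolding pconst_of_nat[symmetric] pconst_mult[symmetric] using Suc by simp
  ultimately show ?thesis by (simp add: mult.assoc[symmetric])
qed simp

text \<open>Unit weights turn \<open>complete_sum_power_sum\<close> into the product of geometric
  series that generates the ordinary complete homogeneous polynomials.\<close>

lemma complete_sum_one: "complete_sum (\<lambda>_. 1) n = 1"
proof (induction n rule: less_induct)
  case (less n)
  show ?case
  proof (cases "n = 0")
    case False
    have "of_nat n * complete_sum (\<lambda>_. 1) n = (\<Sum>k=1..n. 1)"
      unfolding complete_sum_rec by (intro sum.cong) (use less in auto)
    then show ?thesis using of_nat_cancel[of n "complete_sum (\<lambda>_. 1) n" 1] False by simp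
  qed simp
qed

lemma psubst_complete_sum: "psubst \<phi> (complete_sum b n) = complete_sum (\<lambda>k. psubst \<phi> (b k)) n"
  by (simp add: complete_sum_def cycle_weight_def psubst.hom_prod psubst.hom_sum psubst.hom_mult)

text \<open>Differentiating Newton's identity gives c h_(n-1) + (n-1) c h_(n-1) for n times the
  derivative. The constant \<open>c\<close> is 1 for the first variable of the family and 0 for a
  foreign one, so lowering and independence share one proof.\<close>

lemma pderiv_complete_sum:
  assumes b: "\<And>k. k \<ge> 1 \<Longrightarrow> ppoly_deriv v (b k) = (if k = 1 then c else 0)"
  shows "ppoly_deriv v (complete_sum b n) = (if n = 0 then 0 else c * complete_sum b (n - 1))"
proof (induction n rule: less_induct)
  case (less n)
  show ?case
  proof (cases n)
    case (Suc m)
    have "of_nat n * ppoly_deriv v (complete_sum b n) = ppoly_deriv v (of_nat n * complete_sum b n)"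
      by (simp add: pderiv.mult pderiv.of_nat)
    also have "\<dots> = (\<Sum>k=1..n. ppoly_deriv v (b k) * complete_sum b (n - k)) +
        (\<Sum>k=1..n. b k * ppoly_deriv v (complete_sum b (n - k)))"
      unfolding complete_sum_rec by (simp add: pderiv.sum pderiv.mult sum.distrib)
    also have "(\<Sum>k=1..n. ppoly_deriv v (b k) * complete_sum b (n - k)) = c * complete_sum b m"
      unfolding Suc sum_shift by (auto simp: b intro!: sum.neutral)
    also have "(\<Sum>k=1..n. b k * ppoly_deriv v (complete_sum b (n - k)))
        = (\<Sum>k=1..m. b k * ppoly_deriv v (complete_sum b (n - k)))"
      unfolding Suc by simp
    also have "\<dots> = (\<Sum>k=1..m. b k * (c * complete_sum b (m - k)))"
      by (intro sum.cong refl arg_cong2[of _ _ _ _ "(*)"], subst less) (auto simp: Suc Suc_diff_le)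
    also have "\<dots> = c * (of_nat m * complete_sum b m)"
      unfolding complete_sum_rec by (simp add: sum_distrib_left mult.left_commute)
    also have "c * complete_sum b m + c * (of_nat m * complete_sum b m) = of_nat n * (c * complete_sum b m)"
      by (simp add: Suc algebra_simps)
    finally show ?thesis using Suc by (subst (asm) of_nat_cancel) auto
  qed simp
qed

text \<open>The recursion says that \<open>H = \<Sum> complete_sum b n X^n\<close> solves \<open>X H' = (\<Sum> b k X^k) H\<close>.\<close>

lemma euler_ode_unique:
  assumes "\<And>n. of_nat n * F $ n = (\<Sum>k=1..n. b k * F $ (n - k))" "F $ 0 = (1 :: ppoly)"
  shows "F $ n = complete_sum b n"
proof (induction n rule: less_induct)
  case (less n)
  show ?case
  proof (cases "n = 0")
    case False
    have "of_nat n * F $ n = of_nat n * complete_sum b n"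
      unfolding assms complete_sum_rec by (intro sum.cong) (use less in auto)
    then show ?thesis using False by (subst (asm) of_nat_cancel) auto
  qed (simp add: assms)
qed

lemma euler_ode_iff:
  "(\<forall>n. of_nat n * F $ n = (\<Sum>k=1..n. b k * F $ (n - k))) \<longleftrightarrow>
    fps_X * fps_deriv F = Abs_fps (\<lambda>k. if k = 0 then 0 else b k) * (F :: ppoly fps)"
proof -
  have "(fps_X * fps_deriv F) $ n = of_nat n * F $ n" for n
    by (cases n) (auto simp: algebra_simps)
  moreover have "(Abs_fps (\<lambda>k. if k = 0 then 0 else b k) * F) $ n = (\<Sum>k=1..n. b k * F $ (n - k))" for n
    by (simp add: fps_mult_nth sum.atLeast_Suc_atMost)
  ultimately show ?thesis by (simp add: fps_eq_iff)
qed

text \<open>Logarithmic derivatives add under products, and scaling X by \<open>y i\<close> turns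
  the coefficient \<open>a k\<close> into \<open>a k * y i ^ k\<close>. So the product solves the
  equation that characterises the left-hand side; this is the Cauchy kernel.\<close>

lemma complete_sum_power_sum:
  fixes y :: "nat \<Rightarrow> ppoly"
  shows "complete_sum (\<lambda>k. a k * (\<Sum>i<m. y i ^ k)) n =
    (\<Prod>i<m. Abs_fps (\<lambda>l. complete_sum a l * y i ^ l)) $ n"
proof -
  let ?F = "\<lambda>i. Abs_fps (\<lambda>l. complete_sum a l * y i ^ l)"
  let ?B = "\<lambda>b. Abs_fps (\<lambda>k. if k = 0 then 0 else b k)"
  have "\<forall>n. of_nat n * ?F i $ n = (\<Sum>k=1..n. (a k * y i ^ k) * ?F i $ (n - k))" for i
  proof
    fix n
    have "of_nat n * ?F i $ n = (\<Sum>k=1..n. a k * complete_sum a (n - k)) * y i ^ n"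
      using complete_sum_rec[of n a] by (simp add: mult.assoc[symmetric])
    also have "\<dots> = (\<Sum>k=1..n. (a k * y i ^ k) * ?F i $ (n - k))"
      unfolding sum_distrib_right
    proof (intro sum.cong refl)
      fix k assume "k \<in> {1..n}"
      then have "y i ^ n = y i ^ k * y i ^ (n - k)" by (simp flip: power_add)
      then show "a k * complete_sum a (n - k) * y i ^ n = (a k * y i ^ k) * ?F i $ (n - k)"
        by (simp add: ac_simps)
    qed
    finally show "of_nat n * ?F i $ n = (\<Sum>k=1..n. (a k * y i ^ k) * ?F i $ (n - k))" .
  qed
  then have F: "fps_X * fps_deriv (?F i) = ?B (\<lambda>k. a k * y i ^ k) * ?F i" for i
    by (rule euler_ode_iff[THEN iffD1])
  have "fps_X * fps_deriv (\<Prod>i<m. ?F i) = ?B (\<lambda>k. a k * (\<Sum>i<m. y i ^ k)) * (\<Prod>i<m. ?F i)"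
  proof (induction m)
    case 0
    have "?B (\<lambda>k. a k * (\<Sum>i<0. y i ^ k)) = 0" by (rule fps_ext) simp
    then show ?case by simp
  next
    case (Suc m)
    have B: "?B (\<lambda>k. a k * (\<Sum>i<Suc m. y i ^ k)) =
        ?B (\<lambda>k. a k * (\<Sum>i<m. y i ^ k)) + ?B (\<lambda>k. a k * y m ^ k)"
      by (rule fps_ext) (simp add: algebra_simps)
    have *: "X * (F * G' + F' * G) = (B + C) * (F * G)"
      if "X * F' = B * F" "X * G' = C * G" for X F F' G G' B C :: "ppoly fps"
    proof -
      have "X * (F * G' + F' * G) = F * (X * G') + (X * F') * G" by (simp add: algebra_simps)
      then show ?thesis unfolding that by (simp add: algebra_simps)
    qed
    show ?case
      unfolding B prod.lessThan_Suc fps_deriv_mult by (rule *[OF Suc F])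
  qed
  then have *: "\<forall>n. of_nat n * (\<Prod>i<m. ?F i) $ n =
      (\<Sum>k=1..n. (a k * (\<Sum>i<m. y i ^ k)) * (\<Prod>i<m. ?F i) $ (n - k))"
    by (rule euler_ode_iff[THEN iffD2])
  have "(\<Prod>i<m. ?F i) $ 0 = 1"
    by (induction m) simp_all
  with * have "(\<Prod>i<m. ?F i) $ n = complete_sum (\<lambda>k. a k * (\<Sum>i<m. y i ^ k)) n"
    by (intro euler_ode_unique) blast+
  then show ?thesis by simp
qed

section \<open>Determinants\<close>

text \<open>Entries are indexed by all natural numbers so that determinants of different sizes share
  one array and replacing a row or column is a change of index.\<close>

definition fdet :: "nat \<Rightarrow> (nat \<Rightarrow> nat \<Rightarrow> 'a::comm_ring_1) \<Rightarrow> 'a" where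
  "fdet m f = det (mat m m (\<lambda>(i, j). f i j))"

lemma fdet_perms: "fdet m f = (\<Sum>p | p permutes {..<m}. signof p * (\<Prod>i<m. f i (p i)))"
  unfolding fdet_def
  by (subst det_def'[of _ m])
     (auto simp: atLeast0LessThan permutes_in_image intro!: sum.cong prod.cong dest: permutes_in_image)

lemma fdet_cong: "(\<And>i j. i < m \<Longrightarrow> j < m \<Longrightarrow> f i j = g i j) \<Longrightarrow> fdet m f = fdet m g"
  unfolding fdet_def by (rule arg_cong[of _ _ det]) (auto intro!: eq_matI)

lemma fdet_transpose: "fdet m (\<lambda>i j. f j i) = fdet m f"
proof -
  have "mat m m (\<lambda>(i, j). f j i) = transpose_mat (mat m m (\<lambda>(i, j). f i j))"
    by (auto intro!: eq_matI)
  then show ?thesis unfolding fdet_def by (simp add: det_transpose[of _ m])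
qed

lemma fdet_mult: "fdet m (\<lambda>i j. \<Sum>l<m. f i l * g l j) = fdet m f * fdet m g"
proof -
  have "mat m m (\<lambda>(i, j). \<Sum>l<m. f i l * g l j) = mat m m (\<lambda>(i, j). f i j) * mat m m (\<lambda>(i, j). g i j)"
    by (auto intro!: eq_matI simp: scalar_prod_def atLeast0LessThan)
  then show ?thesis unfolding fdet_def by (simp add: det_mult[of _ m])
qed

lemma fdet_0 [simp]: "fdet 0 f = 1"
  by (simp add: fdet_perms)

lemma fdet_identical_rows:
  assumes "a < m" "b < m" "a \<noteq> b" "\<And>j. j < m \<Longrightarrow> f a j = f b j"
  shows "fdet m f = 0"
  unfolding fdet_def by (rule det_identical_rows[of _ m a b]) (use assms in \<open>auto intro!: eq_vecI\<close>)

lemma fdet_expand_last_column: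
  assumes "\<And>i. i < m \<Longrightarrow> f i m = 0"
  shows "fdet (Suc m) f = f m m * fdet m f"
proof -
  let ?A = "mat (Suc m) (Suc m) (\<lambda>(i, j). f i j)"
  have "det ?A = (\<Sum>i<Suc m. ?A $$ (i, m) * cofactor ?A i m)"
    by (rule laplace_expansion_column) auto
  also have "\<dots> = f m m * cofactor ?A m m" using assms by simp
  also have "mat_delete ?A m m = mat m m (\<lambda>(i, j). f i j)"
    by (auto intro!: eq_matI simp: mat_delete_def)
  then have "cofactor ?A m m = fdet m f" by (simp add: cofactor_def fdet_def)
  finally show ?thesis by (simp add: fdet_def)
qed

lemma fdet_2: "fdet 2 f = f 0 0 * f 1 1 - f 0 1 * f 1 0"
proof -
  let ?A = "mat 2 2 (\<lambda>(i, j). f i j)"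
  have "det ?A = (\<Sum>i<2. ?A $$ (i, 0) * cofactor ?A i 0)"
    by (rule laplace_expansion_column) auto
  also have "\<dots> = f 0 0 * cofactor ?A 0 0 + f 1 0 * cofactor ?A 1 0"
    by (simp add: numeral_2_eq_2)
  also have "cofactor ?A 0 0 = f 1 1" unfolding cofactor_def
    by (subst det_single) (auto simp: mat_delete_def)
  also have "cofactor ?A 1 0 = - f 0 1" unfolding cofactor_def
    by (subst det_single) (auto simp: mat_delete_def)
  finally show ?thesis by (simp add: fdet_def algebra_simps)
qed

lemma (in derivation) fdet:
  "d (fdet m f) = (\<Sum>r<m. fdet m (\<lambda>i j. if i = r then d (f i j) else f i j))"
proof -
  have "d (fdet m f) = (\<Sum>p | p permutes {..<m}. signof p *
      (\<Sum>r<m. d (f r (p r)) * (\<Prod>i\<in>{..<m} - {r}. f i (p i))))"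
    by (simp add: fdet_perms sum mult sign prod)
  also have "\<dots> = (\<Sum>r<m. \<Sum>p | p permutes {..<m}. signof p *
      (d (f r (p r)) * (\<Prod>i\<in>{..<m} - {r}. f i (p i))))"
    unfolding sum_distrib_left by (rule sum.swap)
  also have "\<dots> = (\<Sum>r<m. fdet m (\<lambda>i j. if i = r then d (f i j) else f i j))"
    unfolding fdet_perms
  proof (intro sum.cong refl arg_cong2[of _ _ _ _ "(*)"])
    fix r p assume "r \<in> {..<m}"
    then show "d (f r (p r)) * (\<Prod>i\<in>{..<m} - {r}. f i (p i)) =
       (\<Prod>i<m. if i = r then d (f i (p i)) else f i (p i))"
      by (subst prod.remove[of _ r]) (auto intro!: prod.cong)
  qed
  finally show ?thesis .
qed

text \<open>Differentiating a row other than the last makes it a copy of the next row, so only the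
  term of the last row survives.\<close>

lemma (in derivation) fdet_rows:
  assumes "\<And>i j. d (f i j) = f (Suc i) j"
  shows "d (fdet (Suc k) f) = fdet (Suc k) (\<lambda>i. f (if i = k then Suc k else i))"
proof -
  have "d (fdet (Suc k) f) = (\<Sum>r<Suc k. fdet (Suc k) (\<lambda>i j. if i = r then f (Suc i) j else f i j))"
    by (simp only: fdet assms)
  also have "\<dots> = fdet (Suc k) (\<lambda>i j. if i = k then f (Suc i) j else f i j)"
  proof -
    have "fdet (Suc k) (\<lambda>i j. if i = r then f (Suc i) j else f i j) = 0" if "r < k" for r
      by (rule fdet_identical_rows[of r _ "Suc r"]) (use that in auto)
    then show ?thesis by simp
  qed
  also have "\<dots> = fdet (Suc k) (\<lambda>i. f (if i = k then Suc k else i))"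
    by (rule fdet_cong) auto
  finally show ?thesis .
qed

lemma (in derivation) fdet_columns:
  assumes "\<And>i j. d (f i j) = f i (Suc j)"
  shows "d (fdet (Suc k) f) = fdet (Suc k) (\<lambda>i j. f i (if j = k then Suc k else j))"
proof -
  have "d (fdet (Suc k) (\<lambda>i j. f j i)) = fdet (Suc k) (\<lambda>i j. f j (if i = k then Suc k else i))"
    by (rule fdet_rows) (rule assms)
  then show ?thesis
    using fdet_transpose[of "Suc k" f] fdet_transpose[of "Suc k" "\<lambda>i j. f i (if j = k then Suc k else j)"]
    by simp
qed

text \<open>With D the full determinant, the product with \<open>b\<close> has last two columns D
  times unit vectors. Hence D times the lower right 2 by 2 minor of the adjugate is D^2 times
  \<open>fdet k f\<close>, and one D is cancelled by \<open>nz\<close>. The map \<open>s k\<close>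
  skips the index k; for a Wronskian this replaces the last row or column by its derivative.\<close>

lemma desnanot_jacobi:
  fixes f :: "nat \<Rightarrow> nat \<Rightarrow> 'a::idom"
  defines "s \<equiv> \<lambda>k i. if i = k then Suc k else i"
  assumes nz: "fdet (k + 2) f \<noteq> 0"
  shows "fdet (k + 2) f * fdet k f = fdet (Suc k) f * fdet (Suc k) (\<lambda>i j. f (s k i) (s k j))
    - fdet (Suc k) (\<lambda>i. f (s k i)) * fdet (Suc k) (\<lambda>i j. f i (s k j))"
proof -
  let ?A = "mat (k + 2) (k + 2) (\<lambda>(i, j). f i j)"
  define D where "D = fdet (k + 2) f"
  \<comment> \<open>\<open>b\<close> is the identity matrix with its last two columns taken from the adjugate of \<open>f\<close>\<close>
  define J where "J = (\<lambda>l j. cofactor ?A j l)"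
  define b where "b = (\<lambda>l j. if j < k then of_bool (l = j) else J l j)"
  have AJ: "(\<Sum>l<k+2. f i l * J l j) = (if i = j then D else 0)" if "i < k + 2" "j < k + 2" for i j
  proof -
    have "(?A * adj_mat ?A) $$ (i, j) = (det ?A \<cdot>\<^sub>m 1\<^sub>m (k + 2)) $$ (i, j)"
      using adj_mat(2)[of ?A "k + 2"] by simp
    then show ?thesis using that
      by (simp add: scalar_prod_def atLeast0LessThan adj_mat_def J_def D_def fdet_def)
  qed
  define c where "c = (\<lambda>i j. if j < k then f i j else if i = j then D else 0)"
  have "fdet (k + 2) (\<lambda>i j. \<Sum>l<k+2. f i l * b l j) = fdet (k + 2) c"
  proof (rule fdet_cong)
    fix i j assume "i < k + 2" "j < k + 2"
    then show "(\<Sum>l<k+2. f i l * b l j) = c i j"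
      using AJ[of i j] by (auto simp: b_def c_def of_bool_def mult_delta_right)
  qed
  then have prod: "D * fdet (k + 2) b = fdet (k + 2) c"
    by (simp only: fdet_mult D_def)
  have c: "fdet (k + 2) c = D * (D * fdet k f)"
  proof -
    have "fdet (k + 2) c = D * fdet (Suc k) c"
      using fdet_expand_last_column[of "Suc k" c] by (simp add: c_def)
    also have "fdet (Suc k) c = D * fdet k c"
      using fdet_expand_last_column[of k c] by (simp add: c_def)
    also have "fdet k c = fdet k f" by (rule fdet_cong) (simp add: c_def)
    finally show ?thesis .
  qed
  have b: "fdet (k + 2) b = J k k * J (Suc k) (Suc k) - J k (Suc k) * J (Suc k) k"
  proof -
    have "mat (k + 2) (k + 2) (\<lambda>(i, j). b i j) = four_block_mat (1\<^sub>m k) (mat k 2 (\<lambda>(i, j). J i (k + j)))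
       (0\<^sub>m 2 k) (mat 2 2 (\<lambda>(i, j). J (k + i) (k + j)))"
      by (rule eq_matI) (auto simp: b_def)
    then have "fdet (k + 2) b = det (1\<^sub>m k :: 'a mat) * det (mat 2 2 (\<lambda>(i, j). J (k + i) (k + j)))"
      unfolding fdet_def by (simp only:) (rule det_four_block_mat_lower_left_zero, auto)
    also have "\<dots> = fdet 2 (\<lambda>i j. J (k + i) (k + j))" by (simp add: fdet_def)
    finally show ?thesis by (simp add: fdet_2)
  qed
  have J: "J k k = fdet (Suc k) (\<lambda>i j. f (s k i) (s k j))" "J (Suc k) (Suc k) = fdet (Suc k) f"
    "J k (Suc k) = - fdet (Suc k) (\<lambda>i j. f i (s k j))" "J (Suc k) k = - fdet (Suc k) (\<lambda>i. f (s k i))"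
    unfolding J_def cofactor_def fdet_def s_def
    by (auto simp: mat_delete_def intro!: arg_cong[of _ _ det] eq_matI)
  have "D * (D * fdet k f) = D * (J k k * J (Suc k) (Suc k) - J k (Suc k) * J (Suc k) k)"
    using prod unfolding b c by (rule sym)
  then have "D * fdet k f = J k k * J (Suc k) (Suc k) - J k (Suc k) * J (Suc k) k"
    using nz by (simp add: D_def)
  then show ?thesis unfolding D_def J by (simp add: mult.commute)
qed

text \<open>The unitriangular matrix \<open>u\<close> carries the coefficients of the monic
  polynomial \<open>q\<close> in its last column. Multiplying by it replaces the column of m-th
  powers by values of \<open>q\<close>, which vanish in all rows but the last.\<close>

lemma vandermonde:
  fixes y :: "nat \<Rightarrow> 'a::idom"
  shows "fdet m (\<lambda>i j. y i ^ j) = (\<Prod>b<m. \<Prod>a<b. y b - y a)"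
proof (induction m)
  case (Suc m)
  define q where "q = (\<Prod>a<m. [:- y a, 1:])"
  have lc: "lead_coeff q = 1" unfolding q_def lead_coeff_prod by simp
  have "degree q = m" unfolding q_def by (subst degree_prod_eq_sum_degree) auto
  define u where "u = (\<lambda>i j. if j < m then of_bool (i = j) else coeff q i)"
  have u: "fdet (Suc m) u = 1"
  proof -
    let ?U = "mat (Suc m) (Suc m) (\<lambda>(i, j). u i j)"
    have "det ?U = prod_list (diag_mat ?U)"
      by (rule det_upper_triangular[of _ "Suc m"]) (auto simp: upper_triangular_def u_def)
    also have "diag_mat ?U = map (\<lambda>i. 1) [0..<Suc m]"
      unfolding diag_mat_def
      by (rule map_cong) (use lc \<open>degree q = m\<close> in \<open>auto simp: u_def less_Suc_eq\<close>)
    also have "prod_list \<dots> = 1" by (induction m) auto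
    finally show ?thesis by (simp add: fdet_def)
  qed
  define c where "c = (\<lambda>i j. if j < m then y i ^ j else poly q (y i))"
  have "fdet (Suc m) (\<lambda>i j. y i ^ j) = fdet (Suc m) (\<lambda>i j. \<Sum>l<Suc m. y i ^ l * u l j)"
    by (simp only: fdet_mult u mult_1_right)
  also have "\<dots> = fdet (Suc m) c"
  proof (rule fdet_cong)
    fix i j assume "i < Suc m" "j < Suc m"
    show "(\<Sum>l<Suc m. y i ^ l * u l j) = c i j"
    proof (cases "j < m")
      case True
      then have "(\<Sum>l<Suc m. y i ^ l * u l j) = (\<Sum>l<Suc m. if l = j then y i ^ l else 0)"
        by (intro sum.cong) (auto simp: u_def)
      then show ?thesis using True by (simp add: c_def del: sum.lessThan_Suc)
    next
      case False
      then show ?thesis using \<open>degree q = m\<close>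
        by (simp add: u_def c_def poly_altdef lessThan_Suc_atMost mult.commute del: sum.lessThan_Suc)
    qed
  qed
  also have "\<dots> = poly q (y m) * fdet m c"
  proof -
    have "poly q (y i) = 0" if "i < m" for i
    proof -
      have "poly q (y i) = (\<Prod>a<m. y i - y a)" by (simp add: q_def poly_prod)
      then show ?thesis using that by (auto intro!: prod_zero)
    qed
    then show ?thesis by (subst fdet_expand_last_column) (auto simp: c_def)
  qed
  also have "fdet m c = (\<Prod>b<m. \<Prod>a<b. y b - y a)"
    unfolding Suc[symmetric] by (rule fdet_cong) (simp add: c_def)
  also have "poly q (y m) = (\<Prod>a<m. y m - y a)" by (simp add: q_def poly_prod)
  finally show ?case by (simp add: mult.commute)
qed simp

text \<open>The generating polynomial of the signed elementary symmetric functions of all variables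
  but \<open>y i\<close>.\<close>

definition omit_poly :: "nat \<Rightarrow> (nat \<Rightarrow> 'a::comm_ring_1) \<Rightarrow> nat \<Rightarrow> 'a poly" where
  "omit_poly m y i = (\<Prod>j\<in>{..<m} - {i}. [:1, - y j:])"

lemma degree_omit_poly: "i < m \<Longrightarrow> degree (omit_poly m y i) < m"
proof -
  assume i: "i < m"
  have "degree (omit_poly m y i) \<le> (\<Sum>j\<in>{..<m} - {i}. degree [:1, - y j:])"
    using degree_prod_sum_le[of "{..<m} - {i}" "\<lambda>j. [:1, - y j:]"]
    by (simp add: omit_poly_def comp_def)
  also have "\<dots> \<le> (\<Sum>j\<in>{..<m} - {i}. 1)"
    by (intro sum_mono) (simp add: degree_pCons_le)
  also have "\<dots> < m" using i by simp
  finally show ?thesis .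
qed

text \<open>Multiplying the product of all geometric series by \<open>omit_poly m y i\<close> leaves
  only the i-th series, whose coefficients are powers of \<open>y i\<close>. The guard stands for
  complete functions of negative index.\<close>

lemma complete_homogeneous_column:
  fixes y h :: "nat \<Rightarrow> 'a::comm_ring_1"
  assumes H: "Abs_fps h = (\<Prod>j<m. Abs_fps (\<lambda>l. y j ^ l))" and i: "i < m"
  shows "(\<Sum>k<m. (if k \<le> l then h (l - k) else 0) * coeff (omit_poly m y i) k) = y i ^ l"
proof -
  let ?G = "\<lambda>j. Abs_fps (\<lambda>l. y j ^ l)"
  have *: "fps_of_poly [:1, - y j:] * ?G j = 1" for j
  proof (rule fps_ext)
    fix n show "(fps_of_poly [:1, - y j:] * ?G j) $ n = 1 $ n"
    proof (cases n)
      case (Suc k)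
      have "fps_of_poly [:1, - y j:] = 1 - fps_const (y j) * fps_X"
      proof (rule fps_ext)
        fix n show "fps_of_poly [:1, - y j:] $ n = (1 - fps_const (y j) * fps_X) $ n"
          by (cases n) (auto simp: coeff_pCons split: nat.splits)
      qed
      then have "fps_of_poly [:1, - y j:] * ?G j = ?G j - fps_const (y j) * (fps_X * ?G j)"
        by (simp only: left_diff_distrib mult.assoc mult_1_left)
      then show ?thesis using Suc by simp
    qed (simp add: fps_mult_nth)
  qed
  have "fps_of_poly (omit_poly m y i) = (\<Prod>j\<in>{..<m} - {i}. fps_of_poly [:1, - y j:])"
    unfolding omit_poly_def by (simp add: fps_of_poly_prod)
  then have "fps_of_poly (omit_poly m y i) * (\<Prod>j\<in>{..<m} - {i}. ?G j) = 1"
    by (simp add: prod.distrib[symmetric] *)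
  moreover have "(\<Prod>j<m. ?G j) = ?G i * (\<Prod>j\<in>{..<m} - {i}. ?G j)"
    using i by (intro prod.remove) auto
  ultimately have "fps_of_poly (omit_poly m y i) * Abs_fps h = ?G i"
    unfolding H by (simp add: mult.left_commute)
  then have "y i ^ l = (fps_of_poly (omit_poly m y i) * Abs_fps h) $ l" by simp
  also have "\<dots> = (\<Sum>k=0..l. coeff (omit_poly m y i) k * h (l - k))"
    by (simp add: fps_mult_nth)
  also have "\<dots> = (\<Sum>k\<in>{0..l} \<union> {..<m}. (if k \<le> l then h (l - k) else 0) * coeff (omit_poly m y i) k)"
    by (rule sum.mono_neutral_cong_left) (auto simp: mult.commute)
  also have "\<dots> = (\<Sum>k<m. (if k \<le> l then h (l - k) else 0) * coeff (omit_poly m y i) k)"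
  proof (rule sum.mono_neutral_right)
    show "\<forall>k\<in>{0..l} \<union> {..<m} - {..<m}. (if k \<le> l then h (l - k) else 0) * coeff (omit_poly m y i) k = 0"
      using degree_omit_poly[OF i, of y] by (auto simp: coeff_eq_0)
  qed auto
  finally show ?thesis by simp
qed

text \<open>The matrix of the h(l-k) is unitriangular, and its product with the coefficient matrix
  is the Vandermonde matrix of the powers \<open>y i ^ l\<close>.\<close>

lemma fdet_omit_poly:
  fixes y h :: "nat \<Rightarrow> 'a::idom"
  assumes H: "Abs_fps h = (\<Prod>j<m. Abs_fps (\<lambda>l. y j ^ l))"
  shows "fdet m (\<lambda>k i. coeff (omit_poly m y i) k) = (\<Prod>b<m. \<Prod>a<b. y b - y a)"
proof -
  let ?L = "\<lambda>l k. if k \<le> l then h (l - k) else 0"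
  have h0: "h 0 = 1"
  proof -
    have "h 0 = (\<Prod>j<m. Abs_fps (\<lambda>l. y j ^ l)) $ 0" by (simp flip: H)
    also have "\<dots> = 1" by (induction m) auto
    finally show ?thesis .
  qed
  have "fdet m ?L = fdet m (\<lambda>k l. ?L l k)" by (rule fdet_transpose[symmetric])
  also have "\<dots> = prod_list (diag_mat (mat m m (\<lambda>(k, l). ?L l k)))"
    unfolding fdet_def by (rule det_upper_triangular[of _ m]) (auto simp: upper_triangular_def)
  also have "diag_mat (mat m m (\<lambda>(k, l). ?L l k)) = map (\<lambda>i. 1) [0..<m]"
    unfolding diag_mat_def by (rule map_cong) (auto simp: h0)
  also have "prod_list \<dots> = 1" by (induction m) auto
  finally have "fdet m (\<lambda>k i. coeff (omit_poly m y i) k) =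
      fdet m (\<lambda>l i. \<Sum>k<m. ?L l k * coeff (omit_poly m y i) k)"
    by (simp add: fdet_mult)
  also have "\<dots> = fdet m (\<lambda>l i. y i ^ l)"
    by (rule fdet_cong) (rule complete_homogeneous_column[OF H])
  also have "\<dots> = fdet m (\<lambda>i l. y i ^ l)" by (rule fdet_transpose)
  finally show ?thesis by (simp add: vandermonde)
qed

section \<open>Colourings invariant under a permutation\<close>

text \<open>The variables \<open>y\<^sub>i\<close> that replace the power sums \<open>p'\<^sub>k\<close> are again called \<open>P' i\<close>, now with \<open>i \<ge> 0\<close>;
  the substitution is an endomorphism of the polynomial ring.\<close>

definition yv :: "nat \<Rightarrow> ppoly" where
  "yv i = var_poly (P' i)"

definition invariant_colourings :: "nat \<Rightarrow> nat \<Rightarrow> (nat \<Rightarrow> nat) \<Rightarrow> (nat \<Rightarrow> nat) set" where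
  "invariant_colourings m d g = {c \<in> {..<d} \<rightarrow>\<^sub>E {..<m}. \<forall>x<d. c (g x) = c x}"

definition colour_monom :: "nat \<Rightarrow> (nat \<Rightarrow> nat) \<Rightarrow> ppoly" where
  "colour_monom d c = (\<Prod>x<d. yv (c x))"

lemma finite_invariant_colourings [simp]: "finite (invariant_colourings m d g)"
  unfolding invariant_colourings_def by (rule finite_subset[of _ "{..<d} \<rightarrow>\<^sub>E {..<m}"]) (auto intro: finite_PiE)

lemma orbit_class:
  assumes "g permutes {..<d :: nat}" "x < d"
  shows "{u \<in> {..<d}. orbit g u = orbit g x} = orbit g x"
proof -
  have "orbit g u = orbit g x \<longleftrightarrow> u \<in> orbit g x" for u
    using orbit_eq_iff[OF assms(1), of x u] by auto
  moreover have "orbit g x \<subseteq> {..<d}" using assms by (intro permutes_orbit_subset) auto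
  ultimately show ?thesis by auto
qed

text \<open>An invariant colouring is a free choice of one colour for each cycle, and a cycle of
  length k coloured i contributes \<open>yv i ^ k\<close>. Expanding the product of power sums gives
  exactly these choices.\<close>

lemma sum_colour_monom:
  assumes g: "g permutes {..<d}"
  shows "(\<Sum>c\<in>invariant_colourings m d g. colour_monom d c) =
    cycle_weight (\<lambda>k. \<Sum>i<m. yv i ^ k) {..<d} g"
proof -
  let ?O = "orbit g ` {..<d}"
  let ?c = "\<lambda>\<phi>. \<lambda>x\<in>{..<d}. \<phi> (orbit g x)"
  have perm: "permutation g" using g by (auto simp: permutation_permutes)
  have "cycle_weight (\<lambda>k. \<Sum>i<m. yv i ^ k) {..<d} g =
      (\<Sum>\<phi>\<in>?O \<rightarrow>\<^sub>E {..<m}. \<Prod>C\<in>?O. yv (\<phi> C) ^ card C)"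
    unfolding cycle_weight_def by (rule prod_sum_PiE) auto
  also have "\<dots> = (\<Sum>\<phi>\<in>?O \<rightarrow>\<^sub>E {..<m}. colour_monom d (?c \<phi>))"
  proof (intro sum.cong refl)
    fix \<phi> :: "nat set \<Rightarrow> nat"
    have "colour_monom d (?c \<phi>) = (\<Prod>x<d. yv (\<phi> (orbit g x)))" by (simp add: colour_monom_def)
    also have "\<dots> = (\<Prod>C\<in>?O. \<Prod>x\<in>{x \<in> {..<d}. orbit g x = C}. yv (\<phi> (orbit g x)))"
      by (rule prod.group[symmetric]) auto
    also have "\<dots> = (\<Prod>C\<in>?O. yv (\<phi> C) ^ card C)"
    proof (intro prod.cong refl)
      fix C assume "C \<in> ?O"
      then obtain z where z: "z < d" "C = orbit g z" by auto
      have "(\<Prod>x\<in>{x \<in> {..<d}. orbit g x = C}. yv (\<phi> (orbit g x))) = (\<Prod>x\<in>{x \<in> {..<d}. orbit g x = C}. yv (\<phi> C))"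
        by (intro prod.cong) auto
      also have "\<dots> = yv (\<phi> C) ^ card C" using orbit_class[OF g z(1)] z by simp
      finally show "(\<Prod>x\<in>{x \<in> {..<d}. orbit g x = C}. yv (\<phi> (orbit g x))) = yv (\<phi> C) ^ card C" .
    qed
    finally show "(\<Prod>C\<in>?O. yv (\<phi> C) ^ card C) = colour_monom d (?c \<phi>)" ..
  qed
  also have "\<dots> = (\<Sum>c\<in>invariant_colourings m d g. colour_monom d c)"
  proof (rule sum.reindex_bij_betw)
    show "bij_betw ?c (?O \<rightarrow>\<^sub>E {..<m}) (invariant_colourings m d g)"
    proof (rule bij_betw_imageI)
      show "inj_on ?c (?O \<rightarrow>\<^sub>E {..<m})"
      proof (rule inj_onI)
        fix \<phi> \<psi> assume *: "\<phi> \<in> ?O \<rightarrow>\<^sub>E {..<m}" "\<psi> \<in> ?O \<rightarrow>\<^sub>E {..<m}" "?c \<phi> = ?c \<psi>"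
        have "\<phi> (orbit g x) = \<psi> (orbit g x)" if "x < d" for x
          using fun_cong[OF *(3), of x] that by simp
        then show "\<phi> = \<psi>" using *(1,2) by (intro PiE_ext[of \<phi> ?O "\<lambda>_. {..<m}"]) auto
      qed
      show "?c ` (?O \<rightarrow>\<^sub>E {..<m}) = invariant_colourings m d g"
      proof (intro Set.set_eqI iffI)
        fix c assume "c \<in> ?c ` (?O \<rightarrow>\<^sub>E {..<m})"
        then obtain \<phi> where \<phi>: "\<phi> \<in> ?O \<rightarrow>\<^sub>E {..<m}" "c = ?c \<phi>" by auto
        have "g x < d" if "x < d" for x using permutes_in_image[OF g, of x] that by simp
        moreover have "orbit g (g x) = orbit g x" for x using perm by (rule permutation_orbit_step)
        ultimately show "c \<in> invariant_colourings m d g"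
          using \<phi> by (auto simp: invariant_colourings_def)
      next
        fix c assume c: "c \<in> invariant_colourings m d g"
        have *: "c z = c x" if "z \<in> orbit g x" "x < d" for x z
          using that(1)
        proof induction
          case base
          show ?case using c that by (simp add: invariant_colourings_def)
        next
          case (step z)
          then have "z < d" using permutes_orbit_subset[OF g, of x] that by auto
          then show ?case using c step by (simp add: invariant_colourings_def)
        qed
        let ?\<phi> = "\<lambda>C\<in>?O. c (SOME z. z \<in> C)"
        have **: "c (SOME z. z \<in> orbit g x) = c x" if "x < d" for x
          using *[OF _ that] someI_ex[of "\<lambda>z. z \<in> orbit g x"] orbit_nonempty[of g x] by blast
        have "c = ?c ?\<phi>"
          using c ** by (auto simp: invariant_colourings_def fun_eq_iff PiE_def extensional_def)
        moreover have "?\<phi> \<in> ?O \<rightarrow>\<^sub>E {..<m}"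
          using c ** by (auto simp: invariant_colourings_def)
        ultimately show "c \<in> ?c ` (?O \<rightarrow>\<^sub>E {..<m})" by blast
      qed
    qed
  qed
  finally show ?thesis ..
qed

subsection \<open>Multiplication by a transposition cuts a cycle\<close>

text \<open>If the two swapped points have different colours, they lie on one cycle of \<open>g\<close>, which is
  coloured \<open>i\<close> from \<open>u\<close> up to \<open>v\<close> and \<open>k\<close> from \<open>v\<close> on. Moving \<open>v\<close> one step along the cycle makes the
  sum over \<open>v\<close> telescope; its end terms are the two constant colourings of the cycle.\<close>

definition cut_colourings where
  "cut_colourings m d g u v i k = {c \<in> invariant_colourings m d (transpose u v \<circ> g). c u = i \<and> c v = k}"

lemma cut_colourings_sum:
  assumes g: "g permutes {..<d}" and u: "u < d" and ik: "i < m" "k < m" "i \<noteq> k"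
  shows "(yv i - yv k) * (\<Sum>v\<in>{..<d} - {u}. \<Sum>c\<in>cut_colourings m d g u v i k. colour_monom d c) =
    yv k * (\<Sum>c | c \<in> invariant_colourings m d g \<and> c u = i. colour_monom d c) -
    yv i * (\<Sum>c | c \<in> invariant_colourings m d g \<and> c u = k. colour_monom d c)"
proof -
  have perm: "permutation g" using g by (auto simp: permutation_permutes)
  define N where "N = funpow_dist1 g u u"
  define w where "w n = (g ^^ n) u" for n
  have self: "u \<in> orbit g u" using perm by (rule permutation_self_in_orbit)
  have N: "N > 0" by (simp add: N_def)
  have orb: "orbit g u = w ` {..<N}"
    using orbit_conv_funpow_dist1[OF self] by (simp add: N_def w_def[abs_def] atLeast0LessThan)
  have inj: "inj_on w {..<N}"
    using inj_on_funpow_dist1[OF self] by (simp add: N_def w_def[abs_def] atLeast0LessThan)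
  have w0: "w 0 = u" and wN: "w N = u" and wS: "g (w n) = w (Suc n)" for n
    using funpow_dist1_prop[OF self] by (simp_all add: w_def N_def)
  have w_eq: "w n = w n' \<longleftrightarrow> n = n'" if "n < N" "n' < N" for n n'
    using inj_onD[OF inj] that by auto
  have wd: "w n < d" for n
    by (induction n) (use u permutes_in_image[OF g] in \<open>auto simp: w0 wS[symmetric]\<close>)
  have R: "g x \<notin> orbit g u \<and> g x < d" if "x < d" "x \<notin> orbit g u" for x
    using that permutes_in_image[OF g, of x] orbit_eq_iff[OF g, of u x] orbit_eq_iff[OF g, of u "g x"]
      permutation_orbit_step[OF perm, of x] by auto
  \<comment> \<open>\<open>X a\<close> colours the first a points of the cycle of \<open>u\<close>
    by i and the rest by k. For 0 < a < N it is the set of cut colourings with v =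
    \<open>w a\<close>; a = 0 and a = N, which no v different from u yields, are the constant
    colourings.\<close>
  define X where "X a = {c \<in> {..<d} \<rightarrow>\<^sub>E {..<m}. (\<forall>n<N. c (w n) = (if n < a then i else k)) \<and>
     (\<forall>x<d. x \<notin> orbit g u \<longrightarrow> c (g x) = c x)}" for a
  define S where "S a = (\<Sum>c\<in>X a. colour_monom d c)" for a

  \<comment> \<open>Recolouring the single point \<open>w a\<close> from k to i is a bijection from
    \<open>X a\<close> to \<open>X (Suc a)\<close> and exchanges one factor \<open>yv k\<close> for
    \<open>yv i\<close>.\<close>
  have step: "yv i * S a = yv k * S (Suc a)" if a: "a < N" for a
  proof -
    have "S (Suc a) = (\<Sum>c\<in>X a. colour_monom d (c(w a := i)))"
      unfolding S_def
    proof (rule sum.reindex_bij_witness[where i = "\<lambda>c. c(w a := i)" and j = "\<lambda>c. c(w a := k)"])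
      have wa: "w a \<in> orbit g u" using orb a by auto
      have Rw: "g x \<noteq> w a" if "x < d" "x \<notin> orbit g u" for x using R[OF that] wa by auto
      fix c assume c: "c \<in> X (Suc a)"
      then have "c (w a) = i" using a by (auto simp: X_def)
      then show "c(w a := k, w a := i) = c" by auto
      show "c(w a := k) \<in> X a"
        using c ik a wd wa Rw by (auto simp: X_def w_eq PiE_iff extensional_def)
      show "colour_monom d (c(w a := k, w a := i)) = colour_monom d c"
        using \<open>c (w a) = i\<close> by (simp add: fun_upd_idem)
    next
      have wa: "w a \<in> orbit g u" using orb a by auto
      have Rw: "g x \<noteq> w a" if "x < d" "x \<notin> orbit g u" for x using R[OF that] wa by auto
      fix c assume c: "c \<in> X a"
      then have "c (w a) = k" using a by (auto simp: X_def)
      then show "c(w a := i, w a := k) = c" by auto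
      show "c(w a := i) \<in> X (Suc a)"
        using c ik a wd wa Rw by (auto simp: X_def w_eq PiE_iff extensional_def)
    qed
    also have "yv k * \<dots> = yv i * S a"
      unfolding S_def sum_distrib_left
    proof (intro sum.cong refl)
      fix c assume "c \<in> X a"
      then have "c (w a) = k" using a by (auto simp: X_def)
      moreover have "colour_monom d e = yv (e (w a)) * (\<Prod>x\<in>{..<d} - {w a}. yv (e x))" for e
        unfolding colour_monom_def by (rule prod.remove) (use wd in auto)
      ultimately show "yv k * colour_monom d (c(w a := i)) = yv i * colour_monom d c"
        by (simp add: mult.left_commute)
    qed
    finally show ?thesis ..
  qed

  have Xi: "{c \<in> invariant_colourings m d g. c u = i} = X N"
  proof (intro Set.set_eqI iffI)
    fix c assume c: "c \<in> {c \<in> invariant_colourings m d g. c u = i}"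
    have "c (w n) = i" for n
      by (induction n) (use c wd in \<open>auto simp: w0 wS[symmetric] invariant_colourings_def\<close>)
    then show "c \<in> X N" using c by (auto simp: X_def invariant_colourings_def)
  next
    fix c assume c: "c \<in> X N"
    have cw: "c (w n) = i" if "n \<le> N" for n
      using that c w0 wN N by (cases "n = N") (auto simp: X_def)
    have "c (g x) = c x" if "x < d" for x
    proof (cases "x \<in> orbit g u")
      case True
      then obtain n where "n < N" "x = w n" using orb by auto
      then show ?thesis using cw[of n] cw[of "Suc n"] wS by simp
    qed (use c that in \<open>auto simp: X_def\<close>)
    then show "c \<in> {c \<in> invariant_colourings m d g. c u = i}"
      using c cw[of 0] w0 by (auto simp: X_def invariant_colourings_def)
  qed
  have Xk: "{c \<in> invariant_colourings m d g. c u = k} = X 0"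
  proof (intro Set.set_eqI iffI)
    fix c assume c: "c \<in> {c \<in> invariant_colourings m d g. c u = k}"
    have "c (w n) = k" for n
      by (induction n) (use c wd in \<open>auto simp: w0 wS[symmetric] invariant_colourings_def\<close>)
    then show "c \<in> X 0" using c by (auto simp: X_def invariant_colourings_def)
  next
    fix c assume c: "c \<in> X 0"
    have cw: "c (w n) = k" if "n \<le> N" for n
      using that c w0 wN N by (cases "n = N") (auto simp: X_def)
    have "c (g x) = c x" if "x < d" for x
    proof (cases "x \<in> orbit g u")
      case True
      then obtain n where "n < N" "x = w n" using orb by auto
      then show ?thesis using cw[of n] cw[of "Suc n"] wS by simp
    qed (use c that in \<open>auto simp: X_def\<close>)
    then show "c \<in> {c \<in> invariant_colourings m d g. c u = k}"
      using c cw[of 0] w0 by (auto simp: X_def invariant_colourings_def)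
  qed
  have cut: "cut_colourings m d g u (w a) i k = X a" if a: "0 < a" "a < N" for a
  proof (intro Set.set_eqI iffI)
    fix c assume c: "c \<in> cut_colourings m d g u (w a) i k"
    then have ct: "c (transpose u (w a) (g x)) = c x" if "x < d" for x
      using that by (auto simp: cut_colourings_def invariant_colourings_def)
    have ne: "w n \<noteq> u" if "0 < n" "n < N" for n using w_eq[of n 0] w0 that by auto
    have 1: "c (w n) = i" if "n < a" for n
      using that
    proof (induction n)
      case 0
      then show ?case using c by (simp add: w0 cut_colourings_def)
    next
      case (Suc n)
      then show ?case using ct[OF wd, of n] a ne[of "Suc n"] w_eq[of "Suc n" a]
        by (auto simp: wS transpose_def split: if_splits)
    qed
    have 2: "a + n < N \<Longrightarrow> c (w (a + n)) = k" for n
    proof (induction n)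
      case 0
      then show ?case using c by (simp add: cut_colourings_def)
    next
      case (Suc n)
      then show ?case using ct[OF wd, of "a + n"] a ne[of "Suc (a + n)"] w_eq[of "Suc (a + n)" a]
        by (auto simp: wS transpose_def split: if_splits)
    qed
    have "c (w n) = k" if "a \<le> n" "n < N" for n using 2[of "n - a"] that by simp
    moreover have "c (g x) = c x" if "x < d" "x \<notin> orbit g u" for x
    proof -
      have "g x \<noteq> u" "g x \<noteq> w a" using R[OF that] self orb a by auto
      then show ?thesis using ct[OF that(1)] by simp
    qed
    ultimately show "c \<in> X a"
      using 1 c by (auto simp: X_def cut_colourings_def invariant_colourings_def)
  next
    fix c assume c: "c \<in> X a"
    then have cw: "c (w n) = (if n < a then i else k)" if "n < N" for n
      using that by (auto simp: X_def)
    have "c (transpose u (w a) (g x)) = c x" if "x < d" for x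
    proof (cases "x \<in> orbit g u")
      case True
      then obtain n where n: "n < N" "x = w n" using orb by auto
      consider "Suc n = N" | "Suc n = a" | "Suc n < N" "Suc n \<noteq> a" using n by linarith
      then show ?thesis
      proof cases
        case 1
        then show ?thesis using n cw[of a] cw[of n] a wN by (auto simp: wS)
      next
        case 2
        then show ?thesis using n cw[of 0] cw[of n] a w0 by (auto simp: wS)
      next
        case 3
        then have "w (Suc n) \<noteq> u" "w (Suc n) \<noteq> w a" using w_eq[of "Suc n" 0] w_eq[of "Suc n" a] w0 a by auto
        then show ?thesis using 3 n cw[of n] cw[of "Suc n"] by (auto simp: wS)
      qed
    next
      case False
      have "g x \<noteq> u" "g x \<noteq> w a" using R[OF that False] self orb a by auto
      then show ?thesis using c that False by (auto simp: X_def)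
    qed
    then show "c \<in> cut_colourings m d g u (w a) i k"
      using c cw[of 0] cw[of a] a w0 N by (auto simp: X_def cut_colourings_def invariant_colourings_def)
  qed
  \<comment> \<open>If \<open>v\<close> is off the cycle of \<open>u\<close>, the transposition
    joins the two cycles, and an invariant colouring cannot give \<open>u\<close> and
    \<open>v\<close> different colours.\<close>
  have empty: "cut_colourings m d g u v i k = {}" if v: "v \<notin> orbit g u" for v
  proof (rule ccontr)
    assume "cut_colourings m d g u v i k \<noteq> {}"
    then obtain c where c: "c \<in> cut_colourings m d g u v i k" by auto
    then have ct: "c (transpose u v (g x)) = c x" if "x < d" for x
      using that by (auto simp: cut_colourings_def invariant_colourings_def)
    have "c (w n) = i" if "n < N" for n
      using that
    proof (induction n)
      case 0
      then show ?case using c by (simp add: w0 cut_colourings_def)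
    next
      case (Suc n)
      have "w (Suc n) \<noteq> u" "w (Suc n) \<noteq> v" using Suc.prems w_eq[of "Suc n" 0] w0 v orb by auto
      then show ?case using Suc ct[OF wd, of n] by (simp add: wS)
    qed
    from this[of "N - 1"] ct[OF wd, of "N - 1"] N wN have "c v = i" by (simp add: wS)
    then show False using c ik by (simp add: cut_colourings_def)
  qed

  have "(\<Sum>v\<in>{..<d} - {u}. \<Sum>c\<in>cut_colourings m d g u v i k. colour_monom d c) =
      (\<Sum>v\<in>w ` {1..<N}. \<Sum>c\<in>cut_colourings m d g u v i k. colour_monom d c)"
  proof (rule sum.mono_neutral_right)
    show "w ` {1..<N} \<subseteq> {..<d} - {u}" using wd w_eq[of _ 0] w0 by auto
    show "\<forall>v\<in>{..<d} - {u} - w ` {1..<N}. (\<Sum>c\<in>cut_colourings m d g u v i k. colour_monom d c) = 0"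
    proof
      fix v assume v: "v \<in> {..<d} - {u} - w ` {1..<N}"
      have "v \<notin> orbit g u"
      proof
        assume "v \<in> orbit g u"
        then obtain n where n: "n < N" "v = w n" using orb by auto
        then show False using v w0 by (cases n) auto
      qed
      then show "(\<Sum>c\<in>cut_colourings m d g u v i k. colour_monom d c) = 0" by (simp add: empty)
    qed
  qed simp
  also have "\<dots> = (\<Sum>a\<in>{1..<N}. S a)"
    unfolding S_def
    by (subst sum.reindex) (auto intro: inj_on_subset[OF inj] simp: cut intro!: sum.cong)
  finally have "(yv i - yv k) * (\<Sum>v\<in>{..<d} - {u}. \<Sum>c\<in>cut_colourings m d g u v i k. colour_monom d c)
     = (\<Sum>a\<in>{1..<N}. yv k * S (Suc a) - yv k * S a)"
    by (simp add: sum_distrib_left left_diff_distrib step)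
  also have "\<dots> = yv k * S N - yv k * S 1"
    using sum_Suc_diff'[of 1 N "\<lambda>a. yv k * S a"] N by simp
  also have "yv k * S 1 = yv i * S 0" using step[of 0] N by simp
  finally show ?thesis using Xi Xk by (simp add: S_def)
qed

section \<open>The cut-and-join operator conjugated by the Vandermonde determinant\<close>

definition euler :: "nat \<Rightarrow> ppoly \<Rightarrow> ppoly" where
  "euler i f = yv i * ppoly_deriv (P' i) f"

interpretation euler: derivation "euler i" for i
  unfolding euler_def[abs_def] by (rule derivation_scale) (rule derivation_pderiv)

definition casimir :: "nat \<Rightarrow> rat" where
  "casimir m = (\<Sum>j<m. of_nat (m - 1) * of_nat j - of_nat j * (of_nat j - 1) / 2)"

text \<open>On monomials \<open>y^l\<close> this is the scalar \<open>\<Sum>i. l\<^sub>i(l\<^sub>i-1)/2 - (m-1) l\<^sub>i\<close>, normalised to vanish at the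
  exponents \<open>0, \<dots>, m-1\<close> of the Vandermonde determinant. For \<open>l\<^sub>i = \<lambda>\<^sub>i + m - i\<close> (\<open>1 \<le> i \<le> m\<close>) it is the content sum of \<open>\<lambda>\<close>.\<close>

definition cut_join :: "nat \<Rightarrow> ppoly \<Rightarrow> ppoly" where
  "cut_join m f = (\<Sum>i<m. pconst (1 / 2) * (euler i (euler i f) - euler i f) - of_nat (m - 1) * euler i f)
     + pconst (casimir m) * f"

definition vdm :: "nat \<Rightarrow> ppoly" where
  "vdm m = (\<Prod>b<m. \<Prod>a<b. yv b - yv a)"

lemma euler_yv: "euler i (yv j) = (if i = j then yv i else 0)"
  by (simp add: euler_def yv_def)

lemma euler_pconst [simp]: "euler i (pconst c) = 0"
  by (simp add: euler_def)

lemma cut_join_add: "cut_join m (f + g) = cut_join m f + cut_join m g"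
proof -
  have *: "(\<Sum>i<m. A i (f + g)) + c * (f + g) = ((\<Sum>i<m. A i f) + c * f) + ((\<Sum>i<m. A i g) + c * g)"
    if "\<And>i. A i (f + g) = A i f + A i g" for A :: "nat \<Rightarrow> ppoly \<Rightarrow> ppoly" and c
    by (simp add: that sum.distrib algebra_simps)
  show ?thesis unfolding cut_join_def by (rule *) (simp add: euler.add algebra_simps)
qed

lemma cut_join_0 [simp]: "cut_join m 0 = 0"
  by (simp add: cut_join_def)

lemma cut_join_sum: "cut_join m (\<Sum>x\<in>A. f x) = (\<Sum>x\<in>A. cut_join m (f x))"
  by (induction A rule: infinite_finite_induct) (auto simp: cut_join_add)

lemma cut_join_cmult:
  assumes "\<And>i. euler i s = 0"
  shows "cut_join m (s * f) = s * cut_join m f"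
  by (simp add: cut_join_def euler.mult assms algebra_simps sum_distrib_left)

lemma euler_prod_power:
  assumes "finite A"
  shows "euler i (\<Prod>j\<in>A. yv (c j)) = of_nat (card {j \<in> A. c j = i}) * (\<Prod>j\<in>A. yv (c j))"
  using assms
proof (induction A rule: finite_induct)
  case (insert a A)
  have "{j \<in> insert a A. c j = i} = (if c a = i then insert a {j \<in> A. c j = i} else {j \<in> A. c j = i})"
    by auto
  then show ?case using insert by (simp add: euler.mult euler_yv algebra_simps)
qed simp

lemma euler_monom: 
  assumes "i < m"
  shows "euler i (\<Prod>j<m. yv j ^ p j) = of_nat (p i) * (\<Prod>j<m. yv j ^ p j)"
proof -
  have e: "euler i (yv j ^ n) = (if j = i then of_nat n * yv j ^ n else 0)" for j n
    by (induction n) (auto simp: euler.mult euler_yv algebra_simps)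
  have "euler i (\<Prod>j<m. yv j ^ p j) = (\<Sum>j<m. euler i (yv j ^ p j) * (\<Prod>k\<in>{..<m} - {j}. yv k ^ p k))"
    by (rule euler.prod) simp
  also have "\<dots> = (\<Sum>j<m. if j = i then of_nat (p i) * (yv i ^ p i * (\<Prod>k\<in>{..<m} - {i}. yv k ^ p k)) else 0)"
    by (intro sum.cong) (auto simp: e)
  also have "\<dots> = of_nat (p i) * (yv i ^ p i * (\<Prod>k\<in>{..<m} - {i}. yv k ^ p k))"
    using assms by simp
  also have "yv i ^ p i * (\<Prod>k\<in>{..<m} - {i}. yv k ^ p k) = (\<Prod>j<m. yv j ^ p j)"
    using assms by (intro prod.remove[symmetric]) auto
  finally show ?thesis .
qed

text \<open>The eigenvalue on a monomial is symmetric in the exponents, and each monomial of the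
  Vandermonde determinant has as exponents a permutation of 0, ..., m-1.\<close>

lemma cut_join_vdm: "cut_join m (vdm m) = 0"
proof -
  let ?M = "\<lambda>p. \<Prod>j<m. yv j ^ p j"
  have z: "cut_join m (?M p) = 0" if p: "p permutes {..<m}" for p
  proof -
    have "cut_join m (?M p) = pconst ((\<Sum>i<m. 1 / 2 * (of_nat (p i) * of_nat (p i) - of_nat (p i)) -
        of_nat (m - 1) * of_nat (p i)) + casimir m) * ?M p"
      unfolding cut_join_def pconst_add distrib_right pconst.hom_sum sum_distrib_right
        pconst_diff pconst_mult pconst_of_nat
      by (intro arg_cong2[of _ _ _ _ "(+)"] sum.cong refl)
         (simp add: euler_monom euler.mult euler.of_nat algebra_simps del: of_nat_diff)
    also have "(\<Sum>i<m. 1 / 2 * (of_nat (p i) * of_nat (p i) - of_nat (p i)) - of_nat (m - 1) * of_nat (p i))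
       = (\<Sum>i<m. 1 / 2 * (of_nat i * of_nat i - of_nat i) - of_nat (m - 1) * of_nat i :: rat)"
      using sum.permute[OF p, of "\<lambda>i. 1 / 2 * (of_nat i * of_nat i - of_nat i) - of_nat (m - 1) * of_nat i :: rat"]
      by (simp add: comp_def)
    also have "\<dots> = - casimir m"
      unfolding casimir_def sum_negf[symmetric] by (intro sum.cong refl) (simp add: field_simps)
    finally show ?thesis by simp
  qed
  have "vdm m = fdet m (\<lambda>i j. yv i ^ j)"
    by (simp add: vdm_def vandermonde)
  then have "cut_join m (vdm m) = (\<Sum>p | p permutes {..<m}. signof p * cut_join m (?M p))"
    by (simp add: fdet_perms cut_join_sum cut_join_cmult euler.sign)
  also have "\<dots> = 0" by (intro sum.neutral) (use z in auto)
  finally show ?thesis .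
qed

text \<open>Leibniz rule for an operator of second order, with \<open>n i\<close> the degree of the
  monomial \<open>M\<close> in y_i. The factor 1/2 absorbs the doubled cross term; the last sum will
  count ordered pairs of points of equal colour, the middle one will match the cut
  colourings.\<close>

lemma cut_join_mult:
  assumes "\<And>i. i < m \<Longrightarrow> euler i M = of_nat (n i) * M"
  shows "cut_join m (V * M) = cut_join m V * M +
    (\<Sum>i<m. of_nat (n i) * (euler i V - of_nat (m - 1) * V)) * M +
    pconst (1 / 2) * (\<Sum>i<m. of_nat (n i) * (of_nat (n i) - 1)) * (V * M)"
proof -
  have half: "pconst (1 / 2) * 2 = 1"
    using pconst_mult[of "1/2" 2] pconst_of_nat[of 2] by simp
  have *: "pconst (1 / 2) * (euler i (euler i (V * M)) - euler i (V * M)) - of_nat (m - 1) * euler i (V * M)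
     = (pconst (1 / 2) * (euler i (euler i V) - euler i V) - of_nat (m - 1) * euler i V) * M
       + of_nat (n i) * (euler i V - of_nat (m - 1) * V) * M
       + pconst (1 / 2) * (of_nat (n i) * (of_nat (n i) - 1)) * (V * M)" if "i < m" for i
  proof -
    have *: "h * ((a2 * M + a * (k * M) + (a * (k * M) + V * (k * (k * M)))) - (a * M + V * (k * M)))
        - r * (a * M + V * (k * M)) =
      (h * (a2 - a) - r * a) * M + k * (a - r * V) * M + h * (k * (k - 1)) * (V * M)"
      if "h * 2 = 1" for h a a2 k r M :: ppoly
    proof -
      have "h * (a * (k * M)) + h * (a * (k * M)) = (h * 2) * (a * (k * M))" by (simp add: algebra_simps)
      then have "h * (a * (k * M)) + h * (a * (k * M)) = a * (k * M)" using that by simp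
      then show ?thesis by (simp add: algebra_simps)
    qed
    show ?thesis using *[OF half, of "euler i (euler i V)" M "euler i V" "of_nat (n i)" "of_nat (m - 1)"]
      by (simp only: euler.mult euler.add assms[OF that] euler.of_nat mult_zero_left add_0_left)
  qed
  have "cut_join m (V * M) = (\<Sum>i<m.
      (pconst (1 / 2) * (euler i (euler i V) - euler i V) - of_nat (m - 1) * euler i V) * M
       + of_nat (n i) * (euler i V - of_nat (m - 1) * V) * M
       + pconst (1 / 2) * (of_nat (n i) * (of_nat (n i) - 1)) * (V * M)) + pconst (casimir m) * V * M"
    unfolding cut_join_def by (intro arg_cong2[of _ _ _ _ "(+)"] sum.cong refl * mult.assoc[symmetric]) simp
  then show ?thesis
    unfolding cut_join_def sum.distrib sum_distrib_right[symmetric] sum_distrib_left[symmetric]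
    by (simp only: distrib_left distrib_right ac_simps)
qed

lemma sum_pairs: "(\<Sum>b<m. \<Sum>a<b. n a + n b :: nat) = (m - 1) * (\<Sum>i<m. n i)"
proof (induction m)
  case (Suc m)
  then show ?case by (cases m) (auto simp: sum.distrib algebra_simps)
qed simp

definition pairs :: "nat \<Rightarrow> (nat \<times> nat) set" where
  "pairs m = (SIGMA b:{..<m}. {..<b})"

text \<open>The quotient of the Vandermonde determinant by one difference, formed without
  division.\<close>

definition vdm_omit :: "nat \<Rightarrow> nat \<times> nat \<Rightarrow> ppoly" where
  "vdm_omit m p = (\<Prod>(b, a)\<in>pairs m - {p}. yv b - yv a)"

lemma finite_pairs [simp]: "finite (pairs m)"
  by (simp add: pairs_def)

lemma vdm_pairs: "vdm m = (\<Prod>(b, a)\<in>pairs m. yv b - yv a)"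
  by (simp add: vdm_def pairs_def prod.Sigma)

lemma vdm_omit: "(b, a) \<in> pairs m \<Longrightarrow> (yv b - yv a) * vdm_omit m (b, a) = vdm m"
  by (simp add: vdm_pairs vdm_omit_def prod.remove[of _ "(b, a)"])

text \<open>Each index lies in m-1 pairs, so (m-1) times the sum of the n_i can be spread over pairs
  as n_a + n_b. A pair then contributes n_b y_b - n_a y_a - (n_a + n_b)(y_b - y_a) = n_b y_a - n_a
  y_b, the shape of the end terms in \<open>cut_colourings_sum\<close>.\<close>

lemma euler_vdm:
  "(\<Sum>i<m. of_nat (n i) * (euler i (vdm m) - of_nat (m - 1) * vdm m)) =
    (\<Sum>(b, a)\<in>pairs m. vdm_omit m (b, a) * (of_nat (n b) * yv a - of_nat (n a) * yv b))"
proof -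
  have e: "euler i (vdm m) = (\<Sum>(b, a)\<in>pairs m. euler i (yv b - yv a) * vdm_omit m (b, a))" for i
    unfolding vdm_pairs vdm_omit_def by (subst euler.prod) (auto intro!: sum.cong)
  have d: "(\<Sum>i<m. of_nat (n i) * euler i (yv b - yv a)) = of_nat (n b) * yv b - of_nat (n a) * yv a"
    if "(b, a) \<in> pairs m" for a b
  proof -
    have "(\<Sum>i<m. of_nat (n i) * euler i (yv b - yv a)) =
       (\<Sum>i<m. if i = b then of_nat (n b) * yv b else 0) - (\<Sum>i<m. if i = a then of_nat (n a) * yv a else 0)"
      unfolding sum_subtractf[symmetric] by (intro sum.cong) (auto simp: euler.diff euler_yv)
    then show ?thesis using that by (auto simp: pairs_def)
  qed
  have "(\<Sum>i<m. of_nat (n i) * euler i (vdm m)) =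
     (\<Sum>(b, a)\<in>pairs m. (\<Sum>i<m. of_nat (n i) * euler i (yv b - yv a)) * vdm_omit m (b, a))"
    unfolding e sum_distrib_left sum_distrib_right case_prod_unfold mult.assoc by (rule sum.swap)
  also have "\<dots> = (\<Sum>(b, a)\<in>pairs m. (of_nat (n b) * yv b - of_nat (n a) * yv a) * vdm_omit m (b, a))"
    by (intro sum.cong) (auto simp: d)
  finally have 1: "(\<Sum>i<m. of_nat (n i) * euler i (vdm m)) = \<dots>" .
  have "(\<Sum>i<m. of_nat (n i) * (of_nat (m - 1) * vdm m)) = of_nat ((m - 1) * (\<Sum>i<m. n i)) * vdm m"
    unfolding of_nat_mult of_nat_sum sum_distrib_left sum_distrib_right
    by (intro sum.cong refl) (simp only: ac_simps)
  also have "\<dots> = of_nat (\<Sum>(b, a)\<in>pairs m. n a + n b) * vdm m"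
  proof -
    have "(\<Sum>(b, a)\<in>pairs m. n a + n b) = (m - 1) * (\<Sum>i<m. n i)"
      unfolding pairs_def sum_pairs[symmetric] by (rule sum.Sigma[symmetric]) auto
    then show ?thesis by simp
  qed
  also have "\<dots> = (\<Sum>(b, a)\<in>pairs m. (of_nat (n a) + of_nat (n b)) * ((yv b - yv a) * vdm_omit m (b, a)))"
    unfolding of_nat_sum sum_distrib_right by (intro sum.cong refl) (auto simp: vdm_omit)
  finally have 2: "(\<Sum>i<m. of_nat (n i) * (of_nat (m - 1) * vdm m)) = \<dots>" .
  show ?thesis
    unfolding right_diff_distrib sum_subtractf 1 2 unfolding sum_subtractf[symmetric]
    by (intro sum.cong refl) (auto simp: algebra_simps)
qed

lemma sum_transpositions:
  fixes F :: "(nat \<Rightarrow> nat) \<Rightarrow> ppoly"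
  shows "2 * (\<Sum>t\<in>transpositions d. F t) = (\<Sum>u<d. \<Sum>v\<in>{..<d} - {u}. F (transpose u v))"
proof -
  let ?L = "{(u, v). u < v \<and> v < d}"
  have fin: "finite ?L" by (rule finite_subset[of _ "{..<d} \<times> {..<d}"]) auto
  have inj: "inj_on (\<lambda>(u, v). transpose u v) ?L"
  proof (intro inj_onI, clarify)
    fix u v u' v' :: nat assume *: "u < v" "u' < v'" "transpose u v = transpose u' v'"
    have "transpose u' v' u = v" "transpose u' v' v = u" using *(3) by (metis transpose_apply_first transpose_apply_second)+
    then show "u = u' \<and> v = v'" using *(1,2) by (auto simp: transpose_def split: if_splits)
  qed
  have "transpositions d = (\<lambda>(u, v). transpose u v) ` ?L"
  proof (intro Set.set_eqI iffI)
    fix t assume "t \<in> transpositions d"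
    then obtain i j where ij: "i < d" "j < d" "i \<noteq> j" "t = transpose i j" by (auto simp: transpositions_def)
    have "t = (\<lambda>(u, v). transpose u v) (min i j, max i j)"
      using ij transpose_commute[of i j] by (auto simp: min_def max_def)
    moreover have "(min i j, max i j) \<in> ?L" using ij by (auto simp: min_def max_def)
    ultimately show "t \<in> (\<lambda>(u, v). transpose u v) ` ?L" by (rule image_eqI)
  qed (force simp: transpositions_def)
  then have 1: "(\<Sum>t\<in>transpositions d. F t) = (\<Sum>(u, v)\<in>?L. F (transpose u v))"
    using inj by (simp add: sum.reindex case_prod_unfold)
  have 2: "(\<Sum>(u, v)\<in>?L. F (transpose u v)) = (\<Sum>(u, v)\<in>{(u, v). v < u \<and> u < d}. F (transpose u v))"
    by (rule sum.reindex_bij_witness[where i = "\<lambda>(u, v). (v, u)" and j = "\<lambda>(u, v). (v, u)"])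
       (auto simp: transpose_commute)
  have "(\<Sum>u<d. \<Sum>v\<in>{..<d} - {u}. F (transpose u v)) =
      (\<Sum>(u, v)\<in>?L \<union> {(u, v). v < u \<and> u < d}. F (transpose u v))"
    by (subst sum.Sigma) (auto intro!: sum.cong)
  also have "\<dots> = (\<Sum>(u, v)\<in>?L. F (transpose u v)) + (\<Sum>(u, v)\<in>{(u, v). v < u \<and> u < d}. F (transpose u v))"
    by (rule sum.union_disjoint) (auto intro: finite_subset[of _ "{..<d} \<times> {..<d}"])
  finally show ?thesis unfolding 1 2 by simp
qed

definition ysum :: "nat \<Rightarrow> nat \<Rightarrow> (nat \<Rightarrow> nat) \<Rightarrow> ppoly" where
  "ysum m d g = cycle_weight (\<lambda>k. \<Sum>i<m. yv i ^ k) {..<d} g"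

lemma transpose_permutes_lessThan: "u < d \<Longrightarrow> v < d \<Longrightarrow> g permutes {..<d :: nat} \<Longrightarrow> transpose u v \<circ> g permutes {..<d}"
  by (intro permutes_compose permutes_swap_id) auto

text \<open>Swapping two points of equal colour is invisible to a colouring, so these colourings are
  the ones invariant under \<open>g\<close>. Unequal colours form a pair b > a, attached to u and v
  in one of two orders; hence two cut sums.\<close>

lemma ysum_transpose:
  assumes g: "g permutes {..<d}" and uv: "u < d" "v < d" "u \<noteq> v"
  shows "ysum m d (transpose u v \<circ> g) =
    (\<Sum>c\<in>invariant_colourings m d g. if c u = c v then colour_monom d c else 0) +
    (\<Sum>(b, a)\<in>pairs m. (\<Sum>c\<in>cut_colourings m d g u v b a. colour_monom d c) +
       (\<Sum>c\<in>cut_colourings m d g v u b a. colour_monom d c))"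
proof -
  let ?I = "invariant_colourings m d (transpose u v \<circ> g)"
  have t: "transpose u v \<circ> g = transpose v u \<circ> g" by (simp add: transpose_commute)
  have same: "{c \<in> ?I. c u = c v} = {c \<in> invariant_colourings m d g. c u = c v}"
  proof -
    have *: "c (transpose u v x) = c x" if "c u = c v" for c :: "nat \<Rightarrow> nat" and x
      using that by (auto simp: transpose_def)
    show ?thesis
    proof (rule Collect_cong)
      fix c :: "nat \<Rightarrow> nat"
      show "c \<in> ?I \<and> c u = c v \<longleftrightarrow> c \<in> invariant_colourings m d g \<and> c u = c v"
        using *[of c] by (cases "c u = c v") (simp_all add: invariant_colourings_def)
    qed
  qed
  have diff: "{c \<in> ?I. c u \<noteq> c v} =
      (\<Union>(b, a)\<in>pairs m. cut_colourings m d g u v b a \<union> cut_colourings m d g v u b a)"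
  proof (intro Set.set_eqI iffI)
    fix c assume c: "c \<in> {c \<in> ?I. c u \<noteq> c v}"
    then have "c u < m" "c v < m" using uv by (auto simp: invariant_colourings_def)
    then have "(c u, c v) \<in> pairs m \<or> (c v, c u) \<in> pairs m" using c by (auto simp: pairs_def)
    then show "c \<in> (\<Union>(b, a)\<in>pairs m. cut_colourings m d g u v b a \<union> cut_colourings m d g v u b a)"
      using c unfolding cut_colourings_def t[symmetric] by fastforce
  qed (auto simp: cut_colourings_def t[symmetric] pairs_def)
  have fin: "finite (cut_colourings m d g u' v' i k)" for u' v' i k
    by (simp add: cut_colourings_def)
  have "ysum m d (transpose u v \<circ> g) = (\<Sum>c\<in>?I. colour_monom d c)"
    unfolding ysum_def using sum_colour_monom[OF transpose_permutes_lessThan[OF uv(1,2) g]] by simp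
  also have "?I = {c \<in> ?I. c u = c v} \<union> {c \<in> ?I. c u \<noteq> c v}" by auto
  also have "(\<Sum>c\<in>\<dots>. colour_monom d c) = (\<Sum>c\<in>{c \<in> ?I. c u = c v}. colour_monom d c) +
      (\<Sum>c\<in>{c \<in> ?I. c u \<noteq> c v}. colour_monom d c)"
    by (rule sum.union_disjoint) auto
  also have "(\<Sum>c\<in>{c \<in> ?I. c u = c v}. colour_monom d c) =
      (\<Sum>c\<in>invariant_colourings m d g. if c u = c v then colour_monom d c else 0)"
    unfolding same by (simp add: sum.If_cases Int_def)
  also have "(\<Sum>c\<in>{c \<in> ?I. c u \<noteq> c v}. colour_monom d c) =
      (\<Sum>(b, a)\<in>pairs m. \<Sum>c\<in>cut_colourings m d g u v b a \<union> cut_colourings m d g v u b a. colour_monom d c)"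
    unfolding diff case_prod_unfold
    by (rule sum.UNION_disjoint) (auto simp: fin, auto simp: cut_colourings_def pairs_def)
  also have "\<dots> = (\<Sum>(b, a)\<in>pairs m. (\<Sum>c\<in>cut_colourings m d g u v b a. colour_monom d c) +
       (\<Sum>c\<in>cut_colourings m d g v u b a. colour_monom d c))"
    unfolding case_prod_unfold
    by (intro sum.cong refl sum.union_disjoint) (auto simp: fin, auto simp: cut_colourings_def pairs_def)
  finally show ?thesis .
qed

lemma card_ordered_monochrome_pairs:
  fixes c :: "nat \<Rightarrow> nat"
  assumes "c \<in> {..<d} \<rightarrow> {..<m}"
  shows "(\<Sum>u<d. \<Sum>v\<in>{..<d} - {u}. if c u = c v then M else 0) =
    (\<Sum>i<m. of_nat (card {x \<in> {..<d}. c x = i}) * (of_nat (card {x \<in> {..<d}. c x = i}) - 1)) * (M :: ppoly)"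
proof -
  let ?n = "\<lambda>i. card {x \<in> {..<d}. c x = i}"
  have "(\<Sum>v\<in>{..<d} - {u}. if c u = c v then M else 0) = (of_nat (?n (c u)) - 1) * M" if "u < d" for u
  proof -
    have "(\<Sum>v<d. if c u = c v then M else 0) = (\<Sum>v\<in>{x \<in> {..<d}. c x = c u}. M)"
      by (subst sum.If_cases) (auto simp: Int_def intro!: arg_cong[of _ _ card])
    moreover have "(\<Sum>v<d. if c u = c v then M else 0) = M + (\<Sum>v\<in>{..<d} - {u}. if c u = c v then M else 0)"
      using that by (subst sum.remove[of _ u]) auto
    ultimately show ?thesis by (simp add: algebra_simps)
  qed
  then have "(\<Sum>u<d. \<Sum>v\<in>{..<d} - {u}. if c u = c v then M else 0) = (\<Sum>u<d. (of_nat (?n (c u)) - 1) * M)"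
    by simp
  also have "\<dots> = (\<Sum>i<m. \<Sum>u\<in>{x \<in> {..<d}. c x = i}. (of_nat (?n (c u)) - 1) * M)"
    by (rule sum.group[symmetric]) (use assms in auto)
  also have "\<dots> = (\<Sum>i<m. of_nat (?n i) * ((of_nat (?n i) - 1) * M))"
    by (intro sum.cong refl) simp
  finally show ?thesis by (simp add: sum_distrib_right mult.assoc)
qed

lemma sum_if_colour:
  "(\<Sum>u<d. \<Sum>c | c \<in> invariant_colourings m d g \<and> c u = i. colour_monom d c) =
    (\<Sum>c\<in>invariant_colourings m d g. of_nat (card {x \<in> {..<d}. c x = i}) * colour_monom d c)"
proof -
  have "(\<Sum>u<d. \<Sum>c | c \<in> invariant_colourings m d g \<and> c u = i. colour_monom d c) =
     (\<Sum>u<d. \<Sum>c\<in>invariant_colourings m d g. if c u = i then colour_monom d c else 0)"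
    by (simp add: sum.If_cases Int_def)
  also have "\<dots> = (\<Sum>c\<in>invariant_colourings m d g. \<Sum>u<d. if c u = i then colour_monom d c else 0)"
    by (rule sum.swap)
  also have "\<dots> = (\<Sum>c\<in>invariant_colourings m d g. of_nat (card {x \<in> {..<d}. c x = i}) * colour_monom d c)"
    by (intro sum.cong refl) (simp add: sum.If_cases Int_def)
  finally show ?thesis .
qed

text \<open>Twice the left-hand sum runs over ordered pairs (u, v). Equally coloured pairs give the
  term n_i(n_i - 1); the others, after the telescoping for each pair of colours, give the
  first-order term in the form of \<open>euler_vdm\<close>.\<close>

lemma cut_join_ysum:
  assumes g: "g permutes {..<d}"
  shows "vdm m * (\<Sum>t\<in>transpositions d. ysum m d (t \<circ> g)) = cut_join m (vdm m * ysum m d g)"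
proof -
  let ?I = "invariant_colourings m d g"
  let ?n = "\<lambda>c i. card {x \<in> {..<d}. c x = i}"
  let ?S = "\<lambda>u v b a. \<Sum>c\<in>cut_colourings m d g u v b a. colour_monom d c"
  let ?V = "\<lambda>b a. vdm_omit m (b, a)"
  have c: "c \<in> {..<d} \<rightarrow> {..<m}" if "c \<in> ?I" for c
    using that by (auto simp: invariant_colourings_def)
  have "cut_join m (vdm m * ysum m d g) = (\<Sum>c\<in>?I. cut_join m (vdm m * colour_monom d c))"
    unfolding ysum_def sum_colour_monom[OF g, symmetric] by (simp add: sum_distrib_left cut_join_sum)
  also have "\<dots> = (\<Sum>c\<in>?I.
      (\<Sum>(b, a)\<in>pairs m. ?V b a * (of_nat (?n c b) * yv a - of_nat (?n c a) * yv b)) * colour_monom d c +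
      pconst (1 / 2) * (\<Sum>i<m. of_nat (?n c i) * (of_nat (?n c i) - 1)) * (vdm m * colour_monom d c))"
  proof (intro sum.cong refl)
    fix c
    have "euler i (colour_monom d c) = of_nat (?n c i) * colour_monom d c" for i
      unfolding colour_monom_def by (rule euler_prod_power) simp
    from cut_join_mult[OF this, of m "vdm m"]
    show "cut_join m (vdm m * colour_monom d c) =
      (\<Sum>(b, a)\<in>pairs m. ?V b a * (of_nat (?n c b) * yv a - of_nat (?n c a) * yv b)) * colour_monom d c +
      pconst (1 / 2) * (\<Sum>i<m. of_nat (?n c i) * (of_nat (?n c i) - 1)) * (vdm m * colour_monom d c)"
      unfolding euler_vdm cut_join_vdm by simp
  qed
  finally have R0: "cut_join m (vdm m * ysum m d g) = \<dots>" .
  have R: "cut_join m (vdm m * ysum m d g) =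
     (\<Sum>c\<in>?I. (\<Sum>(b, a)\<in>pairs m. ?V b a * (of_nat (?n c b) * yv a - of_nat (?n c a) * yv b)) * colour_monom d c) +
     pconst (1 / 2) * (vdm m * (\<Sum>c\<in>?I. (\<Sum>i<m. of_nat (?n c i) * (of_nat (?n c i) - 1)) * colour_monom d c))"
  proof -
    have *: "(\<Sum>c\<in>?I. h * A c * (V * B c)) = h * (V * (\<Sum>c\<in>?I. A c * B c))"
      for h V :: ppoly and A B
      unfolding sum_distrib_left by (intro sum.cong refl) (simp only: ac_simps)
    show ?thesis unfolding R0 sum.distrib * ..
  qed

  have join: "(\<Sum>u<d. \<Sum>v\<in>{..<d} - {u}. \<Sum>c\<in>?I. if c u = c v then colour_monom d c else 0) =
      (\<Sum>c\<in>?I. (\<Sum>i<m. of_nat (?n c i) * (of_nat (?n c i) - 1)) * colour_monom d c)"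
  proof -
    have "(\<Sum>u<d. \<Sum>v\<in>{..<d} - {u}. \<Sum>c\<in>?I. if c u = c v then colour_monom d c else 0) =
       (\<Sum>u<d. \<Sum>c\<in>?I. \<Sum>v\<in>{..<d} - {u}. if c u = c v then colour_monom d c else 0)"
      by (intro sum.cong refl sum.swap)
    also have "\<dots> = (\<Sum>c\<in>?I. \<Sum>u<d. \<Sum>v\<in>{..<d} - {u}. if c u = c v then colour_monom d c else 0)"
      by (rule sum.swap)
    also have "\<dots> = (\<Sum>c\<in>?I. (\<Sum>i<m. of_nat (?n c i) * (of_nat (?n c i) - 1)) * colour_monom d c)"
      by (intro sum.cong refl card_ordered_monochrome_pairs c)
    finally show ?thesis .
  qed
  have swap: "(\<Sum>u<d. \<Sum>v\<in>{..<d} - {u}. F v u) = (\<Sum>u<d. \<Sum>v\<in>{..<d} - {u}. F u v)" for F :: "nat \<Rightarrow> nat \<Rightarrow> ppoly"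
    by (simp add: sum.Sigma)
       (rule sum.reindex_bij_witness[where i = "\<lambda>(u, v). (v, u)" and j = "\<lambda>(u, v). (v, u)"], auto)
  have "vdm m * (\<Sum>u<d. \<Sum>v\<in>{..<d} - {u}. \<Sum>(b, a)\<in>pairs m. ?S u v b a) =
     (\<Sum>c\<in>?I. (\<Sum>(b, a)\<in>pairs m. ?V b a * (of_nat (?n c b) * yv a - of_nat (?n c a) * yv b)) * colour_monom d c)"
  proof -
    have "(\<Sum>u<d. \<Sum>v\<in>{..<d} - {u}. \<Sum>(b, a)\<in>pairs m. ?S u v b a) =
        (\<Sum>u<d. \<Sum>(b, a)\<in>pairs m. \<Sum>v\<in>{..<d} - {u}. ?S u v b a)"
      unfolding case_prod_unfold by (intro sum.cong refl sum.swap)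
    also have "\<dots> = (\<Sum>(b, a)\<in>pairs m. \<Sum>u<d. \<Sum>v\<in>{..<d} - {u}. ?S u v b a)"
      unfolding case_prod_unfold by (rule sum.swap)
    finally have "vdm m * (\<Sum>u<d. \<Sum>v\<in>{..<d} - {u}. \<Sum>(b, a)\<in>pairs m. ?S u v b a) =
      (\<Sum>(b, a)\<in>pairs m. vdm m * (\<Sum>u<d. \<Sum>v\<in>{..<d} - {u}. ?S u v b a))"
      by (simp only: sum_distrib_left case_prod_unfold)
    also have "\<dots> = (\<Sum>(b, a)\<in>pairs m. ?V b a *
        (\<Sum>c\<in>?I. (of_nat (?n c b) * yv a - of_nat (?n c a) * yv b) * colour_monom d c))"
    proof (intro sum.cong refl, clarify)
      fix a b assume p: "(b, a) \<in> pairs m"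
      have "vdm m * (\<Sum>u<d. \<Sum>v\<in>{..<d} - {u}. ?S u v b a) =
        ?V b a * (\<Sum>u<d. (yv b - yv a) * (\<Sum>v\<in>{..<d} - {u}. ?S u v b a))"
        unfolding vdm_omit[OF p, symmetric] sum_distrib_left[symmetric] by (simp add: ac_simps)
      also have "(\<Sum>u<d. (yv b - yv a) * (\<Sum>v\<in>{..<d} - {u}. ?S u v b a)) =
        (\<Sum>u<d. yv a * (\<Sum>c | c \<in> ?I \<and> c u = b. colour_monom d c) -
          yv b * (\<Sum>c | c \<in> ?I \<and> c u = a. colour_monom d c))"
        by (intro sum.cong refl cut_colourings_sum[OF g]) (use p in \<open>auto simp: pairs_def\<close>)
      also have "\<dots> = yv a * (\<Sum>c\<in>?I. of_nat (?n c b) * colour_monom d c) -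
          yv b * (\<Sum>c\<in>?I. of_nat (?n c a) * colour_monom d c)"
        unfolding sum_subtractf sum_distrib_left[symmetric] sum_if_colour ..
      also have "\<dots> = (\<Sum>c\<in>?I. (of_nat (?n c b) * yv a - of_nat (?n c a) * yv b) * colour_monom d c)"
        unfolding sum_distrib_left sum_subtractf[symmetric]
        by (intro sum.cong refl) (simp add: algebra_simps)
      finally show "vdm m * (\<Sum>u<d. \<Sum>v\<in>{..<d} - {u}. ?S u v b a) = ?V b a *
        (\<Sum>c\<in>?I. (of_nat (?n c b) * yv a - of_nat (?n c a) * yv b) * colour_monom d c)" .
    qed
    also have "\<dots> = (\<Sum>c\<in>?I. \<Sum>(b, a)\<in>pairs m. ?V b a * ((of_nat (?n c b) * yv a - of_nat (?n c a) * yv b) * colour_monom d c))"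
      unfolding sum_distrib_left case_prod_unfold by (rule sum.swap)
    also have "\<dots> = (\<Sum>c\<in>?I. (\<Sum>(b, a)\<in>pairs m. ?V b a * (of_nat (?n c b) * yv a - of_nat (?n c a) * yv b)) * colour_monom d c)"
      unfolding sum_distrib_right case_prod_unfold mult.assoc ..
    finally show ?thesis .
  qed
  note cut = this

  have "2 * (\<Sum>t\<in>transpositions d. ysum m d (t \<circ> g)) =
      (\<Sum>u<d. \<Sum>v\<in>{..<d} - {u}. ysum m d (transpose u v \<circ> g))"
    by (rule sum_transpositions)
  also have "\<dots> = (\<Sum>u<d. \<Sum>v\<in>{..<d} - {u}.
     (\<Sum>c\<in>?I. if c u = c v then colour_monom d c else 0) +
     ((\<Sum>(b, a)\<in>pairs m. ?S u v b a) + (\<Sum>(b, a)\<in>pairs m. ?S v u b a)))"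
    by (intro sum.cong refl, subst ysum_transpose[OF g]) (auto simp: sum.distrib case_prod_unfold)
  also have "\<dots> = (\<Sum>c\<in>?I. (\<Sum>i<m. of_nat (?n c i) * (of_nat (?n c i) - 1)) * colour_monom d c) +
     2 * (\<Sum>u<d. \<Sum>v\<in>{..<d} - {u}. \<Sum>(b, a)\<in>pairs m. ?S u v b a)"
    unfolding sum.distrib join swap[of "\<lambda>u v. \<Sum>(b, a)\<in>pairs m. ?S u v b a"] by simp
  finally have L: "2 * (\<Sum>t\<in>transpositions d. ysum m d (t \<circ> g)) =
     (\<Sum>c\<in>?I. (\<Sum>i<m. of_nat (?n c i) * (of_nat (?n c i) - 1)) * colour_monom d c) +
     2 * (\<Sum>u<d. \<Sum>v\<in>{..<d} - {u}. \<Sum>(b, a)\<in>pairs m. ?S u v b a)" .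
  have half: "V * T = C + h * (V * J)" if "2 * T = J + 2 * K" "V * K = C" "h * 2 = 1" for V T C h J K :: ppoly
  proof -
    have "V * T = h * 2 * (V * T)" using that by simp
    also have "\<dots> = h * (V * (2 * T))" by (simp add: ac_simps)
    also have "\<dots> = h * (V * J) + h * 2 * (V * K)" unfolding that(1) by (simp add: algebra_simps)
    finally show ?thesis using that by simp
  qed
  have "pconst (1 / 2) * 2 = 1"
    using pconst_mult[of "1/2" 2] pconst_of_nat[of 2] by simp
  from half[OF L cut this] show ?thesis unfolding R .
qed

section \<open>Specialising the second set of power sums\<close>

definition power_sums :: "nat \<Rightarrow> ppoly \<Rightarrow> ppoly" where
  "power_sums m = psubst (\<lambda>v. case v of P k \<Rightarrow> var_poly (P k) | P' k \<Rightarrow> (\<Sum>i<m. yv i ^ k))"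

interpretation power_sums: comm_ring_hom "power_sums m" for m
  unfolding power_sums_def by (rule psubst.comm_ring_hom_axioms)

lemma power_sums_pconst [simp]: "power_sums m (pconst c) = pconst c"
  and power_sums_P [simp]: "power_sums m (var_poly (P k)) = var_poly (P k)"
  and power_sums_P' [simp]: "power_sums m (var_poly (P' k)) = (\<Sum>i<m. yv i ^ k)"
  by (simp_all add: power_sums_def)

text \<open>The domain on which the specialisation is injective. Index 0 is left out because the
  power sum of exponent 0 is the constant m, and indices above m because those power sums depend on
  the first m.\<close>

inductive_set bounded_polys :: "nat \<Rightarrow> ppoly set" for m where
  const: "pconst c \<in> bounded_polys m"
| P: "var_poly (P k) \<in> bounded_polys m"
| P': "1 \<le> k \<Longrightarrow> k \<le> m \<Longrightarrow> var_poly (P' k) \<in> bounded_polys m"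
| add: "f \<in> bounded_polys m \<Longrightarrow> g \<in> bounded_polys m \<Longrightarrow> f + g \<in> bounded_polys m"
| mult: "f \<in> bounded_polys m \<Longrightarrow> g \<in> bounded_polys m \<Longrightarrow> f * g \<in> bounded_polys m"

lemma bounded_polys_0 [simp]: "0 \<in> bounded_polys m"
  and bounded_polys_1 [simp]: "1 \<in> bounded_polys m"
  using bounded_polys.const[of 0 m] bounded_polys.const[of 1 m] by simp_all

lemma bounded_polys_uminus: "f \<in> bounded_polys m \<Longrightarrow> - f \<in> bounded_polys m"
  using bounded_polys.mult[OF bounded_polys.const[of "- 1" m], of f] by (simp add: pconst_uminus)

lemma bounded_polys_diff: "f \<in> bounded_polys m \<Longrightarrow> g \<in> bounded_polys m \<Longrightarrow> f - g \<in> bounded_polys m"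
  using bounded_polys.add[of f m "- g"] by (simp add: bounded_polys_uminus)

lemma bounded_polys_sum: "(\<And>x. x \<in> A \<Longrightarrow> f x \<in> bounded_polys m) \<Longrightarrow> (\<Sum>x\<in>A. f x) \<in> bounded_polys m"
  by (induction A rule: infinite_finite_induct) (auto intro: bounded_polys.add)

lemma bounded_polys_prod: "(\<And>x. x \<in> A \<Longrightarrow> f x \<in> bounded_polys m) \<Longrightarrow> (\<Prod>x\<in>A. f x) \<in> bounded_polys m"
  by (induction A rule: infinite_finite_induct) (auto intro: bounded_polys.mult)

lemma bounded_polys_pderiv: "f \<in> bounded_polys m \<Longrightarrow> ppoly_deriv v f \<in> bounded_polys m"
  by (induction rule: bounded_polys.induct)
     (auto simp: pderiv.add pderiv.mult intro: bounded_polys.intros)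

lemma bounded_polys_pderiv_eq_0:
  "f \<in> bounded_polys m \<Longrightarrow> \<not> (1 \<le> k \<and> k \<le> m) \<Longrightarrow> ppoly_deriv (P' k) f = 0"
  by (induction rule: bounded_polys.induct) (auto simp: pderiv.add pderiv.mult)

text \<open>Chain rule: the power sum of exponent k+1 has derivative (k+1) y_i^k. The result is the
  value at y_i of one polynomial with coefficients independent of i.\<close>

lemma pderiv_power_sums:
  assumes "f \<in> bounded_polys m" "i < m"
  shows "ppoly_deriv (P' i) (power_sums m f) =
    (\<Sum>k<m. of_nat (Suc k) * power_sums m (ppoly_deriv (P' (Suc k)) f) * yv i ^ k)"
  using assms(1)
proof (induction rule: bounded_polys.induct)
  case (P' k)
  have "ppoly_deriv (P' i) (yv j ^ k) = (if j = i then of_nat k * yv i ^ (k - 1) else 0)" for j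
    by (simp add: pderiv.power yv_def)
  then have "ppoly_deriv (P' i) (power_sums m (var_poly (P' k))) = of_nat k * yv i ^ (k - 1)"
    using assms(2) by (simp add: pderiv.sum)
  moreover have "(\<Sum>j<m. of_nat (Suc j) * power_sums m (ppoly_deriv (P' (Suc j)) (var_poly (P' k))) * yv i ^ j) =
     (\<Sum>j<m. if j = k - 1 then of_nat k * yv i ^ (k - 1) else 0)"
    using P' by (intro sum.cong) auto
  ultimately show ?case using P' by simp
next
  case (add f g)
  then show ?case
    by (simp add: power_sums.hom_add pderiv.add algebra_simps sum.distrib)
next
  case (mult f g)
  have "ppoly_deriv (P' i) (power_sums m (f * g)) =
     (\<Sum>k<m. of_nat (Suc k) * power_sums m (ppoly_deriv (P' (Suc k)) f) * yv i ^ k) * power_sums m g +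
     power_sums m f * (\<Sum>k<m. of_nat (Suc k) * power_sums m (ppoly_deriv (P' (Suc k)) g) * yv i ^ k)"
    by (simp only: power_sums.hom_mult pderiv.mult mult.IH)
  also have "\<dots> = (\<Sum>k<m. of_nat (Suc k) * power_sums m (ppoly_deriv (P' (Suc k)) (f * g)) * yv i ^ k)"
    unfolding sum_distrib_left sum_distrib_right sum.distrib[symmetric]
    by (intro sum.cong refl)
       (simp only: pderiv.mult power_sums.hom_mult power_sums.hom_add distrib_left distrib_right ac_simps)
  finally show ?case .
qed (auto simp: power_sums.hom_zero)

definition total_degree :: "(pvar \<Rightarrow>\<^sub>0 nat) \<Rightarrow> nat" where
  "total_degree n = (\<Sum>v\<in>Poly_Mapping.keys n. Poly_Mapping.lookup n v)"

lemma total_degree_Suc: "total_degree (n + Poly_Mapping.single v 1) = Suc (total_degree n)"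
proof -
  have *: "total_degree k = (\<Sum>w\<in>insert v (Poly_Mapping.keys n). Poly_Mapping.lookup k w)"
    if "Poly_Mapping.keys k \<subseteq> insert v (Poly_Mapping.keys n)" for k
    unfolding total_degree_def
    by (rule sum.mono_neutral_left) (use that in \<open>auto simp: in_keys_iff\<close>)
  have "Poly_Mapping.keys (n + Poly_Mapping.single v 1) \<subseteq> insert v (Poly_Mapping.keys n)"
    using keys_add[of n "Poly_Mapping.single v 1"] by auto
  from *[OF this] *[OF subset_insertI] show ?thesis
    by (auto simp: lookup_add sum.distrib lookup_single when_def)
qed

lemma yv_inj: "yv i = yv j \<longleftrightarrow> i = j"
proof
  assume "yv i = yv j"
  then have "Poly_Mapping.lookup (yv i) (Poly_Mapping.single (P' i) 1) = Poly_Mapping.lookup (yv j) (Poly_Mapping.single (P' i) 1)"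
    by simp
  then have "Poly_Mapping.single (P' j) (1::nat) = Poly_Mapping.single (P' i) 1"
    by (simp add: yv_def var_poly_def lookup_single when_def split: if_splits)
  then have "Poly_Mapping.lookup (Poly_Mapping.single (P' j) (1::nat)) (P' i) = Poly_Mapping.lookup (Poly_Mapping.single (P' i) 1) (P' i)"
    by simp
  then show "i = j" by (simp add: lookup_single when_def split: if_splits)
qed simp

lemma power_sums_fixed:
  assumes "\<And>n k. n \<in> Poly_Mapping.keys f \<Longrightarrow> Poly_Mapping.lookup n (P' k) = 0"
  shows "power_sums m f = f"
proof -
  have "power_sums m f = (\<Sum>n\<in>Poly_Mapping.keys f. Poly_Mapping.single n (Poly_Mapping.lookup f n))"
    unfolding power_sums_def psubst_def
  proof (intro sum.cong refl)
    fix n assume n: "n \<in> Poly_Mapping.keys f"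
    have "(\<Prod>v\<in>Poly_Mapping.keys n. (case v of P k \<Rightarrow> var_poly (P k) | P' k \<Rightarrow> \<Sum>i<m. yv i ^ k) ^ Poly_Mapping.lookup n v)
       = (\<Prod>v\<in>Poly_Mapping.keys n. var_poly v ^ Poly_Mapping.lookup n v)"
    proof (intro prod.cong refl)
      fix v show "(case v of P k \<Rightarrow> var_poly (P k) | P' k \<Rightarrow> \<Sum>i<m. yv i ^ k) ^ Poly_Mapping.lookup n v
         = var_poly v ^ Poly_Mapping.lookup n v"
        using assms[OF n] by (cases v) simp_all
    qed
    then show "pconst (Poly_Mapping.lookup f n) *
        (\<Prod>v\<in>Poly_Mapping.keys n. (case v of P k \<Rightarrow> var_poly (P k) | P' k \<Rightarrow> \<Sum>i<m. yv i ^ k) ^ Poly_Mapping.lookup n v)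
      = Poly_Mapping.single n (Poly_Mapping.lookup f n)"
      by (simp add: single_eq_prod[of n "Poly_Mapping.lookup f n"])
  qed
  then show ?thesis using ppoly_sum_single[of f] by simp
qed

text \<open>Algebraic independence of the first \<open>m\<close> power sums in \<open>m\<close> variables: the Jacobian matrix is a
  Vandermonde matrix, so an algebraic relation forces all its partial derivatives to be relations too.\<close>

lemma power_sums_eq_0:
  assumes "f \<in> bounded_polys m" "power_sums m f = 0" "\<And>n. n \<in> Poly_Mapping.keys f \<Longrightarrow> total_degree n < N"
  shows "f = 0"
  using assms
proof (induction N arbitrary: f)
  case 0
  have "Poly_Mapping.keys f = {}" using 0(3) not_less_zero by blast
  then show ?case using ppoly_sum_single[of f] by simp
next
  case (Suc N)
  \<comment> \<open>This polynomial vanishes at the m distinct elements \<open>yv i\<close> of an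
    integral domain but has no term of degree m or more, so it is 0. Counting roots takes the place
    of inverting the Jacobian.\<close>
  define q where "q = (\<Sum>k<m. monom (of_nat (Suc k) * power_sums m (ppoly_deriv (P' (Suc k)) f)) k)"
  have coeff_q: "coeff q k = of_nat (Suc k) * power_sums m (ppoly_deriv (P' (Suc k)) f)" if "k < m" for k
    using that by (simp add: q_def coeff_sum)
  have "q = 0"
  proof (rule ccontr)
    assume "q \<noteq> 0"
    have root: "poly q (yv i) = 0" if "i < m" for i
      using pderiv_power_sums[OF Suc.prems(1) that] Suc.prems(2)
      by (simp add: q_def poly_sum poly_monom del: of_nat_Suc)
    have "m = card (yv ` {..<m})" by (subst card_image) (auto simp: inj_on_def yv_inj)
    also have "\<dots> \<le> card {x. poly q x = 0}"
      using root by (intro card_mono poly_roots_finite \<open>q \<noteq> 0\<close>) auto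
    also have "\<dots> \<le> degree q" by (rule card_poly_roots_bound) fact
    finally have "m \<le> degree q" .
    moreover have "coeff q (degree q) = 0" if "m \<le> degree q"
      using that unfolding q_def coeff_sum by (intro sum.neutral) auto
    ultimately show False using \<open>q \<noteq> 0\<close> by simp
  qed
  have zero: "ppoly_deriv (P' k) f = 0" for k
  proof (cases "1 \<le> k \<and> k \<le> m")
    case True
    then have "power_sums m (ppoly_deriv (P' k) f) = 0"
      using coeff_q[of "k - 1"] \<open>q = 0\<close> by (cases k) (auto simp del: of_nat_Suc)
    moreover have "total_degree n < N" if "n \<in> Poly_Mapping.keys (ppoly_deriv (P' k) f)" for n
    proof -
      have "n + Poly_Mapping.single (P' k) 1 \<in> Poly_Mapping.keys f"
        using that by (auto simp: in_keys_iff lookup_pderiv)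
      then show ?thesis using Suc.prems(3) total_degree_Suc by fastforce
    qed
    ultimately show ?thesis using Suc.IH bounded_polys_pderiv[OF Suc.prems(1)] by blast
  qed (use bounded_polys_pderiv_eq_0[OF Suc.prems(1)] in blast)
  \<comment> \<open>With all these derivatives zero, \<open>f\<close> contains none of the variables
    that the specialisation moves.\<close>
  then have "power_sums m f = f"
    by (intro power_sums_fixed) (rule ppoly_pderiv_eq_0)
  then show ?case using Suc.prems(2) by simp
qed

lemma power_sums_inj:
  assumes "f \<in> bounded_polys m" "g \<in> bounded_polys m" "power_sums m f = power_sums m g"
  shows "f = g"
proof -
  have "f - g = 0"
  proof (rule power_sums_eq_0)
    show "f - g \<in> bounded_polys m" using assms by (intro bounded_polys_diff)
    show "power_sums m (f - g) = 0" using assms by (simp add: power_sums.hom_minus)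
    show "total_degree n < Suc (Max (total_degree ` Poly_Mapping.keys (f - g)))" if "n \<in> Poly_Mapping.keys (f - g)" for n
      using that by (simp add: less_Suc_eq_le)
  qed
  then show ?thesis by simp
qed

section \<open>The coefficients of the generating function\<close>

abbreviation p_weight :: "nat \<Rightarrow> (nat \<Rightarrow> nat) \<Rightarrow> ppoly" where
  "p_weight d \<equiv> cycle_weight (\<lambda>k. var_poly (P k)) {..<d}"

abbreviation p'_weight :: "nat \<Rightarrow> (nat \<Rightarrow> nat) \<Rightarrow> ppoly" where
  "p'_weight d \<equiv> cycle_weight (\<lambda>k. var_poly (P' k)) {..<d}"

abbreviation transposition_lists :: "nat \<Rightarrow> nat \<Rightarrow> (nat \<Rightarrow> nat) list set" where
  "transposition_lists d b \<equiv> listset (replicate b (transpositions d))"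

lemma orbit_card_bounds:
  assumes "g permutes {..<d}" "C \<in> orbit g ` {..<d}"
  shows "1 \<le> card C" "card C \<le> d"
proof -
  from assms obtain x where x: "x < d" "C = orbit g x" by auto
  have sub: "C \<subseteq> {..<d}" using permutes_orbit_subset[OF assms(1), of x] x by auto
  then have "card C \<le> card {..<d}" by (intro card_mono) auto
  then show "card C \<le> d" by simp
  show "1 \<le> card C"
    using sub x orbit_nonempty[of g x] finite_subset[OF sub] by (simp add: Suc_le_eq card_gt_0_iff)
qed

lemma cycle_type_partitions:
  assumes g: "g permutes {..<d}"
  shows "cycle_type d g \<in> partitions d"
proof -
  have "\<Sum>\<^sub># (cycle_type d g) = (\<Sum>C\<in>orbit g ` {..<d}. card C)"
    by (simp add: cycle_type_def sum_unfold_sum_mset)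
  also have "\<dots> = card (\<Union>(orbit g ` {..<d}))"
  proof (rule card_Union_disjoint[symmetric])
    show "pairwise disjnt (orbit g ` {..<d})"
      unfolding pairwise_def disjnt_def
    proof (intro ballI impI, elim imageE)
      fix C D x y assume *: "C \<noteq> D" "C = orbit g x" "D = orbit g y"
      show "C \<inter> D = {}"
      proof (rule ccontr)
        assume "C \<inter> D \<noteq> {}"
        then obtain z where "z \<in> orbit g x" "z \<in> orbit g y" using * by auto
        then have "orbit g x = orbit g z" "orbit g y = orbit g z"
          using orbit_eq_iff[OF g, of x z] orbit_eq_iff[OF g, of y z] by auto
        then show False using * by simp
      qed
    qed
    show "finite A" if "A \<in> orbit g ` {..<d}" for A
      using orbit_card_bounds(1)[OF g that] by (auto intro: card_ge_0_finite)
  qed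
  also have "\<Union>(orbit g ` {..<d}) = {..<d}"
    using permutes_orbit_subset[OF g] permutation_self_in_orbit[of g] g by (fastforce simp: permutation_permutes)
  finally show ?thesis
    using orbit_card_bounds(1)[OF g] by (fastforce simp: partitions_def cycle_type_def)
qed

lemma transposition_lists_permutes:
  "ts \<in> transposition_lists d b \<Longrightarrow> foldr (\<circ>) ts id permutes {..<d}"
proof (induction b arbitrary: ts)
  case (Suc b)
  then obtain i j ts' where ts: "ts = transpose i j # ts'" "i < d" "j < d" "ts' \<in> transposition_lists d b"
    by (auto simp: set_Cons_def transpositions_def)
  have "transpose i j \<circ> foldr (\<circ>) ts' id permutes {..<d}"
    by (rule permutes_compose[OF Suc.IH[OF ts(4)]]) (rule permutes_swap_id, use ts in auto)
  moreover have "foldr (\<circ>) ts id = transpose i j \<circ> foldr (\<circ>) ts' id" by (simp add: ts(1))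
  ultimately show ?case by (simp only:)
qed (auto simp: permutes_id)

lemma finite_transposition_lists: "finite (transposition_lists d b)"
  by (rule finite_listset) (auto simp: finite_transpositions)

text \<open>The second monodromy is forced to be the inverse of the product of the transpositions
  with \<open>g\<close>, and inversion preserves the cycle type.\<close>

lemma Cov_transpositions:
  "Cov d (conj_class d \<mu> # conj_class d \<nu> # replicate b (transpositions d)) =
    of_nat (card {(g, ts). g permutes {..<d} \<and> ts \<in> transposition_lists d b \<and>
      cycle_type d g = \<mu> \<and> cycle_type d (foldr (\<circ>) ts id \<circ> g) = \<nu>}) / fact d"
proof -
  let ?A = "{gs \<in> listset (conj_class d \<mu> # conj_class d \<nu> # replicate b (transpositions d)). foldr (\<circ>) gs id = id}"
  let ?B = "{(g, ts). g permutes {..<d} \<and> ts \<in> transposition_lists d b \<and>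
      cycle_type d g = \<mu> \<and> cycle_type d (foldr (\<circ>) ts id \<circ> g) = \<nu>}"
  let ?F = "\<lambda>ts. foldr (\<circ>) ts (id :: nat \<Rightarrow> nat)"
  let ?f = "\<lambda>(g, ts). g # inv_into UNIV (?F ts \<circ> g) # ts"
  have type_inv: "cycle_type d (inv_into UNIV h) = cycle_type d h" if "h permutes {..<d}" for h
    using that orbit_inv_eq[of h] by (simp add: cycle_type_def permutation_permutes fun_eq_iff) (metis finite_lessThan)
  have "bij_betw ?f ?B ?A"
  proof (rule bij_betw_imageI)
    show "inj_on ?f ?B" by (auto simp: inj_on_def)
    show "?f ` ?B = ?A"
    proof (intro Set.set_eqI iffI)
      fix gs assume "gs \<in> ?f ` ?B"
      then obtain g ts where *: "gs = g # inv_into UNIV (?F ts \<circ> g) # ts" "g permutes {..<d}"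
        "ts \<in> transposition_lists d b" "cycle_type d g = \<mu>" "cycle_type d (?F ts \<circ> g) = \<nu>" by auto
      have F: "?F ts permutes {..<d}" by (rule transposition_lists_permutes) fact
      have Fg: "?F ts \<circ> g permutes {..<d}" using * F by (intro permutes_compose)
      have "g \<circ> (inv_into UNIV (?F ts \<circ> g) \<circ> ?F ts) = id"
      proof -
        have "inv_into UNIV (?F ts \<circ> g) = inv_into UNIV g \<circ> inv_into UNIV (?F ts)"
          using F *(2) by (intro o_inv_distrib) (auto simp: permutes_bij)
        then show ?thesis
          using permutes_inv_o[OF F] permutes_inv_o[OF *(2)] by (simp add: o_assoc)
      qed
      then show "gs \<in> ?A"
        using * type_inv[OF Fg] permutes_inv[OF Fg] by (auto simp: set_Cons_def conj_class_def)
    next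
      fix gs assume "gs \<in> ?A"
      then obtain g h ts where *: "gs = g # h # ts" "g permutes {..<d}" "cycle_type d g = \<mu>"
        "h permutes {..<d}" "cycle_type d h = \<nu>" "ts \<in> transposition_lists d b" "g \<circ> (h \<circ> ?F ts) = id"
        by (auto simp: set_Cons_def conj_class_def)
      have F: "?F ts permutes {..<d}" by (rule transposition_lists_permutes) fact
      have Fg: "?F ts \<circ> g permutes {..<d}" using * F by (intro permutes_compose)
      have "h \<circ> ?F ts = inv_into UNIV g"
        using *(2,7) by (metis inv_unique_comp permutes_inv_o(2) o_assoc comp_id id_comp)
      then have "h \<circ> (?F ts \<circ> g) = id" using permutes_inv_o(2)[OF *(2)] by (simp add: o_assoc)
      then have h: "h = inv_into UNIV (?F ts \<circ> g)"
        using permutes_inv_o(1)[OF Fg] by (metis o_assoc comp_id id_comp)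
      then have "cycle_type d (?F ts \<circ> g) = \<nu>" using type_inv[OF Fg] *(5) by simp
      then show "gs \<in> ?f ` ?B" using * h by (auto simp: image_iff)
    qed
  qed
  then have "card ?B = card ?A" by (rule bij_betw_same_card)
  then show ?thesis by (simp add: Cov_def)
qed

text \<open>Grouping by cycle types replaces the sums over partitions by a sum over actual
  permutations, where one more transposition is simply a multiplication on the left.\<close>

lemma tau_nth:
  "tau $ d $ b = pconst (1 / (fact d * fact b)) * (\<Sum>g | g permutes {..<d}. \<Sum>ts\<in>transposition_lists d b.
     p_weight d g * p'_weight d (foldr (\<circ>) ts id \<circ> g))"
proof -
  let ?S = "{g. g permutes {..<d}} \<times> transposition_lists d b"
  let ?ty = "\<lambda>(g, ts). (cycle_type d g, cycle_type d (foldr (\<circ>) ts id \<circ> g))"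
  let ?X = "\<lambda>\<mu>. \<Prod>i\<in>#\<mu>. var_poly (P i)"
  let ?Y = "\<lambda>\<nu>. \<Prod>i\<in>#\<nu>. var_poly (P' i)"
  have fin: "finite ?S" by (intro finite_cartesian_product finite_permutations finite_transposition_lists) auto
  have "tau $ d $ b = (\<Sum>(\<mu>, \<nu>)\<in>partitions d \<times> partitions d.
       pconst (Cov d (conj_class d \<mu> # conj_class d \<nu> # replicate b (transpositions d)) / fact b) * ?X \<mu> * ?Y \<nu>)"
    unfolding tau_def by (simp add: sum.cartesian_product)
  also have "\<dots> = (\<Sum>(\<mu>, \<nu>)\<in>partitions d \<times> partitions d. \<Sum>x\<in>{x \<in> ?S. ?ty x = (\<mu>, \<nu>)}.
       pconst (1 / (fact d * fact b)) * (?X (fst (?ty x)) * ?Y (snd (?ty x))))"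
  proof (intro sum.cong refl, clarify)
    fix \<mu> \<nu>
    have "{(g, ts). g permutes {..<d} \<and> ts \<in> transposition_lists d b \<and>
      cycle_type d g = \<mu> \<and> cycle_type d (foldr (\<circ>) ts id \<circ> g) = \<nu>} = {x \<in> ?S. ?ty x = (\<mu>, \<nu>)}" by auto
    then have "pconst (Cov d (conj_class d \<mu> # conj_class d \<nu> # replicate b (transpositions d)) / fact b)
      = pconst (of_nat (card {x \<in> ?S. ?ty x = (\<mu>, \<nu>)}) * (1 / (fact d * fact b)))"
      by (simp add: Cov_transpositions)
    also have "\<dots> = of_nat (card {x \<in> ?S. ?ty x = (\<mu>, \<nu>)}) * pconst (1 / (fact d * fact b))"
      by (simp only: pconst_mult pconst_of_nat)
    finally have "pconst (Cov d (conj_class d \<mu> # conj_class d \<nu> # replicate b (transpositions d)) / fact b) * ?X \<mu> * ?Y \<nu>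
      = (\<Sum>x\<in>{x \<in> ?S. ?ty x = (\<mu>, \<nu>)}. pconst (1 / (fact d * fact b)) * (?X \<mu> * ?Y \<nu>))"
      by (simp add: mult.assoc)
    also have "\<dots> = (\<Sum>x\<in>{x \<in> ?S. ?ty x = (\<mu>, \<nu>)}. pconst (1 / (fact d * fact b)) * (?X (fst (?ty x)) * ?Y (snd (?ty x))))"
      by (intro sum.cong refl) auto
    finally show "pconst (Cov d (conj_class d \<mu> # conj_class d \<nu> # replicate b (transpositions d)) / fact b) * ?X \<mu> * ?Y \<nu>
      = \<dots>" .
  qed
  also have "\<dots> = (\<Sum>y\<in>partitions d \<times> partitions d. \<Sum>x\<in>{x \<in> ?S. ?ty x = y}.
       pconst (1 / (fact d * fact b)) * (?X (fst (?ty x)) * ?Y (snd (?ty x))))"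
    by (intro sum.cong refl) auto
  also have "\<dots> = (\<Sum>x\<in>?S. pconst (1 / (fact d * fact b)) * (?X (fst (?ty x)) * ?Y (snd (?ty x))))"
  proof (rule sum.group[OF fin])
    show "finite (partitions d \<times> partitions d)" by (simp add: finite_partitions)
    show "?ty ` ?S \<subseteq> partitions d \<times> partitions d"
      using transposition_lists_permutes by (auto intro!: cycle_type_partitions permutes_compose)
  qed
  also have "\<dots> = pconst (1 / (fact d * fact b)) * (\<Sum>(g, ts)\<in>?S. p_weight d g * p'_weight d (foldr (\<circ>) ts id \<circ> g))"
    unfolding sum_distrib_left by (intro sum.cong refl) (auto simp: prod_cycle_type)
  finally show ?thesis by (simp add: sum.cartesian_product)
qed

lemma cycle_weight_bounded:
  assumes "g permutes {..<d}" "\<And>k. 1 \<le> k \<Longrightarrow> k \<le> d \<Longrightarrow> b k \<in> bounded_polys m"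
  shows "cycle_weight b {..<d} g \<in> bounded_polys m"
  unfolding cycle_weight_def by (intro bounded_polys_prod assms(2) orbit_card_bounds[OF assms(1)])

text \<open>Cycles of a permutation of d points have length at most d, so no p'_k with k > d
  occurs.\<close>

lemma tau_bounded: "d \<le> m \<Longrightarrow> tau $ d $ b \<in> bounded_polys m"
  unfolding tau_nth
  by (intro bounded_polys.mult bounded_polys.const bounded_polys_sum cycle_weight_bounded)
     (auto intro!: bounded_polys.P bounded_polys.P' permutes_compose transposition_lists_permutes)

lemma power_sums_p'_weight: "power_sums m (p'_weight d g) = ysum m d g"
  and power_sums_p_weight: "power_sums m (p_weight d g) = p_weight d g"
  by (simp_all add: cycle_weight_def power_sums.hom_prod ysum_def)

lemma power_sums_tau_nth:
  "power_sums m (tau $ d $ b) = pconst (1 / (fact d * fact b)) *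
     (\<Sum>g | g permutes {..<d}. \<Sum>ts\<in>transposition_lists d b. p_weight d g * ysum m d (foldr (\<circ>) ts id \<circ> g))"
  unfolding tau_nth
  by (simp only: power_sums.hom_mult power_sums_pconst power_sums.hom_sum power_sums_p_weight power_sums_p'_weight)

text \<open>The coefficient form of differentiation in \<beta>. A transposition put at the head of
  the list changes the second permutation only, so the P-weight of \<open>g\<close> is a constant
  for \<open>cut_join\<close> and \<open>cut_join_ysum\<close> applies to each summand.\<close>

lemma power_sums_tau_rec:
  "of_nat (Suc b) * (vdm m * power_sums m (tau $ d $ Suc b)) = cut_join m (vdm m * power_sums m (tau $ d $ b))"
proof -
  let ?F = "\<lambda>ts. foldr (\<circ>) ts (id :: nat \<Rightarrow> nat)"
  have eP: "euler i (p_weight d g) = 0" for i g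
    unfolding cycle_weight_def by (subst euler.prod) (auto simp: euler_def)
  have L: "(\<Sum>ts\<in>transposition_lists d (Suc b). f ts) = (\<Sum>ts\<in>transposition_lists d b. \<Sum>t\<in>transpositions d. f (t # ts))"
    for f :: "(nat \<Rightarrow> nat) list \<Rightarrow> ppoly"
  proof -
    have "transposition_lists d (Suc b) = (\<lambda>(ts, t). t # ts) ` (transposition_lists d b \<times> transpositions d)"
      by (auto simp: set_Cons_def)
    moreover have "inj_on (\<lambda>(ts, t). t # ts) (transposition_lists d b \<times> transpositions d)"
      by (auto simp: inj_on_def)
    ultimately show ?thesis
      by (simp add: sum.reindex sum.cartesian_product case_prod_unfold)
  qed
  have "cut_join m (vdm m * power_sums m (tau $ d $ b)) =
    pconst (1 / (fact d * fact b)) * (\<Sum>g | g permutes {..<d}. \<Sum>ts\<in>transposition_lists d b.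
      p_weight d g * cut_join m (vdm m * ysum m d (?F ts \<circ> g)))"
  proof -
    have "vdm m * power_sums m (tau $ d $ b) = pconst (1 / (fact d * fact b)) *
      (\<Sum>g | g permutes {..<d}. \<Sum>ts\<in>transposition_lists d b. p_weight d g * (vdm m * ysum m d (?F ts \<circ> g)))"
      unfolding power_sums_tau_nth sum_distrib_left by (simp only: ac_simps)
    then show ?thesis by (simp add: cut_join_cmult cut_join_sum eP)
  qed
  also have "\<dots> = pconst (1 / (fact d * fact b)) * (\<Sum>g | g permutes {..<d}. \<Sum>ts\<in>transposition_lists d b.
      p_weight d g * (vdm m * (\<Sum>t\<in>transpositions d. ysum m d (t \<circ> (?F ts \<circ> g)))))"
    by (intro arg_cong2[of _ _ _ _ "(*)"] sum.cong refl, subst cut_join_ysum)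
       (auto intro!: permutes_compose transposition_lists_permutes)
  also have "\<dots> = pconst (1 / (fact d * fact b)) * (vdm m * (\<Sum>g | g permutes {..<d}. \<Sum>ts\<in>transposition_lists d (Suc b).
      p_weight d g * ysum m d (?F ts \<circ> g)))"
    unfolding L by (simp add: sum_distrib_left o_assoc mult.left_commute)
  also have "pconst (1 / (fact d * fact b)) = of_nat (Suc b) * pconst (1 / (fact d * fact (Suc b)))"
    unfolding pconst_of_nat[symmetric] pconst_mult[symmetric] by (simp add: field_simps del: of_nat_Suc)
  finally show ?thesis unfolding power_sums_tau_nth by (simp only: ac_simps)
qed

text \<open>Without transpositions both weights belong to the same permutation and multiply cycle by
  cycle, which leaves the Cauchy kernel.\<close>

lemma power_sums_tau_0:
  "power_sums m (tau $ d $ 0) =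
    (\<Prod>i<m. Abs_fps (\<lambda>l. complete_sum (\<lambda>k. var_poly (P k)) l * yv i ^ l)) $ d"
proof -
  have "power_sums m (tau $ d $ 0) = complete_sum (\<lambda>k. var_poly (P k) * (\<Sum>i<m. yv i ^ k)) d"
    unfolding power_sums_tau_nth complete_sum_def
    by (simp add: ysum_def cycle_weight_def prod.distrib)
  then show ?thesis by (simp only: complete_sum_power_sum)
qed

section \<open>The determinantal tau function\<close>

abbreviation hP :: "nat \<Rightarrow> ppoly" where
  "hP \<equiv> complete_sum (\<lambda>k. var_poly (P k))"

abbreviation hP' :: "nat \<Rightarrow> ppoly" where
  "hP' \<equiv> complete_sum (\<lambda>k. var_poly (P' k))"

definition content_weight :: "rat \<Rightarrow> nat \<Rightarrow> bseries" where
  "content_weight s l = exp_beta (of_nat l * (of_nat l - 1) / 2 + s * of_nat l)"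

text \<open>The series f of the overview differentiated j times in p_1 and k times in p'_1. Each
  derivative lowers the index of a complete homogeneous function, and the guard makes negative
  indices vanish.\<close>

definition wave :: "rat \<Rightarrow> nat \<Rightarrow> nat \<Rightarrow> qseries" where
  "wave s j k = Abs_fps (\<lambda>l. if j \<le> l \<and> k \<le> l
     then content_weight s l * fps_const (hP (l - j) * hP' (l - k)) else 0)"

lemma pderiv_hP:
  "ppoly_deriv (P 1) (hP n) = (if n = 0 then 0 else hP (n - 1))"
  "ppoly_deriv (P' 1) (hP' n) = (if n = 0 then 0 else hP' (n - 1))"
  "ppoly_deriv (P 1) (hP' n) = 0"
  "ppoly_deriv (P' 1) (hP n) = 0"
  using pderiv_complete_sum[of "P 1" "\<lambda>k. var_poly (P k)" 1 n]
    pderiv_complete_sum[of "P' 1" "\<lambda>k. var_poly (P' k)" 1 n]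
    pderiv_complete_sum[of "P 1" "\<lambda>k. var_poly (P' k)" 0 n]
    pderiv_complete_sum[of "P' 1" "\<lambda>k. var_poly (P k)" 0 n]
  by auto

lemma content_weight_nth: "content_weight s l $ b =
    pconst ((of_nat l * (of_nat l - 1) / 2 + s * of_nat l) ^ b / fact b)"
  by (simp add: content_weight_def)

lemma wave_nth: "wave s j k $ l = (if j \<le> l \<and> k \<le> l
    then content_weight s l * fps_const (hP (l - j) * hP' (l - k)) else 0)"
  by (simp add: wave_def)

lemma partial_wave: "partial (P 1) (wave s j k) = wave s (Suc j) k"
  and partial'_wave: "partial (P' 1) (wave s j k) = wave s j (Suc k)"
proof -
  have "partial (P 1) (wave s j k) $ l $ b = wave s (Suc j) k $ l $ b" for l b
    by (cases "l = j") (auto simp: wave_nth content_weight_nth pderiv.mult pderiv_hP[unfolded One_nat_def] Suc_le_eq)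
  then show "partial (P 1) (wave s j k) = wave s (Suc j) k" by (intro fps_ext)
  have "partial (P' 1) (wave s j k) $ l $ b = wave s j (Suc k) $ l $ b" for l b
    by (cases "l = k") (auto simp: wave_nth content_weight_nth pderiv.mult pderiv_hP[unfolded One_nat_def] Suc_le_eq)
  then show "partial (P' 1) (wave s j k) = wave s j (Suc k)" by (intro fps_ext)
qed

abbreviation qconst :: "ppoly \<Rightarrow> qseries" where
  "qconst f \<equiv> fps_const (fps_const f)"

interpretation qconst: comm_ring_hom qconst
  by standard simp_all

interpretation fps_const: comm_ring_hom "fps_const :: 'a::comm_ring_1 \<Rightarrow> 'a fps"
  by standard simp_all

definition power_sums_q :: "nat \<Rightarrow> qseries \<Rightarrow> qseries" where
  "power_sums_q m = fps_map (fps_map (power_sums m))"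

interpretation power_sums_q: comm_ring_hom "power_sums_q m" for m
  unfolding power_sums_q_def
  by (intro comm_ring_hom_fps_map power_sums.comm_ring_hom_axioms)

lemma power_sums_q_nth: "power_sums_q m F $ l $ b = power_sums m (F $ l $ b)"
  by (simp add: power_sums_q_def)

lemma (in comm_ring_hom) hom_fdet: "hom (fdet m f) = fdet m (\<lambda>i j. hom (f i j))"
  by (simp add: fdet_perms hom_distribs)

lemma fdet_scale_rows: "fdet m (\<lambda>i j. c i * f i j) = (\<Prod>i<m. c i) * fdet m f"
  unfolding fdet_perms sum_distrib_left by (intro sum.cong refl) (simp add: prod.distrib ac_simps)

lemma fdet_scale_columns: "fdet m (\<lambda>i j. c j * f i j) = (\<Prod>j<m. c j) * fdet m f"
  using fdet_scale_rows[of m c "\<lambda>i j. f j i"] fdet_transpose[of m f] fdet_transpose[of m "\<lambda>i j. c j * f i j"]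
  by simp

text \<open>What remains of the entries after specialisation and recombination of the columns: the
  factor h(l-k) in P' becomes y_i^l, so each column involves a single variable y_i.\<close>

definition alternant_entry :: "rat \<Rightarrow> nat \<Rightarrow> nat \<Rightarrow> qseries" where
  "alternant_entry s j i = Abs_fps (\<lambda>l. if j \<le> l
     then content_weight s l * fps_const (hP (l - j) * yv i ^ l) else 0)"

lemma alternant_entry_nth: "alternant_entry s j i $ l = (if j \<le> l
    then content_weight s l * fps_const (hP (l - j) * yv i ^ l) else 0)"
  by (simp add: alternant_entry_def)

lemma power_sums_hP: "power_sums m (hP n) = hP n"
  using psubst_complete_sum by (simp add: power_sums_def)

lemma power_sums_hP': "Abs_fps (\<lambda>n. power_sums m (hP' n)) = (\<Prod>j<m. Abs_fps (\<lambda>l. yv j ^ l))"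
proof (rule fps_ext)
  fix n
  have "power_sums m (hP' n) = complete_sum (\<lambda>k. \<Sum>i<m. yv i ^ k) n"
    using psubst_complete_sum by (simp add: power_sums_def)
  then show "Abs_fps (\<lambda>n. power_sums m (hP' n)) $ n = (\<Prod>j<m. Abs_fps (\<lambda>l. yv j ^ l)) $ n"
    using complete_sum_power_sum[of "\<lambda>_. 1" yv m n] by (simp add: complete_sum_one)
qed

lemma wave_alternant_entry:
  assumes i: "i < m"
  shows "(\<Sum>k<m. power_sums_q m (wave s j k) * qconst (coeff (omit_poly m yv i) k)) = alternant_entry s j i"
proof -
  have "(\<Sum>k<m. power_sums_q m (wave s j k) * qconst (coeff (omit_poly m yv i) k)) $ l $ b =
      alternant_entry s j i $ l $ b" for l b
  proof (cases "j \<le> l")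
    case True
    let ?c = "content_weight s l $ b"
    have c: "power_sums m ?c = ?c" by (simp add: content_weight_nth)
    have "(\<Sum>k<m. power_sums_q m (wave s j k) * qconst (coeff (omit_poly m yv i) k)) $ l $ b =
       (\<Sum>k<m. (?c * hP (l - j)) * ((if k \<le> l then power_sums m (hP' (l - k)) else 0) * coeff (omit_poly m yv i) k))"
      unfolding fps_sum_nth
      by (intro sum.cong refl)
         (use True in \<open>simp add: power_sums_q_nth wave_nth power_sums.hom_mult c power_sums_hP mult.assoc\<close>)
    also have "\<dots> = ?c * hP (l - j) * yv i ^ l"
      unfolding sum_distrib_left[symmetric] complete_homogeneous_column[OF power_sums_hP' i] ..
    finally show ?thesis using True by (simp add: alternant_entry_nth mult.assoc)
  qed (simp add: fps_sum_nth power_sums_q_nth wave_nth alternant_entry_nth)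
  then show ?thesis by (intro fps_ext)
qed

text \<open>The Vandermonde factor is the determinant of the column operations that pass from
  complete homogeneous functions to powers.\<close>

lemma fdet_wave_alternant:
  "power_sums_q m (fdet m (wave s)) * qconst (vdm m) = fdet m (alternant_entry s)"
proof -
  have "fdet m (alternant_entry s) = fdet m (\<lambda>j i. \<Sum>k<m. power_sums_q m (wave s j k) *
      qconst (coeff (omit_poly m yv i) k))"
    by (rule fdet_cong) (simp add: wave_alternant_entry)
  also have "\<dots> = fdet m (\<lambda>j k. power_sums_q m (wave s j k)) * fdet m (\<lambda>k i. qconst (coeff (omit_poly m yv i) k))"
    by (rule fdet_mult)
  finally show ?thesis
    using fdet_omit_poly[OF power_sums_hP', of m]
    by (simp add: power_sums_q.hom_fdet qconst.hom_fdet[symmetric] vdm_def)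
qed

subsection \<open>Evolution in \<open>\<beta>\<close>\<close>

interpretation fps_deriv: derivation "fps_deriv :: ppoly fps \<Rightarrow> ppoly fps"
  by standard simp_all

definition beta_deriv :: "qseries \<Rightarrow> qseries" where
  "beta_deriv = fps_map fps_deriv"

lemma beta_deriv_nth: "beta_deriv F $ l $ b = of_nat (Suc b) * F $ l $ Suc b"
  by (simp add: beta_deriv_def)

interpretation beta_deriv: derivation beta_deriv
  unfolding beta_deriv_def by (rule derivation_fps_map) (rule fps_deriv.derivation_axioms)

definition euler_q :: "nat \<Rightarrow> qseries \<Rightarrow> qseries" where
  "euler_q i = fps_map (fps_map (euler i))"

interpretation euler_q: derivation "euler_q i" for i
  unfolding euler_q_def by (intro derivation_fps_map euler.derivation_axioms)

lemma euler_q_nth: "euler_q i F $ l $ b = euler i (F $ l $ b)"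
  by (simp add: euler_q_def)

text \<open>The one-variable part of \<open>cut_join\<close>, lifted to series. The additive
  constant is kept apart because it cannot be distributed over the columns of a determinant; an
  exponential in \<beta> will supply it.\<close>

definition casimir_q :: "nat \<Rightarrow> nat \<Rightarrow> qseries \<Rightarrow> qseries" where
  "casimir_q m i F = qconst (pconst (1 / 2)) * (euler_q i (euler_q i F) - euler_q i F)
     - qconst (of_nat (m - 1)) * euler_q i F"

lemma casimir_q_sum: "casimir_q m i (\<Sum>x\<in>A. F x) = (\<Sum>x\<in>A. casimir_q m i (F x))"
  by (simp add: casimir_q_def euler_q.sum sum_distrib_left flip: sum_subtractf)

lemma casimir_q_mult:
  assumes "euler_q i R = 0"
  shows "casimir_q m i (F * R) = casimir_q m i F * R"
  by (simp add: casimir_q_def euler_q.mult assms algebra_simps)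

lemma cut_join_q_nth:
  "(\<Sum>i<m. casimir_q m i F) $ l $ b + pconst (casimir m) * F $ l $ b = cut_join m (F $ l $ b)"
  by (simp add: cut_join_def casimir_q_def fps_sum_nth euler_q_nth)

lemma euler_q_alternant_entry:
  "i \<noteq> i' \<Longrightarrow> euler_q i (alternant_entry s j i') = 0"
  "euler_q i (alternant_entry s j i) $ l = of_nat l * alternant_entry s j i $ l"
proof -
  have eh: "euler i (hP n) = 0" for n i
    using pderiv_complete_sum[of "P' i" "\<lambda>k. var_poly (P k)" 0 n] by (simp add: euler_def)
  have ey: "euler i (yv i' ^ l) = (if i = i' then of_nat l * yv i ^ l else 0)" for i i' l
    by (induction l) (auto simp: euler.mult euler_yv algebra_simps)
  show "euler_q i (alternant_entry s j i) $ l = of_nat l * alternant_entry s j i $ l"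
    by (rule fps_ext)
       (auto simp: euler_q_nth alternant_entry_nth content_weight_nth euler.mult eh ey
          fps_of_nat[symmetric] algebra_simps simp del: fps_const_mult)
  assume "i \<noteq> i'"
  then have "euler_q i (alternant_entry s j i') $ l $ b = 0 $ l $ b" for l b
    by (simp add: euler_q_nth alternant_entry_nth content_weight_nth euler.mult eh ey)
  then show "euler_q i (alternant_entry s j i') = 0" by (intro fps_ext)
qed

lemma fps_deriv_exp_beta: "fps_deriv (exp_beta c) = fps_const (pconst c) * exp_beta c"
proof (rule fps_ext)
  fix n
  have "of_nat (n + 1) * pconst (c ^ (n + 1) / fact (n + 1)) = pconst c * pconst (c ^ n / fact n)"
  proof -
    have "of_nat (Suc n) * (c ^ Suc n / fact (Suc n)) = c * (c ^ n / fact n)"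
      by (simp add: field_simps del: of_nat_Suc)
    then show ?thesis unfolding pconst_of_nat[symmetric] pconst_mult[symmetric] by simp
  qed
  then show "fps_deriv (exp_beta c) $ n = (fps_const (pconst c) * exp_beta c) $ n"
    by (simp only: fps_deriv_nth exp_beta_nth fps_mult_left_const_nth)
qed

text \<open>This fixes s = 1 - m: the operator multiplies y_i^l by l(l-1)/2 - (m-1)l, which must be
  the exponent in \<open>content_weight\<close>. With m \<ge> 1 the truncated \<open>m - 1\<close>
  is the true difference.\<close>

lemma beta_deriv_alternant_entry:
  assumes m: "m \<ge> 1"
  shows "beta_deriv (alternant_entry (1 - of_nat m) j i) = casimir_q m i (alternant_entry (1 - of_nat m) j i)"
proof (rule fps_ext)
  fix l
  let ?s = "1 - of_nat m :: rat" let ?e = "of_nat l * (of_nat l - 1) / 2 + ?s * of_nat l :: rat"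
  let ?G = "alternant_entry ?s j i"
  have "beta_deriv ?G $ l = fps_const (pconst ?e) * ?G $ l"
    by (simp add: beta_deriv_def alternant_entry_nth content_weight_def fps_deriv_exp_beta mult.assoc)
  also have "?e = 1 / 2 * (of_nat l * of_nat l - of_nat l) - of_nat (m - 1) * of_nat l"
    using m by (simp add: of_nat_diff field_simps)
  also have "fps_const (pconst \<dots>) =
      fps_const (pconst (1 / 2)) * (of_nat l * of_nat l - of_nat l) - fps_const (of_nat (m - 1)) * of_nat l"
    unfolding pconst_diff pconst_mult pconst_of_nat fps_of_nat[symmetric] fps_const_sub[symmetric] fps_const_mult[symmetric] ..
  also have "\<dots> * ?G $ l = casimir_q m i ?G $ l"
  proof -
    have "euler_q i (euler_q i ?G) $ l = of_nat l * (of_nat l * ?G $ l)"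
    proof (rule fps_ext)
      fix b
      have "euler_q i (euler_q i ?G) $ l $ b = euler i ((of_nat l * ?G $ l) $ b)"
        by (simp only: euler_q_nth[of i "euler_q i ?G"] euler_q_alternant_entry(2))
      also have "\<dots> = of_nat l * euler i (?G $ l $ b)"
        by (simp add: fps_of_nat[symmetric] euler.mult euler.of_nat)
      also have "\<dots> = of_nat l * (of_nat l * ?G $ l) $ b"
        by (simp only: euler_q_nth[of i ?G, symmetric] euler_q_alternant_entry(2))
      finally show "euler_q i (euler_q i ?G) $ l $ b = (of_nat l * (of_nat l * ?G $ l)) $ b"
        by (simp add: fps_of_nat[symmetric])
    qed
    moreover have "(h * (a * a - a) - r * a) * g = h * (a * (a * g) - a * g) - r * (a * g)" for h a r g :: bseries
      by (simp add: algebra_simps)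
    ultimately show ?thesis
      by (simp add: casimir_q_def euler_q_alternant_entry(2))
  qed
  finally show "beta_deriv ?G $ l = casimir_q m i ?G $ l" .
qed

text \<open>The operator has order two, yet in each term of the determinant y_i occurs in one factor
  only. So there are no cross terms, and the sum over i reproduces the Leibniz rule for the
  derivative in \<beta>.\<close>

lemma beta_deriv_alternant:
  assumes m: "m \<ge> 1"
  shows "beta_deriv (fdet m (alternant_entry (1 - of_nat m))) =
    (\<Sum>i<m. casimir_q m i (fdet m (alternant_entry (1 - of_nat m))))"
proof -
  let ?G = "\<lambda>p i. alternant_entry (1 - of_nat m) (p i) i"
  let ?R = "\<lambda>p i. \<Prod>j\<in>{..<m} - {i}. ?G p j"
  have R: "euler_q i (?R p i) = 0" for i and p :: "nat \<Rightarrow> nat"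
    by (subst euler_q.prod) (auto simp: euler_q_alternant_entry(1) intro!: sum.neutral)
  \<comment> \<open>Expanded along the transpose, so that products run over the variables and the
    permutation selects the row index.\<close>
  have W: "fdet m (alternant_entry (1 - of_nat m)) = (\<Sum>p | p permutes {..<m}. (\<Prod>i<m. ?G p i) * signof p)"
    by (subst fdet_transpose[symmetric]) (simp add: fdet_perms mult.commute)
  have "(\<Sum>i<m. casimir_q m i (fdet m (alternant_entry (1 - of_nat m)))) =
      (\<Sum>p | p permutes {..<m}. (\<Sum>i<m. casimir_q m i (\<Prod>i<m. ?G p i)) * signof p)"
    unfolding W casimir_q_sum sum_distrib_right
    by (subst sum.swap) (simp add: casimir_q_mult euler_q.sign)
  also have "\<dots> = (\<Sum>p | p permutes {..<m}. beta_deriv (\<Prod>i<m. ?G p i) * signof p)"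
  proof (intro sum.cong refl arg_cong2[of _ _ _ _ "(*)"])
    fix p :: "nat \<Rightarrow> nat"
    have "casimir_q m i (\<Prod>i<m. ?G p i) = beta_deriv (?G p i) * ?R p i" if "i < m" for i
    proof -
      have "(\<Prod>i<m. ?G p i) = ?G p i * ?R p i"
        using that by (intro prod.remove) auto
      then show ?thesis by (simp only: casimir_q_mult[OF R] beta_deriv_alternant_entry[OF m])
    qed
    then show "(\<Sum>i<m. casimir_q m i (\<Prod>i<m. ?G p i)) = beta_deriv (\<Prod>i<m. ?G p i)"
      by (simp add: beta_deriv.prod)
  qed
  also have "\<dots> = beta_deriv (fdet m (alternant_entry (1 - of_nat m)))"
    unfolding W by (simp add: beta_deriv.sum beta_deriv.mult beta_deriv.sign)
  finally show ?thesis ..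
qed

definition staircase :: "nat \<Rightarrow> nat" where
  "staircase m = (\<Sum>j<m. j)"

definition beta_zero :: "qseries \<Rightarrow> ppoly fps" where
  "beta_zero = fps_map (\<lambda>f. f $ 0)"

interpretation beta_zero: comm_ring_hom beta_zero
  unfolding beta_zero_def by (rule comm_ring_hom_fps_map) (standard; simp)

text \<open>At \<beta> = 0 the entry factors as q^j y_i^j times a series depending on i only. Row
  factors collect the power of q, column factors the Cauchy kernel, and a Vandermonde matrix is
  left.\<close>

lemma beta_zero_alternant:
  "beta_zero (fdet m (alternant_entry s)) = fps_X ^ staircase m *
     ((\<Prod>i<m. Abs_fps (\<lambda>l. hP l * yv i ^ l)) * fps_const (vdm m))"
proof -
  let ?H = "\<lambda>i. Abs_fps (\<lambda>l. hP l * yv i ^ l)"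
  have "beta_zero (alternant_entry s j i) = fps_X ^ j * (?H i * fps_const (yv i ^ j))" for i j
  proof (rule fps_ext)
    fix l show "beta_zero (alternant_entry s j i) $ l = (fps_X ^ j * (?H i * fps_const (yv i ^ j))) $ l"
      by (cases "j \<le> l")
         (auto simp: beta_zero_def alternant_entry_nth content_weight_nth fps_X_power_mult_nth mult.assoc
           simp flip: power_add)
  qed
  then have "beta_zero (fdet m (alternant_entry s)) =
      fdet m (\<lambda>j i. fps_X ^ j * (?H i * fps_const (yv i ^ j)))"
    by (simp add: beta_zero.hom_fdet)
  also have "\<dots> = (\<Prod>j<m. fps_X ^ j) * ((\<Prod>i<m. ?H i) * fdet m (\<lambda>j i. fps_const (yv i ^ j)))"
    by (simp only: fdet_scale_rows fdet_scale_columns)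
  also have "fdet m (\<lambda>j i. fps_const (yv i ^ j)) = fps_const (vdm m)"
    using vandermonde[of m yv] fdet_transpose[of m "\<lambda>i j. yv i ^ j"]
    by (simp only: fps_const.hom_fdet[symmetric] vdm_def)
  also have "(\<Prod>j<m. fps_X ^ j) = fps_X ^ staircase m"
    by (simp add: staircase_def power_sum)
  finally show ?thesis .
qed

text \<open>The exponential factor adds the constant of \<open>cut_join\<close>, so both sides obey
  the same recursion in the \<beta>-degree b; it determines everything from b = 0, since
  \<open>Suc b\<close> can be cancelled.\<close>

lemma alternant_tau:
  assumes m: "m \<ge> 1"
  shows "fps_const (exp_beta (casimir m)) * fdet m (alternant_entry (1 - of_nat m)) =
    fps_X ^ staircase m * (qconst (vdm m) * power_sums_q m tau)"
proof -
  let ?W = "fdet m (alternant_entry (1 - of_nat m))"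
  let ?X = "fps_const (exp_beta (casimir m)) * ?W"
  have e0: "euler_q i (fps_const (exp_beta c)) = 0" for i c
    unfolding euler_q_def by (intro fps_ext) (simp add: fps_const_def)
  have "beta_deriv ?X = (\<Sum>i<m. casimir_q m i ?X) + qconst (pconst (casimir m)) * ?X"
  proof -
    have "beta_deriv ?X = beta_deriv (fps_const (exp_beta (casimir m))) * ?W + fps_const (exp_beta (casimir m)) * beta_deriv ?W"
      by (rule beta_deriv.mult)
    also have "beta_deriv (fps_const (exp_beta (casimir m))) = qconst (pconst (casimir m)) * fps_const (exp_beta (casimir m))"
      by (rule fps_ext) (simp add: beta_deriv_def fps_deriv_exp_beta)
    also have "fps_const (exp_beta (casimir m)) * beta_deriv ?W = (\<Sum>i<m. casimir_q m i ?X)"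
      unfolding beta_deriv_alternant[OF m] sum_distrib_left
      by (intro sum.cong refl) (metis casimir_q_mult e0 mult.commute)
    finally show ?thesis by (simp add: algebra_simps)
  qed
  then have "beta_deriv ?X $ K $ b = cut_join m (?X $ K $ b)" for K b
    using cut_join_q_nth[of m ?X K b] by simp
  then have rec: "of_nat (Suc b) * ?X $ K $ Suc b = cut_join m (?X $ K $ b)" for K b
    by (simp only: beta_deriv_nth)
  have "?X $ K $ b = (if K < staircase m then 0 else vdm m * power_sums m (tau $ (K - staircase m) $ b))" for K b
  proof (induction b)
    case 0
    have "?X $ K $ 0 = beta_zero ?W $ K" by (simp add: beta_zero_def)
    then show ?case
      unfolding beta_zero_alternant by (simp add: fps_X_power_mult_nth power_sums_tau_0 mult.commute)
  next
    case (Suc b)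
    have "of_nat (Suc b) * ?X $ K $ Suc b = of_nat (Suc b) *
        (if K < staircase m then 0 else vdm m * power_sums m (tau $ (K - staircase m) $ Suc b))"
      unfolding rec Suc using power_sums_tau_rec[of b m "K - staircase m"] by simp
    then show ?case by (subst (asm) of_nat_cancel) auto
  qed
  then show ?thesis
    by (intro fps_ext) (simp add: fps_X_power_mult_nth power_sums_q_nth)
qed

section \<open>Undoing the specialisation to power sums\<close>

lemma vdm_nonzero: "vdm m \<noteq> 0"
  by (auto simp: vdm_def yv_inj)

definition bounded_series :: "nat \<Rightarrow> qseries set" where
  "bounded_series m = {F. \<forall>d\<le>m. \<forall>b. F $ d $ b \<in> bounded_polys m}"

lemma bounded_series_mult: "F \<in> bounded_series m \<Longrightarrow> G \<in> bounded_series m \<Longrightarrow> F * G \<in> bounded_series m"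
  unfolding bounded_series_def
  by (auto simp: fps_mult_nth fps_sum_nth intro!: bounded_polys_sum bounded_polys.mult)

lemma bounded_series_1 [simp]: "1 \<in> bounded_series m"
  and bounded_series_0 [simp]: "0 \<in> bounded_series m"
  by (auto simp: bounded_series_def)

lemma bounded_series_add: "F \<in> bounded_series m \<Longrightarrow> G \<in> bounded_series m \<Longrightarrow> F + G \<in> bounded_series m"
  and bounded_series_uminus: "F \<in> bounded_series m \<Longrightarrow> - F \<in> bounded_series m"
  by (auto simp: bounded_series_def intro!: bounded_polys.add bounded_polys_uminus)

lemma bounded_series_fdet:
  assumes "\<And>i j. f i j \<in> bounded_series m"
  shows "fdet n f \<in> bounded_series m"
proof -
  have prod: "(\<Prod>x\<in>A. F x) \<in> bounded_series m" if "\<And>x. F x \<in> bounded_series m" for A :: "nat set" and F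
    by (induction A rule: infinite_finite_induct) (auto intro: bounded_series_mult that)
  have sum: "(\<Sum>x\<in>A. F x) \<in> bounded_series m" if "\<And>x. F x \<in> bounded_series m" for A :: "(nat \<Rightarrow> nat) set" and F
    by (induction A rule: infinite_finite_induct) (auto intro: bounded_series_add that)
  have "signof p \<in> bounded_series m" for p :: "nat \<Rightarrow> nat"
    by (auto simp: sign_def intro: bounded_series_uminus)
  then show ?thesis
    unfolding fdet_perms by (intro sum bounded_series_mult prod assms)
qed

text \<open>Column k of \<open>wave\<close> starts at q^k. Once q^k is pulled out, the coefficient
  of q^a contains only h_a in P', hence p'_1, ..., p'_m for a \<le> m. In the unreduced entries the
  relevant degrees are shifted by up to \<open>staircase m\<close>, and the bound would be
  lost.\<close>

definition reduced_wave :: "rat \<Rightarrow> nat \<Rightarrow> nat \<Rightarrow> qseries" where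
  "reduced_wave s j k = Abs_fps (\<lambda>a. if j \<le> a + k
     then content_weight s (a + k) * fps_const (hP (a + k - j) * hP' a) else 0)"

lemma wave_reduced: "wave s j k = fps_X ^ k * reduced_wave s j k"
  by (rule fps_ext) (auto simp: wave_nth reduced_wave_def fps_X_power_mult_nth)

lemma reduced_wave_bounded: "reduced_wave s j k \<in> bounded_series m"
proof -
  have h: "hP n \<in> bounded_polys m" for n
    unfolding complete_sum_def
    by (intro bounded_polys.mult bounded_polys.const bounded_polys_sum cycle_weight_bounded) (auto intro: bounded_polys.P)
  have h': "hP' n \<in> bounded_polys m" if "n \<le> m" for n
    unfolding complete_sum_def
    by (intro bounded_polys.mult bounded_polys.const bounded_polys_sum cycle_weight_bounded)
       (use that in \<open>auto intro: bounded_polys.P'\<close>)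
  show ?thesis
    unfolding bounded_series_def reduced_wave_def
    by (auto simp: content_weight_nth intro!: bounded_polys.mult bounded_polys.const h h')
qed

text \<open>After specialisation \<open>U\<close> and \<open>tau\<close> agree in every degree.
  Injectivity of the specialisation is available for coefficients up to q^m, which is where the
  equality without specialisation ends.\<close>

lemma fdet_wave_tau:
  assumes m: "m \<ge> 1"
  obtains U where "fps_const (exp_beta (casimir m)) * fdet m (wave (1 - of_nat m)) = fps_X ^ staircase m * U"
    "\<And>d. d \<le> m \<Longrightarrow> U $ d = tau $ d"
proof -
  define s :: rat where "s = 1 - of_nat m"
  define U where "U = fps_const (exp_beta (casimir m)) * fdet m (reduced_wave s)"
  have *: "fdet m (wave s) = fps_X ^ staircase m * fdet m (reduced_wave s)"
    unfolding wave_reduced fdet_scale_columns by (simp add: staircase_def power_sum)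
  then have U: "fps_const (exp_beta (casimir m)) * fdet m (wave s) = fps_X ^ staircase m * U"
    by (simp add: U_def mult.left_commute)
  have X: "power_sums_q m (fps_X ^ n) = fps_X ^ n" for n
  proof -
    have "power_sums_q m fps_X = fps_X"
      by (intro fps_ext) (simp add: power_sums_q_nth fps_X_def)
    then show ?thesis by (simp add: power_sums_q.hom_power)
  qed
  have e: "power_sums_q m (fps_const (exp_beta c)) = fps_const (exp_beta c)" for c
    by (intro fps_ext) (simp add: power_sums_q_nth fps_const_def)
  have "fps_X ^ staircase m * (qconst (vdm m) * power_sums_q m U) =
      power_sums_q m (fps_X ^ staircase m * U) * qconst (vdm m)"
    by (simp add: power_sums_q.hom_mult X ac_simps)
  also have "\<dots> = fps_const (exp_beta (casimir m)) * (power_sums_q m (fdet m (wave s)) * qconst (vdm m))"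
    by (simp add: power_sums_q.hom_mult e mult.assoc flip: U)
  also have "\<dots> = fps_X ^ staircase m * (qconst (vdm m) * power_sums_q m tau)"
    unfolding fdet_wave_alternant s_def by (rule alternant_tau[OF m])
  finally have ps: "power_sums_q m U = power_sums_q m tau"
    using vdm_nonzero by simp
  have bU: "U \<in> bounded_series m"
    unfolding U_def
    by (intro bounded_series_mult bounded_series_fdet reduced_wave_bounded)
       (auto simp: bounded_series_def fps_const_def intro: bounded_polys.const)
  have "U $ d $ b = tau $ d $ b" if "d \<le> m" for d b
  proof (rule power_sums_inj[of _ m])
    show "power_sums m (U $ d $ b) = power_sums m (tau $ d $ b)"
      using arg_cong[OF ps, of "\<lambda>F. F $ d $ b"] by (simp add: power_sums_q_nth)
  qed (use that bU in \<open>auto simp: bounded_series_def intro: tau_bounded\<close>)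
  then show ?thesis using that U by (auto simp: s_def intro: fps_ext)
qed

section \<open>The Toda equation\<close>

lemma content_weight_shift: "content_weight (s + r) l = exp_beta r ^ l * content_weight s l"
  unfolding content_weight_def exp_beta_power exp_beta_add[symmetric]
  by (rule arg_cong[of _ _ exp_beta]) (simp add: algebra_simps)

lemma wave_shift: "wave (s + r) j k = subst_q (exp_beta r) (wave s j k)"
  by (rule fps_ext) (simp add: wave_nth content_weight_shift mult.assoc)

lemma subst_q_X: "subst_q c fps_X = fps_const c * fps_X"
  by (rule fps_ext) (simp add: fps_X_def)

lemma subst_q_const: "subst_q c (fps_const a) = fps_const a"
  by (rule fps_ext) (simp add: fps_const_def)

lemma staircase_Suc: "staircase (Suc m) = staircase m + m"
  by (simp add: staircase_def)

text \<open>Passing from m-1 to m in the summands adds j to each old one; the new summand j = m is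
  m(m+1)/2. The difference of this increment, 2m+1, is what the Toda equation uses.\<close>

lemma casimir_Suc: "casimir (Suc m) = casimir m + of_nat (staircase m) + of_nat m * (of_nat m + 1) / 2"
proof (cases m)
  case 0
  then show ?thesis by (simp add: casimir_def staircase_def)
next
  case (Suc k)
  have "casimir (Suc m) = (\<Sum>j<m. of_nat m * of_nat j - of_nat j * (of_nat j - 1) / 2) +
      (of_nat m * of_nat m - of_nat m * (of_nat m - 1) / 2)"
    by (simp add: casimir_def)
  also have "(\<Sum>j<m. of_nat m * of_nat j - of_nat j * (of_nat j - 1) / 2) =
      casimir m + of_nat (staircase m)"
    unfolding casimir_def staircase_def of_nat_sum sum.distrib[symmetric]
    by (intro sum.cong refl) (simp add: Suc algebra_simps)
  finally show ?thesis by (simp add: field_simps)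
qed

lemma fps_mult_nth_cong:
  assumes "\<And>i. i \<le> d \<Longrightarrow> F $ i = F' $ i" "\<And>i. i \<le> d \<Longrightarrow> G $ i = G' $ i"
  shows "(F * G) $ d = (F' * G') $ d"
  unfolding fps_mult_nth by (intro sum.cong refl arg_cong2[of _ _ _ _ "(*)"] assms) auto

text \<open>Rescaling q also acts on the extracted power of q and leaves the exponential of r times
  \<open>staircase m\<close>.\<close>

lemma subst_q_fdet_wave:
  assumes "fps_const (exp_beta (casimir m)) * fdet m (wave s) = fps_X ^ staircase m * U"
  shows "fps_const (exp_beta (casimir m)) * fdet m (wave (s + r)) =
    fps_const (exp_beta (of_nat (staircase m) * r)) * (fps_X ^ staircase m * subst_q (exp_beta r) U)"
proof -
  have "fps_const (exp_beta (casimir m)) * fdet m (wave (s + r)) =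
      subst_q (exp_beta r) (fps_const (exp_beta (casimir m)) * fdet m (wave s))"
    by (simp add: subst_q.hom_mult subst_q_const subst_q.hom_fdet wave_shift[abs_def])
  also have "\<dots> = (fps_const (exp_beta r) * fps_X) ^ staircase m * subst_q (exp_beta r) U"
    by (simp add: assms subst_q.hom_mult subst_q.hom_power subst_q_X)
  finally show ?thesis
    by (simp add: power_mult_distrib fps_const_power exp_beta_power mult.assoc)
qed

lemma exp_beta_nonzero: "exp_beta c \<noteq> 0"
  using exp_beta_inverse[of c] by auto

lemma partial_const_exp: "partial v (fps_const (exp_beta c)) = 0"
  by (intro fps_ext) (simp add: fps_const_def)

lemma partial_X_power: "partial v (fps_X ^ n) = 0"
proof -
  have "partial v fps_X = 0" by (intro fps_ext) (simp add: fps_X_def)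
  then show ?thesis by (simp add: partial.power)
qed

text \<open>The square of F times the mixed derivative of log F, written bilinearly so that no
  division occurs.\<close>

definition toda_form :: "qseries \<Rightarrow> qseries" where
  "toda_form F = F * partial (P 1) (partial (P' 1) F) - partial (P 1) F * partial (P' 1) F"

lemma toda_form_scale:
  assumes "partial (P 1) a = 0" "partial (P' 1) a = 0"
  shows "toda_form (a * F) = a\<^sup>2 * toda_form F"
  by (simp add: toda_form_def partial.mult partial.add assms[unfolded One_nat_def] algebra_simps power2_eq_square)

text \<open>In a two-directional Wronskian the derivatives in p_1 and p'_1 shift the last row and
  the last column; these are precisely the minors in the Desnanot--Jacobi identity.\<close>

lemma toda_fdet_wave:
  assumes "fdet (k + 2) (wave s) \<noteq> 0"
  shows "toda_form (fdet (Suc k) (wave s)) = fdet (k + 2) (wave s) * fdet k (wave s)"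
proof -
  let ?s = "\<lambda>i. if i = k then Suc k else i"
  have c: "partial (P' 1) (fdet (Suc k) (wave s)) = fdet (Suc k) (\<lambda>i j. wave s i (?s j))"
    by (rule partial.fdet_columns) (rule partial'_wave)
  have r: "partial (P 1) (fdet (Suc k) (wave s)) = fdet (Suc k) (\<lambda>i. wave s (?s i))"
    by (rule partial.fdet_rows) (rule partial_wave)
  have rc: "partial (P 1) (fdet (Suc k) (\<lambda>i j. wave s i (?s j))) = fdet (Suc k) (\<lambda>i j. wave s (?s i) (?s j))"
    by (rule partial.fdet_rows) (rule partial_wave)
  show ?thesis
    unfolding toda_form_def c r rc by (rule desnanot_jacobi[OF assms, symmetric])
qed

lemma toda_tau: "toda_form tau = fps_X * (subst_q (exp_beta 1) tau * subst_q (exp_beta (- 1)) tau)"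
proof (rule fps_ext)
  fix d
  \<comment> \<open>All three sizes k, k+1, k+2 then reproduce \<open>tau\<close> through degree d,
    and k is positive even for d = 0.\<close>
  define k where "k = Suc d"
  \<comment> \<open>The parameter proper to the middle size. The sizes k and k+2 have their own at
    s+1 and s-1, so they are shifted by -1 and by 1: the smaller one acquires e^(-\<beta>)q, the
    larger one e^\<beta>q.\<close>
  define s :: rat where "s = 1 - of_nat (Suc k)"
  let ?E = "\<lambda>m. fps_const (exp_beta (casimir m)) :: qseries"
  obtain U0 where U0: "?E k * fdet k (wave (1 - of_nat k)) = fps_X ^ staircase k * U0"
    "\<And>i. i \<le> k \<Longrightarrow> U0 $ i = tau $ i"
    by (rule fdet_wave_tau[of k]) (auto simp: k_def)
  obtain U1 where U1: "?E (Suc k) * fdet (Suc k) (wave (1 - of_nat (Suc k))) = fps_X ^ staircase (Suc k) * U1"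
    "\<And>i. i \<le> Suc k \<Longrightarrow> U1 $ i = tau $ i"
    by (rule fdet_wave_tau[of "Suc k"]) auto
  obtain U2 where U2: "?E (k + 2) * fdet (k + 2) (wave (1 - of_nat (k + 2))) = fps_X ^ staircase (k + 2) * U2"
    "\<And>i. i \<le> k + 2 \<Longrightarrow> U2 $ i = tau $ i"
    by (rule fdet_wave_tau[of "k + 2"]) auto
  have s: "1 - of_nat k + (- 1) = s" "1 - of_nat (k + 2) + 1 = s"
    by (simp_all add: s_def)
  let ?N = "staircase k"
  have N: "staircase (Suc k) = ?N + k" "staircase (k + 2) = ?N + (2 * k + 1)"
    by (simp_all add: staircase_Suc)
  have E0: "?E k * fdet k (wave s) = fps_const (exp_beta (- of_nat ?N)) * (fps_X ^ ?N * subst_q (exp_beta (- 1)) U0)"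
    using subst_q_fdet_wave[OF U0(1), of "- 1"] by (simp only: s mult_minus_right mult_1_right)
  have E2: "?E (k + 2) * fdet (k + 2) (wave s) =
      fps_const (exp_beta (of_nat (?N + (2 * k + 1)))) * (fps_X ^ (?N + (2 * k + 1)) * subst_q (exp_beta 1) U2)"
    using subst_q_fdet_wave[OF U2(1), of 1] by (simp only: s N mult_1_right)
  have E1: "?E (Suc k) * fdet (Suc k) (wave s) = fps_X ^ (?N + k) * U1"
    using U1(1) by (simp only: s_def N)
  \<comment> \<open>The normalised determinant has constant term 1 in q, like
    \<open>tau\<close>.\<close>
  have nz: "fdet (k + 2) (wave s) \<noteq> 0"
  proof
    assume "fdet (k + 2) (wave s) = 0"
    then have "subst_q (exp_beta 1) U2 = 0"
      using E2 exp_beta_nonzero by simp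
    then have "subst_q (exp_beta 1) U2 $ 0 = 0" by simp
    then show False using U2(2)[of 0] by (simp add: tau_nth_0)
  qed
  have X2: "(fps_X ^ (?N + k))\<^sup>2 = fps_X ^ (2 * ?N + 2 * k)"
    by (simp add: power_mult[symmetric] algebra_simps)
  have "(?E (Suc k))\<^sup>2 * toda_form (fdet (Suc k) (wave s)) = fps_X ^ (2 * ?N + 2 * k) * toda_form U1"
    using toda_form_scale[of "?E (Suc k)" "fdet (Suc k) (wave s)"] toda_form_scale[of "fps_X ^ (?N + k)" U1]
    by (simp only: partial_const_exp partial_X_power E1 X2)
  moreover have "?E k * ?E (k + 2) * toda_form (fdet (Suc k) (wave s)) =
      fps_const (exp_beta (of_nat (2 * k + 1))) * (fps_X ^ (2 * ?N + 2 * k) *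
      (fps_X * (subst_q (exp_beta 1) U2 * subst_q (exp_beta (- 1)) U0)))"
  proof -
    have "?E k * ?E (k + 2) * toda_form (fdet (Suc k) (wave s)) =
        (?E (k + 2) * fdet (k + 2) (wave s)) * (?E k * fdet k (wave s))"
      unfolding toda_fdet_wave[OF nz] by (simp only: ac_simps)
    also have "\<dots> = (fps_const (exp_beta (of_nat (?N + (2 * k + 1)))) * fps_const (exp_beta (- of_nat ?N))) *
        ((fps_X ^ (?N + (2 * k + 1)) * fps_X ^ ?N) * (subst_q (exp_beta 1) U2 * subst_q (exp_beta (- 1)) U0))"
      unfolding E0 E2 by (simp only: ac_simps)
    also have "fps_const (exp_beta (of_nat (?N + (2 * k + 1)))) * fps_const (exp_beta (- of_nat ?N)) =
        (fps_const (exp_beta (of_nat (2 * k + 1))) :: qseries)"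
      by (simp add: exp_beta_add[symmetric])
    \<comment> \<open>The outer sizes together carry one more power of q than the square of the
      middle one. This surplus is the factor q of the Toda equation.\<close>
    also have "fps_X ^ (?N + (2 * k + 1)) * fps_X ^ ?N = fps_X ^ (2 * ?N + 2 * k) * (fps_X :: qseries)"
      by (simp add: power_add[symmetric] power_Suc2[symmetric] del: power_Suc)
    finally show ?thesis by (simp only: mult.assoc)
  qed
  \<comment> \<open>The second difference of \<open>casimir\<close> is 2k+1, exactly the exponent
    left by the rescalings, so all exponential factors cancel.\<close>
  moreover have "?E k * ?E (k + 2) = fps_const (exp_beta (of_nat (2 * k + 1))) * (?E (Suc k))\<^sup>2"
  proof -
    have "casimir k + casimir (k + 2) = of_nat (2 * k + 1) + (casimir (Suc k) + casimir (Suc k))"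
      by (simp add: casimir_Suc staircase_Suc field_simps)
    then show ?thesis
      by (simp add: power2_eq_square exp_beta_add[symmetric])
  qed
  ultimately have "fps_const (exp_beta (of_nat (2 * k + 1))) * (fps_X ^ (2 * ?N + 2 * k) * toda_form U1) =
      fps_const (exp_beta (of_nat (2 * k + 1))) * (fps_X ^ (2 * ?N + 2 * k) *
      (fps_X * (subst_q (exp_beta 1) U2 * subst_q (exp_beta (- 1)) U0)))"
    by (simp only: mult.assoc)
  then have *: "toda_form U1 = fps_X * (subst_q (exp_beta 1) U2 * subst_q (exp_beta (- 1)) U0)"
    using exp_beta_nonzero by simp
  have p: "partial v F $ i = partial v G $ i" if "F $ i = G $ i" for v F G i
    using that by (simp add: partial_def)
  have "toda_form U1 $ d = toda_form tau $ d"
    unfolding toda_form_def fps_sub_nth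
    by (intro arg_cong2[of _ _ _ _ "(-)"] fps_mult_nth_cong p U1(2)) (auto simp: k_def)
  moreover have "(fps_X * (subst_q (exp_beta 1) U2 * subst_q (exp_beta (- 1)) U0)) $ d =
      (fps_X * (subst_q (exp_beta 1) tau * subst_q (exp_beta (- 1)) tau)) $ d"
    by (intro fps_mult_nth_cong) (auto simp: k_def U0(2) U2(2))
  ultimately show "toda_form tau $ d = (fps_X * (subst_q (exp_beta 1) tau * subst_q (exp_beta (- 1)) tau)) $ d"
    using * by simp
qed

text \<open>Chain rule for a series with constant coefficients. Since \<open>g\<close> starts at q,
  each coefficient of the composition is a finite sum and can be differentiated term by
  term.\<close>

lemma partial_compose:
  assumes L: "\<And>i. partial v (fps_const (L $ i)) = 0" and g: "g $ 0 = 0"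
  shows "partial v (L oo g) = (fps_deriv L oo g) * partial v g"
proof (rule fps_ext)
  fix n
  let ?\<delta> = "fps_map (ppoly_deriv v)"
  interpret \<delta>: derivation ?\<delta> by (rule derivation_fps_map) (rule derivation_pderiv)
  have nth: "partial v F $ n = ?\<delta> (F $ n)" for F n by (simp add: partial_def)
  have L0: "?\<delta> (L $ i) = 0" for i
    using arg_cong[OF L[of i], of "\<lambda>F. F $ 0"] by (simp add: nth)
  have "partial v (L oo g) $ n = (\<Sum>i=0..n. L $ i * (partial v (g ^ i) $ n))"
    by (simp add: nth fps_compose_nth \<delta>.sum \<delta>.mult L0)
  also have "\<dots> = (\<Sum>i=0..n. of_nat i * L $ i * (g ^ (i - 1) * partial v g) $ n)"
    by (intro sum.cong refl) (simp add: partial.power mult.assoc mult.left_commute fps_of_nat[symmetric])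
  \<comment> \<open>The added term is 0: neither \<open>g\<close> nor its derivative has a constant
    term in q, so \<open>g ^ n * partial v g\<close> starts at q^(n+1). The term i = 0 is 0 as well,
    and the index can be shifted.\<close>
  also have "\<dots> = (\<Sum>i=0..Suc n. of_nat i * L $ i * (g ^ (i - 1) * partial v g) $ n)"
  proof -
    have "(g ^ n * partial v g) $ n = 0"
    proof -
      have "g ^ n $ i * partial v g $ (n - i) = 0" if "i \<le> n" for i
      proof (cases "i = n")
        case True
        have "partial v g $ 0 = 0" using g by (simp add: nth)
        then show ?thesis using True by simp
      next
        case False
        then have "g ^ n $ i = 0" using that g startsby_zero_power_prefix[of g n] by simp
        then show ?thesis by simp
      qed
      then show ?thesis unfolding fps_mult_nth by (intro sum.neutral) simp
    qed
    then show ?thesis by simp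
  qed
  also have "\<dots> = (\<Sum>i=0..n. fps_deriv L $ i * (g ^ i * partial v g) $ n)"
    unfolding sum.atLeast0_atMost_Suc_shift by simp
  also have "\<dots> = (\<Sum>i=0..n. \<Sum>a=0..n. fps_deriv L $ i * (g ^ i $ a * partial v g $ (n - a)))"
    by (simp add: fps_mult_nth sum_distrib_left)
  also have "\<dots> = (\<Sum>a=0..n. (\<Sum>i=0..n. fps_deriv L $ i * g ^ i $ a) * partial v g $ (n - a))"
    by (subst sum.swap) (simp add: sum_distrib_right mult.assoc)
  also have "\<dots> = (\<Sum>a=0..n. (fps_deriv L oo g) $ a * partial v g $ (n - a))"
  proof (intro sum.cong refl arg_cong2[of _ _ _ _ "(*)"])
    fix a assume a: "a \<in> {0..n}"
    have "g ^ i $ a = 0" if "a < i" for i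
      using that g startsby_zero_power_prefix[of g i] by simp
    then show "(\<Sum>i=0..n. fps_deriv L $ i * g ^ i $ a) = (fps_deriv L oo g) $ a"
      unfolding fps_compose_nth using a by (intro sum.mono_neutral_right) auto
  qed
  finally show "partial v (L oo g) $ n = ((fps_deriv L oo g) * partial v g) $ n"
    by (simp add: fps_mult_nth)
qed

text \<open>The derivative of the series of log(1+X) is inverse to 1+X; composed with f - 1 it is
  inverse to f. Multiplying by f keeps the statement free of division.\<close>

lemma partial_qlog:
  assumes f: "f $ 0 = 1"
  shows "partial v (qlog f) * f = partial v f"
proof -
  define L where "L = fps_map (\<lambda>c. fps_const (pconst c)) (fps_ln 1)"
  define g where "g = f - 1"
  have g: "g $ 0 = 0" using f by (simp add: g_def)
  have "partial v (qlog f) = (fps_deriv L oo g) * partial v g"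
    unfolding qlog_def L_def[symmetric] g_def[symmetric]
  proof (rule partial_compose)
    show "partial v (fps_const (L $ i)) = 0" for i
      by (intro fps_ext) (simp add: L_def fps_const_def)
  qed (rule g)
  moreover have "(fps_deriv L oo g) * f = 1"
  proof -
    have "fps_deriv L * (1 + fps_X) = 1"
    proof (rule fps_ext)
      fix n
      have c: "of_nat (Suc n) * L $ Suc n = (- 1) ^ n" for n
      proof -
        have "of_nat (Suc n) * L $ Suc n = fps_const (pconst (of_nat (Suc n) * fps_ln 1 $ Suc n))"
          unfolding L_def fps_map_nth pconst_mult fps_const_mult[symmetric] pconst_of_nat fps_of_nat ..
        also have "of_nat (Suc n) * fps_ln 1 $ Suc n = ((- 1) ^ n :: rat)"
          by (simp add: fps_ln_nth del: of_nat_Suc)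
        finally show ?thesis
          by (simp add: pconst.hom_power pconst_uminus fps_const_power[symmetric] fps_const_neg[symmetric]
              del: fps_const_neg fps_const_power)
      qed
      show "(fps_deriv L * (1 + fps_X)) $ n = 1 $ n"
        using c by (cases n) (simp_all add: distrib_left del: of_nat_Suc)
    qed
    then have "(fps_deriv L * (1 + fps_X)) oo g = 1" by simp
    then have "(fps_deriv L oo g) * ((1 + fps_X) oo g) = 1"
      by (simp only: fps_compose_mult_distrib[OF g])
    then show ?thesis
      using g by (simp add: fps_compose_add_distrib g_def)
  qed
  ultimately show ?thesis
    by (simp add: mult.assoc mult.left_commute[of _ _ f] g_def partial.diff)
qed

theorem mainTheorem2:
  shows "partial (P 1) (partial (P' 1) (qlog tau)) =
    fps_X * (subst_q (exp_beta 1) tau * subst_q (exp_beta (- 1)) tau * qrecip (tau\<^sup>2))"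
proof -
  \<comment> \<open>The quotient rule is replaced by differentiating the product
    \<open>u * tau\<close>; a further multiplication by \<open>tau\<close> produces the bilinear
    form.\<close>
  define u where "u = partial (P' 1) (qlog tau)"
  have u: "u * tau = partial (P' 1) tau"
    unfolding u_def by (rule partial_qlog) (rule tau_nth_0)
  then have u': "partial (P 1) (partial (P' 1) tau) = partial (P 1) u * tau + u * partial (P 1) tau"
    by (metis partial.mult)
  have "tau * (partial (P 1) u * tau) = tau * partial (P 1) (partial (P' 1) tau) - (u * tau) * partial (P 1) tau"
    unfolding u' by (simp add: algebra_simps)
  then have "partial (P 1) u * tau\<^sup>2 = toda_form tau"
    unfolding u by (simp only: toda_form_def power2_eq_square ac_simps)
  then have "partial (P 1) u * (tau\<^sup>2 * qrecip (tau\<^sup>2)) = toda_form tau * qrecip (tau\<^sup>2)"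
    by (simp only: mult.assoc[symmetric])
  then show ?thesis
    unfolding qrecip_tau_square toda_tau by (simp add: u_def mult.assoc)
qed

end
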